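(* Let $\varphi:\mathbb{S}\to\mathbb{S}$ be a homeomorphism and let $h=P[\varphi]:\mathbb{D}\to\mathbb{D}$ be the harmonic Poisson extension of $\varphi$. Then for every $\lambda\in(-1,+\infty)$ the following are equivalent: (i) $\int_{\mathbb{D}}|Dh(z)|^2\log^\lambda(e+|Dh(z)|)\,dz<+\infty$; (ii) $\int_{\mathbb{D}}|Dh(z)|^2\log^\lambda\left(\frac{2}{1-|z|}\right)dz<+\infty$; (iii) $\int_{\mathbb{S}}\int_{\mathbb{S}}\big|\log|\varphi^{-1}(\eta)-\varphi^{-1}(\xi)|\big|^{\lambda+1}\,|d\eta|\,|d\xi|<+\infty$; (iv) $\sum_{j=1}^{\infty}j^\lambda\sum_{k=1}^{2^j}\ell(\varphi(\Gamma_{j,k}))^2<+\infty$; (v) $\sum_{j=1}^{\infty}\sum_{k=1}^{2^j}\ell(\varphi(\Gamma_{j,k}))^2\log^\lambda\left(e+\frac{\ell(\varphi(\Gamma_{j,k}))}{2^{-j}}\right)<+\infty$.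
   Context: $\mathbb{D}$ is the open unit disk in $\mathbb{C}$ and $\mathbb{S}=\partial\mathbb{D}$ is the unit circle. $dz$ denotes two-dimensional Lebesgue (area) measure on $\mathbb{D}$, $|d\xi|$, $|d\eta|$ and $|d\zeta|$ denote integration with respect to arc length on $\mathbb{S}$, $\log^\lambda(t)$ means $(\log t)^\lambda$, and $|Dh(z)|$ is the norm of the (real) differential of $h$ at $z$. The (complex-valued) Poisson extension of $\varphi$ is $P[\varphi](z)=\frac{1}{2\pi}\int_{\mathbb{S}}\frac{1-|z|^2}{|z-\zeta|^2}\varphi(\zeta)\,|d\zeta|$ for $z\in\mathbb{D}$. Dyadic arcs: for $j\in\{1,2,\dots\}$ and $k=1,\dots,2^j$, $\Gamma_{j,k}\subset\mathbb{S}$ is the image of the interval $[2\pi(k-1)/2^j,\,2\pi k/2^j]$ under $\theta\mapsto e^{i\theta}$; $\ell(\varphi(\Gamma_{j,k}))$ is the arc length of the image arc $\varphi(\Gamma_{j,k})\subset\mathbb{S}$. *)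

theory Defs
  imports "HOL-Analysis.Analysis"
begin

(* The sigma-algebra lives on the circle only, so that a function that is merely
   continuous on the circle is measurable whatever its values elsewhere. *)
definition arc_length :: "complex measure" where
  "arc_length =
     distr (restrict_space lborel {0..<2 * pi}) (restrict_space borel (sphere 0 1)) cis"

definition poisson_extension :: "(complex \<Rightarrow> complex) \<Rightarrow> complex \<Rightarrow> complex" where
  "poisson_extension \<phi> z =
     (1 / (2 * pi)) *\<^sub>R
       (LINT \<zeta>|arc_length. ((1 - (norm z)\<^sup>2) / (norm (z - \<zeta>))\<^sup>2) *\<^sub>R \<phi> \<zeta>)"

definition dyadic_arc :: "nat \<Rightarrow> nat \<Rightarrow> complex set" where
  "dyadic_arc j k = cis ` {2 * pi * (real k - 1) / 2 ^ j .. 2 * pi * real k / 2 ^ j}"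

definition norm_D :: "(complex \<Rightarrow> complex) \<Rightarrow> complex \<Rightarrow> real" where
  "norm_D h z = onorm (frechet_derivative h (at z))"

end

theory Submission imports Defs "HOL-Complex_Analysis.Complex_Analysis" begin

text \<open>
  Integrating by parts in the Poisson integral turns the two complex derivatives of \<open>h\<close> into the
  Cauchy integrals \<open>\<integral> \<eta> / (\<psi> \<eta> - z) |d\<eta>|\<close> and \<open>\<integral> cnj \<eta> / (\<psi> \<eta> - z) |d\<eta>|\<close>, up to sign, conjugation and a
  factor \<open>2 \<pi>\<close>. Squaring them and integrating over the circle of radius \<open>r\<close> gives, by Cauchy's formula, the
  double integral of \<open>Re (\<eta> * cnj \<xi>)\<close> against the Poisson kernel of radius \<open>r\<^sup>2\<close> at the chord
  \<open>|\<psi> \<eta> - \<psi> \<xi>|\<close>. Since \<open>Re (\<eta> * cnj \<xi>) \<ge> 1/2\<close> near the diagonal and the kernel is bounded away from it,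
  this factor may be dropped. The weighted integral of the kernel over the radius is comparable to
  \<open>|log |\<psi> \<eta> - \<psi> \<xi>||\<close> to the power \<open>\<lambda> + 1\<close>, which is (ii) \<open>\<longleftrightarrow>\<close> (iii). For (iii) \<open>\<longleftrightarrow>\<close> (iv), the same
  power of the logarithm is comparable to the sum of \<open>j\<close> to the power \<open>\<lambda>\<close> over the scales \<open>2 ^ (-j)\<close> above the
  chord. The remaining equivalences replace one logarithm by another, at the price of a summable
  error where the derivative (or the relative arc length) is small.
\<close>

section \<open>Arc length and polar coordinates\<close>

text \<open>Nothing beyond continuity is known of \<open>\<phi>\<close>, so its Stieltjes measure is
  moved by \<open>\<eta> = \<phi> \<zeta>\<close> to arc length in \<open>\<eta>\<close>, and only
  the continuous inverse \<open>\<psi>\<close> stays inside the kernel. The price is the factor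
  \<open>Re (\<eta> * cnj \<xi>)\<close>, a trace of the tangent direction at \<open>\<eta>\<close>
  and \<open>\<xi>\<close>. It changes sign; uniform continuity of \<open>\<phi>\<close> confines
  the bad pairs to chords bounded away from zero. After that every quantity is an integral over
  pairs of a function of the chord alone, and the comparisons concern functions of one real
  variable.

  The exponent \<open>\<lambda> + 1\<close> comes from the primitive of \<open>log (2 / s)\<close>
  to the power \<open>\<lambda>\<close>, divided by \<open>s\<close>; it is positive because
  \<open>\<lambda> > -1\<close>. Since \<open>\<lambda>\<close> may have either sign, powers of
  logarithms are compared through bounds from both sides. Exchanging logarithms rests on the a
  priori bounds \<open>|Dh| \<le> 2 / (1 - |z|)\<close> and, for arcs, length at most
  \<open>2 * pi\<close>: they bound the logarithm of the size by that of the scale, and the converse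
  fails only where the size is too small to matter.\<close>

lemma space_arc_length [simp]: "space arc_length = sphere 0 1"
  by (simp add: arc_length_def space_restrict_space)

lemma sets_arc_length [measurable_cong]: "sets arc_length = sets (restrict_space borel (sphere 0 1))"
  by (simp add: arc_length_def)

lemma measurable_cis_arc [measurable]:
  "cis \<in> measurable (restrict_space lborel {0..<2 * pi}) (restrict_space borel (sphere 0 1))"
  by (intro measurable_restrict_space3) (auto intro!: borel_measurable_continuous_onI continuous_intros)

lemma emeasure_arc_length_space: "emeasure arc_length (sphere 0 1) = ennreal (2 * pi)"
proof -
  have "emeasure arc_length (sphere 0 1)
      = emeasure (restrict_space lborel {0..<2 * pi}) (space (restrict_space lborel {0..<2 * pi}))"
    unfolding arc_length_def
    by (subst emeasure_distr)
      (auto intro!: arg_cong2[where f=emeasure] simp: space_restrict_space sets_restrict_space_iff)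
  then show ?thesis
    by (simp add: space_restrict_space emeasure_restrict_space)
qed

interpretation arc_length: finite_measure arc_length
  by standard (simp add: emeasure_arc_length_space)

interpretation arc_pair: pair_sigma_finite arc_length arc_length ..

lemma measurable_arc_lengthI:
  fixes f :: "complex \<Rightarrow> 'a :: topological_space"
  assumes "continuous_on (sphere 0 1) f"
  shows "f \<in> borel_measurable arc_length"
  using borel_measurable_continuous_on_restrict[OF assms] by (simp cong: measurable_cong_sets add: sets_arc_length)

lemma nn_integral_arc_length:
  assumes "f \<in> borel_measurable arc_length"
  shows "(\<integral>\<^sup>+\<zeta>. f \<zeta> \<partial>arc_length) = (\<integral>\<^sup>+t. f (cis t) * indicator {0..<2 * pi} t \<partial>lborel)"
  using assms unfolding arc_length_def
  by (subst nn_integral_distr) (auto simp: nn_integral_restrict_space)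

lemma integral_arc_length:
  fixes f :: "complex \<Rightarrow> 'a :: euclidean_space"
  assumes "continuous_on (sphere 0 1) f"
  shows "integral\<^sup>L arc_length f = integral {0..2 * pi} (\<lambda>t. f (cis t))"
proof -
  have c: "continuous_on {0..2 * pi} (\<lambda>t. f (cis t))"
    by (rule continuous_on_compose2[OF assms]) (auto intro!: continuous_intros)
  have "integral\<^sup>L arc_length f = (LINT t:{0..<2 * pi}|lborel. f (cis t))"
    using measurable_arc_lengthI[OF assms] unfolding arc_length_def
    by (subst integral_distr) (auto simp: integral_restrict_space set_lebesgue_integral_def)
  also have "\<dots> = (LINT t:{0..2 * pi}|lborel. f (cis t))"
    unfolding set_lebesgue_integral_def
  proof (rule integral_cong_AE)
    show "(\<lambda>x. indicat_real {0..2 * pi} x *\<^sub>R f (cis x)) \<in> borel_measurable lborel"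
      using borel_integrable_atLeastAtMost'[OF c] by (auto simp: set_integrable_def)
    have "set_integrable lborel {0..<2 * pi} (\<lambda>t. f (cis t))"
      by (rule set_integrable_subset[OF borel_integrable_atLeastAtMost'[OF c]]) auto
    then show "(\<lambda>x. indicat_real {0..<2 * pi} x *\<^sub>R f (cis x)) \<in> borel_measurable lborel"
      by (auto simp: set_integrable_def)
    have "AE x in lborel. x \<noteq> 2 * pi" by (rule AE_lborel_singleton)
    then show "AE x in lborel. indicat_real {0..<2 * pi} x *\<^sub>R f (cis x) = indicat_real {0..2 * pi} x *\<^sub>R f (cis x)"
      by eventually_elim (auto simp: indicator_def)
  qed
  also have "\<dots> = integral {0..2 * pi} (\<lambda>t. f (cis t))"
    by (rule set_borel_integral_eq_integral) (rule borel_integrable_atLeastAtMost'[OF c])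
  finally show ?thesis .
qed

text \<open>\<open>cis\<close> meets \<open>p\<close> at most once per turn. Null points are what
  allows the diagonal \<open>\<eta> = \<xi>\<close> and the common endpoints of neighbouring arcs to
  be ignored.\<close>

lemma emeasure_arc_length_singleton: "emeasure arc_length {p} = 0"
proof (cases "p \<in> sphere 0 1")
  case True
  then have m: "{p} \<in> sets arc_length"
    by (auto simp: sets_arc_length sets_restrict_space)
  then have "emeasure arc_length {p} = (\<integral>\<^sup>+\<zeta>. indicator {p} \<zeta> \<partial>arc_length)"
    by simp
  also have "\<dots> = (\<integral>\<^sup>+t. indicator {p} (cis t) * indicator {0..<2 * pi} t \<partial>lborel)"
    using m by (intro nn_integral_arc_length) auto
  also have "\<dots> = (\<integral>\<^sup>+(t::real). 0 \<partial>lborel)"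
  proof (rule nn_integral_cong_AE)
    have "AE t in lborel. t \<noteq> Arg2pi p" by (rule AE_lborel_singleton)
    then show "AE t in lborel. indicator {p} (cis t) * indicator {0..<2 * pi} t = (0 :: ennreal)"
    proof eventually_elim
      case (elim t)
      then show ?case
        using Arg2pi_unique[of 1 t p] by (auto simp: indicator_def cis_conv_exp)
    qed
  qed
  finally show ?thesis by simp
next
  case False
  then have "{p} \<notin> sets arc_length"
    by (auto simp: sets_arc_length sets_restrict_space)
  then show ?thesis by (rule emeasure_notin_sets)
qed

lemma AE_arc_length_neq: "AE x in arc_length. x \<noteq> p"
proof (cases "p \<in> sphere 0 1")
  case True
  then have "{p} \<in> null_sets arc_length"
    by (auto simp: null_sets_def emeasure_arc_length_singleton sets_arc_length sets_restrict_space)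
  from AE_not_in[OF this] show ?thesis by simp
next
  case False
  then show ?thesis by (intro AE_I2) auto
qed

section \<open>Polar coordinates derived from Fubini\<close>

lemma nn_integral_complex:
  assumes [measurable]: "f \<in> borel_measurable borel"
  shows "(\<integral>\<^sup>+z. f z \<partial>lborel) = (\<integral>\<^sup>+x. (\<integral>\<^sup>+y. f (Complex x y) \<partial>lborel) \<partial>lborel)"
proof -
  let ?h = "\<lambda>(x, y). Complex x y"
  have [measurable]: "?h \<in> borel_measurable (lborel \<Otimes>\<^sub>M lborel)"
  proof -
    have "?h \<in> borel_measurable borel"
      by (intro borel_measurable_continuous_onI) (auto intro!: continuous_intros simp: Complex_eq case_prod_unfold)
    then show ?thesis by (simp add: lborel_prod)
  qed
  \<comment> \<open>Lebesgue measure is determined by its values on boxes, and the image of the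
    product measure has the same ones.\<close>
  have "lborel = distr (lborel \<Otimes>\<^sub>M lborel) borel ?h"
  proof (rule lborel_eqI)
    fix l u :: complex assume le: "\<And>b. b \<in> Basis \<Longrightarrow> l \<bullet> b \<le> u \<bullet> b"
    have "?h -` box l u = box (Re l) (Re u) \<times> box (Im l) (Im u)"
      by (auto simp: box_def Basis_complex_def)
    moreover have "Re l \<le> Re u" "Im l \<le> Im u"
      using le[of 1] le[of \<i>] by (auto simp: Basis_complex_def)
    ultimately show "emeasure (distr (lborel \<Otimes>\<^sub>M lborel) borel ?h) (box l u)
        = ennreal (\<Prod>b\<in>Basis. (u - l) \<bullet> b)"
      by (simp add: emeasure_distr space_pair_measure lborel.emeasure_pair_measure_Times
          ennreal_mult Basis_complex_def)
  qed simp
  then have "(\<integral>\<^sup>+z. f z \<partial>lborel) = (\<integral>\<^sup>+z. f z \<partial>distr (lborel \<Otimes>\<^sub>M lborel) borel ?h)"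
    by simp
  also have "\<dots> = (\<integral>\<^sup>+p. f (?h p) \<partial>(lborel \<Otimes>\<^sub>M lborel))"
    by (rule nn_integral_distr) auto
  also have "\<dots> = (\<integral>\<^sup>+x. (\<integral>\<^sup>+y. f (Complex x y) \<partial>lborel) \<partial>lborel)"
    by (subst lborel.nn_integral_fst[symmetric]) auto
  finally show ?thesis .
qed

text \<open>The slopes fill the whole line, whereas the substitution is made on compact intervals.
  The intervals from \<open>- b n\<close> to \<open>b n\<close> exhaust the open interval of angles,
  and monotone convergence passes to the limit on both sides.\<close>

lemma nn_integral_tan_substitution:
  fixes F :: "real \<Rightarrow> ennreal"
  assumes [measurable]: "F \<in> borel_measurable borel"
  shows "(\<integral>\<^sup>+t. F t \<partial>lborel)
       = (\<integral>\<^sup>+\<theta>. F (tan \<theta>) * ennreal (1 + (tan \<theta>)\<^sup>2) * indicator {-(pi/2)<..<pi/2} \<theta> \<partial>lborel)"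
proof -
  let ?G = "\<lambda>\<theta>. F (tan \<theta>) * ennreal (1 + (tan \<theta>)\<^sup>2)"
  let ?I = "indicator {-(pi/2)<..<pi/2} :: real => ennreal"
  \<comment> \<open>The shift by 1 keeps \<open>b n\<close> positive, so that no interval
    degenerates, not even for \<open>n = 0\<close>.\<close>
  define b where "b n = arctan (real n + 1)" for n
  have b: "0 < b n" "b n < pi/2" "tan (b n) = real n + 1" for n
    using arctan_ubound[of "real n + 1"] by (auto simp: b_def tan_arctan)
  have bmono: "b m \<le> b n" if "m \<le> n" for m n using that by (simp add: b_def arctan_monotone')
  have step: "(\<integral>\<^sup>+t. F t * indicator {-(real n + 1)..real n + 1} t \<partial>lborel)
      = (\<integral>\<^sup>+\<theta>. ?G \<theta> * indicator {-b n..b n} \<theta> \<partial>lborel)" for n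
  proof -
    have cn: "cos x \<noteq> 0" if "x \<in> {-b n..b n}" for x
      using cos_gt_zero_pi[of x] that b[of n] by auto
    have "(\<integral>\<^sup>+t. F t * indicator {tan (- b n)..tan (b n)} t \<partial>lborel)
      = (\<integral>\<^sup>+\<theta>. F (tan \<theta>) * ennreal (inverse ((cos \<theta>)\<^sup>2)) * indicator {-b n..b n} \<theta> \<partial>lborel)"
      by (rule nn_integral_substitution_aux)
        (use b[of n] cn in \<open>auto intro!: DERIV_tan continuous_intros\<close>)
    also have "\<dots> = (\<integral>\<^sup>+\<theta>. ?G \<theta> * indicator {-b n..b n} \<theta> \<partial>lborel)"
    proof (rule nn_integral_cong)
      fix x
      have "inverse ((cos x)\<^sup>2) = 1 + (tan x)\<^sup>2" if "x \<in> {-b n..b n}"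
        using tan_sec[OF cn[OF that]] by (simp add: power_inverse)
      then show "F (tan x) * ennreal (inverse ((cos x)\<^sup>2)) * indicator {-b n..b n} x
          = F (tan x) * ennreal (1 + (tan x)\<^sup>2) * indicator {-b n..b n} x"
        by (cases "x \<in> {-b n..b n}") auto
    qed
    finally show ?thesis using b(3)[of n] by simp
  qed
  have "(\<integral>\<^sup>+t. F t \<partial>lborel) = (\<integral>\<^sup>+t. (SUP n. F t * indicator {-(real n + 1)..real n + 1} t) \<partial>lborel)"
  proof (intro nn_integral_cong antisym)
    fix t
    obtain n where "\<bar>t\<bar> \<le> real n" using real_arch_simple by blast
    then show "F t \<le> (SUP n. F t * indicator {-(real n + 1)..real n + 1} t)"
      by (intro SUP_upper2[of n]) (auto simp: indicator_def)
    show "(SUP n. F t * indicator {-(real n + 1)..real n + 1} t) \<le> F t"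
      by (intro SUP_least) (auto simp: indicator_def)
  qed
  also have "\<dots> = (SUP n. \<integral>\<^sup>+t. F t * indicator {-(real n + 1)..real n + 1} t \<partial>lborel)"
    by (intro nn_integral_monotone_convergence_SUP) (auto simp: incseq_def le_fun_def indicator_def)
  also have "\<dots> = (SUP n. \<integral>\<^sup>+\<theta>. ?G \<theta> * indicator {-b n..b n} \<theta> \<partial>lborel)"
    by (simp only: step)
  also have "\<dots> = (\<integral>\<^sup>+\<theta>. (SUP n. ?G \<theta> * indicator {-b n..b n} \<theta>) \<partial>lborel)"
  proof (intro nn_integral_monotone_convergence_SUP[symmetric])
    show "incseq (\<lambda>n \<theta>. ?G \<theta> * indicator {-b n..b n} \<theta>)"
    proof (intro incseq_SucI le_funI mult_left_mono)
      fix n \<theta>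
      have "{- b n..b n} \<subseteq> {- b (Suc n)..b (Suc n)}"
        using bmono[of n "Suc n"] by auto
      then show "indicator {-b n..b n} \<theta> \<le> (indicator {-b (Suc n)..b (Suc n)} \<theta> :: ennreal)"
        by (auto simp: indicator_def)
    qed auto
  qed (auto simp: tan_def)
  also have "\<dots> = (\<integral>\<^sup>+\<theta>. ?G \<theta> * ?I \<theta> \<partial>lborel)"
  proof (intro nn_integral_cong antisym)
    fix \<theta>
    show "(SUP n. ?G \<theta> * indicator {-b n..b n} \<theta>)
        \<le> ?G \<theta> * ?I \<theta>"
    proof (intro SUP_least)
      fix n
      show "?G \<theta> * indicator {-b n..b n} \<theta>
        \<le> ?G \<theta> * ?I \<theta>"
        using b(2)[of n] by (auto simp: indicator_def)
    qed
    show "?G \<theta> * ?I \<theta>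
       \<le> (SUP n. ?G \<theta> * indicator {-b n..b n} \<theta>)"
    proof (cases "\<theta> \<in> {-(pi/2)<..<pi/2}")
      case True
      obtain n where n: "\<bar>tan \<theta>\<bar> \<le> real n" using real_arch_simple by blast
      have "arctan (tan \<theta>) \<le> b n" "arctan (- tan \<theta>) \<le> b n"
        unfolding b_def by (rule arctan_monotone', use n in linarith)+
      moreover have "arctan (tan \<theta>) = \<theta>" using True by (intro arctan_tan) auto
      ultimately have "\<theta> \<in> {-b n..b n}" by (auto simp: arctan_minus)
      then show ?thesis using True by (intro SUP_upper2[of n]) auto
    qed auto
  qed
  finally show ?thesis .
qed

text \<open>The tangent parametrises lines, not rays: each line of angle \<open>\<theta>\<close>
  meets the circle in the two antipodal points \<open>cis \<theta>\<close> and
  \<open>- cis \<theta>\<close>. The circle is cut at \<open>pi/2\<close> and \<open>3*pi/2\<close>,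
  and the later pieces are turned back by \<open>pi\<close> and \<open>2*pi\<close>.\<close>

lemma nn_integral_arc_length_halves:
  assumes [measurable]: "g \<in> borel_measurable borel"
  shows "(\<integral>\<^sup>+\<zeta>. g \<zeta> \<partial>arc_length)
       = (\<integral>\<^sup>+\<theta>. (g (cis \<theta>) + g (- cis \<theta>)) * indicator {-(pi/2)<..<pi/2} \<theta> \<partial>lborel)"
proof -
  let ?H = "indicator {-(pi/2)<..<pi/2} :: real => ennreal"
  let ?H1 = "indicator {0..<pi/2} :: real => ennreal"
  let ?H2 = "indicator {pi/2..<3*pi/2} :: real => ennreal"
  let ?H3 = "indicator {3*pi/2..<2*pi} :: real => ennreal"
  let ?H4 = "indicator {-(pi/2)..<pi/2} :: real => ennreal"
  let ?H5 = "indicator {-(pi/2)..<0} :: real => ennreal"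
  have [measurable]: "cis \<in> borel_measurable borel"
    by (intro borel_measurable_continuous_onI continuous_intros)
  have gm: "g \<in> borel_measurable arc_length"
    by (simp cong: measurable_cong_sets add: sets_arc_length measurable_restrict_space1)
  let ?I = "\<lambda>a b f. \<integral>\<^sup>+t. f (cis t) * indicator {a..<b} t \<partial>lborel"
  have shift: "(\<integral>\<^sup>+t. g (cis t) * indicator {a..<b} t \<partial>lborel)
      = (\<integral>\<^sup>+t. g (cis (c + t)) * indicator {a - c..<b - c} t \<partial>lborel)" for a b c
  proof -
    have "(\<integral>\<^sup>+t. g (cis t) * indicator {a..<b} t \<partial>lborel)
      = ennreal \<bar>1\<bar> * (\<integral>\<^sup>+t. g (cis (c + 1 * t)) * indicator {a..<b} (c + 1 * t) \<partial>lborel)"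
      by (subst nn_integral_real_affine[where t=c and c=1]) auto
    then show ?thesis
      by (auto intro!: nn_integral_cong simp: indicator_def algebra_simps)
  qed
  have "(\<integral>\<^sup>+\<zeta>. g \<zeta> \<partial>arc_length) = (\<integral>\<^sup>+t. g (cis t) * indicator {0..<2 * pi} t \<partial>lborel)"
    by (rule nn_integral_arc_length[OF gm])
  also have "\<dots> = (\<integral>\<^sup>+t. g (cis t) * ?H1 t + (g (cis t) * ?H2 t
      + g (cis t) * ?H3 t) \<partial>lborel)"
  proof (rule nn_integral_cong)
    fix t :: real
    consider "t < 0" | "0 \<le> t" "t < pi/2" | "pi/2 \<le> t" "t < 3*pi/2" | "3*pi/2 \<le> t" "t < 2*pi" | "2*pi \<le> t"
      by linarith
    then show "g (cis t) * indicator {0..<2 * pi} t = g (cis t) * ?H1 t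
        + (g (cis t) * ?H2 t + g (cis t) * ?H3 t)"
      using pi_gt_zero by cases (simp_all add: indicator_def)
  qed
  also have "\<dots> = (\<integral>\<^sup>+t. g (cis t) * ?H1 t \<partial>lborel)
      + ((\<integral>\<^sup>+t. g (cis t) * ?H2 t \<partial>lborel)
      + (\<integral>\<^sup>+t. g (cis t) * ?H3 t \<partial>lborel))"
    by (simp add: nn_integral_add)
  also have "(\<integral>\<^sup>+t. g (cis t) * ?H2 t \<partial>lborel)
      = (\<integral>\<^sup>+t. g (- cis t) * ?H4 t \<partial>lborel)"
    by (subst shift[where c=pi]) (auto intro!: nn_integral_cong simp: cis_mult[symmetric] algebra_simps)
  also have "(\<integral>\<^sup>+t. g (cis t) * ?H3 t \<partial>lborel)
      = (\<integral>\<^sup>+t. g (cis t) * ?H5 t \<partial>lborel)"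
    by (subst shift[where c="2*pi"]) (auto intro!: nn_integral_cong simp: cis_mult[symmetric])
  also have "(\<integral>\<^sup>+t. g (cis t) * ?H1 t \<partial>lborel)
      + ((\<integral>\<^sup>+t. g (- cis t) * ?H4 t \<partial>lborel)
      + (\<integral>\<^sup>+t. g (cis t) * ?H5 t \<partial>lborel))
      = (\<integral>\<^sup>+t. g (cis t) * ?H1 t + (g (- cis t) * ?H4 t
      + g (cis t) * ?H5 t) \<partial>lborel)"
    by (simp add: nn_integral_add)
  also have "\<dots> = (\<integral>\<^sup>+\<theta>. (g (cis \<theta>) + g (- cis \<theta>)) * ?H \<theta> \<partial>lborel)"
  proof (rule nn_integral_cong_AE)
    have "AE t in lborel. t \<noteq> -(pi/2)" by (rule AE_lborel_singleton)
    then show "AE t in lborel. g (cis t) * ?H1 t + (g (- cis t) * ?H4 t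
      + g (cis t) * ?H5 t) = (g (cis t) + g (- cis t)) * ?H t"
      by eventually_elim (auto simp: indicator_def add.commute)
  qed
  finally show ?thesis .
qed

text \<open>
  The lines through the origin are parametrised by their slope \<open>t\<close>: first \<open>y = x t\<close>, then
  \<open>x = r / sqrt (1 + t\<^sup>2)\<close>, and finally \<open>t = tan \<theta>\<close>.
\<close>

lemma nn_integral_polar:
  assumes [measurable]: "f \<in> borel_measurable borel"
  shows "(\<integral>\<^sup>+z. f z \<partial>lborel)
       = (\<integral>\<^sup>+r. ennreal r * (\<integral>\<^sup>+\<zeta>. f (of_real r * \<zeta>) \<partial>arc_length) * indicator {0<..} r \<partial>lborel)"
proof -
  let ?f = "\<lambda>r \<theta>. f (of_real r * cis \<theta>)"
  let ?s = "\<lambda>r \<theta>. ?f r \<theta> + f (of_real r * - cis \<theta>)"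
  let ?I = "indicator {-(pi/2)<..<pi/2} :: real => ennreal"
  let ?P = "indicator {0<..} :: real => ennreal"
  have [measurable]: "cis \<in> borel_measurable borel"
    by (intro borel_measurable_continuous_onI continuous_intros)
  have [measurable]: "(\<lambda>x. Complex (f x) (g x)) \<in> borel_measurable M"
    if [measurable]: "f \<in> borel_measurable M" "g \<in> borel_measurable M" for f g and M :: "'x measure"
    unfolding Complex_eq by measurable
  define F where "F t = (\<integral>\<^sup>+x. f (Complex x (x * t)) * ennreal \<bar>x\<bar> \<partial>lborel)" for t
  have Fm [measurable]: "F \<in> borel_measurable borel"
    unfolding F_def by measurable
  have "(\<integral>\<^sup>+z. f z \<partial>lborel) = (\<integral>\<^sup>+x. (\<integral>\<^sup>+y. f (Complex x y) \<partial>lborel) \<partial>lborel)"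
    by (rule nn_integral_complex) simp
  also have "\<dots> = (\<integral>\<^sup>+x. (\<integral>\<^sup>+t. f (Complex x (x * t)) * ennreal \<bar>x\<bar> \<partial>lborel) \<partial>lborel)"
  proof (rule nn_integral_cong_AE)
    have "AE x in lborel. x \<noteq> (0::real)" by (rule AE_lborel_singleton)
    then show "AE x in lborel. (\<integral>\<^sup>+y. f (Complex x y) \<partial>lborel)
      = (\<integral>\<^sup>+t. f (Complex x (x * t)) * ennreal \<bar>x\<bar> \<partial>lborel)"
    proof eventually_elim
      case (elim x)
      have "(\<integral>\<^sup>+t. f (Complex x (x * t)) * ennreal \<bar>x\<bar> \<partial>lborel)
          = (\<integral>\<^sup>+t. f (Complex x (0 + x * t)) \<partial>lborel) * ennreal \<bar>x\<bar>"
        by (subst nn_integral_multc) auto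
      also have "\<dots> = (\<integral>\<^sup>+y. f (Complex x y) \<partial>lborel)"
        using elim by (subst (2) nn_integral_real_affine[where c=x and t=0]) (auto simp: mult.commute)
      finally show ?case ..
    qed
  qed
  also have "\<dots> = (\<integral>\<^sup>+t. F t \<partial>lborel)"
    unfolding F_def by (rule lborel_pair.Fubini') measurable
  also have "\<dots> = (\<integral>\<^sup>+\<theta>. F (tan \<theta>) * ennreal (1 + (tan \<theta>)\<^sup>2) * ?I \<theta> \<partial>lborel)"
    by (rule nn_integral_tan_substitution) simp
  also have "\<dots> = (\<integral>\<^sup>+\<theta>. (\<integral>\<^sup>+r. ?f r \<theta> * ennreal \<bar>r\<bar> \<partial>lborel) * ?I \<theta> \<partial>lborel)"
  proof (rule nn_integral_cong)
    fix \<theta> :: real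
    show "F (tan \<theta>) * ennreal (1 + (tan \<theta>)\<^sup>2) * ?I \<theta>
       = (\<integral>\<^sup>+r. ?f r \<theta> * ennreal \<bar>r\<bar> \<partial>lborel) * ?I \<theta>"
    proof (cases "\<theta> \<in> {-(pi/2)<..<pi/2}")
      case True
      then have c: "cos \<theta> > 0" by (intro cos_gt_zero_pi) auto
      have t: "1 + (tan \<theta>)\<^sup>2 = 1 / (cos \<theta>)\<^sup>2"
        using c by (subst tan_sec) (auto simp: power_inverse divide_inverse)
      have "F (tan \<theta>) = ennreal \<bar>cos \<theta>\<bar> *
          (\<integral>\<^sup>+r. f (Complex (0 + cos \<theta> * r) ((0 + cos \<theta> * r) * tan \<theta>)) * ennreal \<bar>0 + cos \<theta> * r\<bar> \<partial>lborel)"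
        unfolding F_def using c by (subst nn_integral_real_affine[where c="cos \<theta>" and t=0]) auto
      also have "(\<integral>\<^sup>+r. f (Complex (0 + cos \<theta> * r) ((0 + cos \<theta> * r) * tan \<theta>)) * ennreal \<bar>0 + cos \<theta> * r\<bar> \<partial>lborel)
         = (\<integral>\<^sup>+r. (?f r \<theta> * ennreal \<bar>r\<bar>) * ennreal (cos \<theta>) \<partial>lborel)"
      proof (rule nn_integral_cong)
        fix r :: real
        have "Complex (0 + cos \<theta> * r) ((0 + cos \<theta> * r) * tan \<theta>) = of_real r * cis \<theta>"
          using c by (auto simp: complex_eq_iff tan_def field_simps)
        moreover have "ennreal \<bar>0 + cos \<theta> * r\<bar> = ennreal \<bar>r\<bar> * ennreal (cos \<theta>)"
          using c by (simp add: abs_mult ennreal_mult mult.commute)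
        ultimately show "f (Complex (0 + cos \<theta> * r) ((0 + cos \<theta> * r) * tan \<theta>)) * ennreal \<bar>0 + cos \<theta> * r\<bar>
           = ?f r \<theta> * ennreal \<bar>r\<bar> * ennreal (cos \<theta>)"
          by (simp add: mult.assoc)
      qed
      also have "\<dots> = (\<integral>\<^sup>+r. ?f r \<theta> * ennreal \<bar>r\<bar> \<partial>lborel) * ennreal (cos \<theta>)"
        by (rule nn_integral_multc) auto
      finally have "F (tan \<theta>) * ennreal (1 + (tan \<theta>)\<^sup>2) =
          (\<integral>\<^sup>+r. ?f r \<theta> * ennreal \<bar>r\<bar> \<partial>lborel) * (ennreal (cos \<theta>) * ennreal (cos \<theta>) * ennreal (1 / (cos \<theta>)\<^sup>2))"
        using c by (simp add: t mult_ac)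
      also have "ennreal (cos \<theta>) * ennreal (cos \<theta>) * ennreal (1 / (cos \<theta>)\<^sup>2) = 1"
        using c by (simp add: ennreal_mult[symmetric] power2_eq_square)
      finally show ?thesis by simp
    qed auto
  qed
  \<comment> \<open>Negative radii describe the opposite ray; reflecting them produces the second
    summand of \<open>?s\<close>.\<close>
  also have "\<dots> = (\<integral>\<^sup>+\<theta>. (\<integral>\<^sup>+r. ennreal r * ?s r \<theta>
      * ?P r \<partial>lborel) * ?I \<theta> \<partial>lborel)"
  proof (rule nn_integral_cong, rule arg_cong2[where f="(*)", OF _ refl])
    fix \<theta> :: real
    let ?g = "\<lambda>r. ?f r \<theta>"
    have "(\<integral>\<^sup>+r. ?g r * ennreal \<bar>r\<bar> \<partial>lborel)
        = (\<integral>\<^sup>+r. ?g r * ennreal \<bar>r\<bar> * ?P r + ?g r * ennreal \<bar>r\<bar> * indicator {..<0} r \<partial>lborel)"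
      by (intro nn_integral_cong) (auto simp: indicator_def)
    also have "\<dots> = (\<integral>\<^sup>+r. ?g r * ennreal \<bar>r\<bar> * ?P r \<partial>lborel)
        + (\<integral>\<^sup>+r. ?g r * ennreal \<bar>r\<bar> * indicator {..<0} r \<partial>lborel)"
      by (intro nn_integral_add) auto
    also have "(\<integral>\<^sup>+r. ?g r * ennreal \<bar>r\<bar> * indicator {..<0} r \<partial>lborel)
        = (\<integral>\<^sup>+r. ?g (-r) * ennreal \<bar>r\<bar> * ?P r \<partial>lborel)"
      by (subst nn_integral_real_affine[where c="-1" and t=0])
        (auto intro!: nn_integral_cong simp: indicator_def)
    also have "(\<integral>\<^sup>+r. ?g r * ennreal \<bar>r\<bar> * ?P r \<partial>lborel) + \<dots>
        = (\<integral>\<^sup>+r. ?g r * ennreal \<bar>r\<bar> * ?P r + ?g (-r) * ennreal \<bar>r\<bar> * ?P r \<partial>lborel)"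
      by (intro nn_integral_add[symmetric]) auto
    also have "\<dots> = (\<integral>\<^sup>+r. ennreal r * ?s r \<theta> * ?P r \<partial>lborel)"
      by (intro nn_integral_cong) (auto simp: indicator_def algebra_simps)
    finally show "(\<integral>\<^sup>+r. ?g r * ennreal \<bar>r\<bar> \<partial>lborel)
      = (\<integral>\<^sup>+r. ennreal r * ?s r \<theta> * ?P r \<partial>lborel)" .
  qed
  also have "\<dots> = (\<integral>\<^sup>+\<theta>. (\<integral>\<^sup>+r. ennreal r * ?s r \<theta>
      * ?P r * ?I \<theta> \<partial>lborel) \<partial>lborel)"
    by (intro nn_integral_cong nn_integral_multc[symmetric]) auto
  also have "\<dots> = (\<integral>\<^sup>+r. (\<integral>\<^sup>+\<theta>. ennreal r * ?s r \<theta>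
      * ?P r * ?I \<theta> \<partial>lborel) \<partial>lborel)"
    by (rule lborel_pair.Fubini') measurable
  also have "\<dots> = (\<integral>\<^sup>+r. ennreal r * (\<integral>\<^sup>+\<zeta>. f (of_real r * \<zeta>) \<partial>arc_length) * ?P r \<partial>lborel)"
  proof (rule nn_integral_cong)
    fix r :: real
    have "(\<integral>\<^sup>+\<theta>. ennreal r * ?s r \<theta>
      * ?P r * ?I \<theta> \<partial>lborel)
      = (\<integral>\<^sup>+\<theta>. ennreal r * (?s r \<theta> * ?I \<theta>)
           * ?P r \<partial>lborel)"
      by (intro nn_integral_cong) (simp add: mult_ac)
    also have "\<dots> = ennreal r * (\<integral>\<^sup>+\<theta>. ?s r \<theta> * ?I \<theta> \<partial>lborel)
           * ?P r"
      by (subst nn_integral_multc, measurable, subst nn_integral_cmult, measurable)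
    also have "(\<integral>\<^sup>+\<theta>. ?s r \<theta> * ?I \<theta> \<partial>lborel)
        = (\<integral>\<^sup>+\<zeta>. f (of_real r * \<zeta>) \<partial>arc_length)"
      by (rule nn_integral_arc_length_halves[symmetric]) measurable
    finally show "(\<integral>\<^sup>+\<theta>. ennreal r * ?s r \<theta>
      * ?P r * ?I \<theta> \<partial>lborel)
      = ennreal r * (\<integral>\<^sup>+\<zeta>. f (of_real r * \<zeta>) \<partial>arc_length) * ?P r" .
  qed
  finally show ?thesis .
qed

section \<open>Derivatives of the Poisson extension\<close>

lemma circle_map_lift:
  assumes "continuous_on (sphere 0 1) f" "f ` sphere 0 1 \<subseteq> sphere 0 1"
  obtains a :: "real \<Rightarrow> real" where "continuous_on UNIV a" "\<And>t. f (cis t) = cis (a t)"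
proof -
  have c: "continuous_on UNIV (\<lambda>t::real. f (cis t))"
    by (rule continuous_on_compose2[OF assms(1)]) (auto intro!: continuous_intros)
  have n1: "norm (f (cis t)) = 1" for t
    using assms(2) by force
  obtain g where g: "continuous_on UNIV g" "\<And>t::real. f (cis t) = exp (g t)"
    using continuous_logarithm_on_contractible[OF c convex_imp_contractible] n1
    by (metis convex_UNIV norm_zero zero_neq_one UNIV_I)
  have "Re (g t) = 0" for t
    using n1[of t] g(2)[of t] by (simp add: norm_exp_eq_Re)
  then have "f (cis t) = cis (Im (g t))" for t
    by (subst g(2), unfold cis_conv_exp, intro arg_cong[where f=exp]) (simp add: complex_eq_iff)
  with that[of "\<lambda>t. Im (g t)"] g(1) show thesis
    by (auto intro!: continuous_intros)
qed

lemma cis_eq_iff: "cis s = cis t \<longleftrightarrow> (\<exists>n::int. s = t + 2 * pi * n)"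
  unfolding cis_conv_exp exp_eq by (auto simp: complex_eq_iff algebra_simps)

text \<open>The difference \<open>a t - b t\<close> is continuous and takes values in the integer
  multiples of \<open>2 * pi\<close>, so any two distinct values are at least \<open>2 * pi\<close>
  apart; on a connected line it must be constant.\<close>

lemma continuous_cis_eq_imp_constant:
  fixes a b :: "real \<Rightarrow> real"
  assumes "continuous_on UNIV a" "continuous_on UNIV b" "\<And>t. cis (a t) = cis (b t)"
  obtains n :: int where "\<And>t. a t = b t + 2 * pi * n"
proof -
  have "\<exists>c. \<forall>t. a t - b t = c"
  proof -
    have "(\<lambda>t. a t - b t) constant_on UNIV"
    proof (rule continuous_discrete_range_constant)
      show "connected (UNIV :: real set)" "continuous_on UNIV (\<lambda>t. a t - b t)"
        by (auto intro!: continuous_intros assms)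
      fix x :: real
      have "2 * pi \<le> norm (a y - b y - (a x - b x))" if "a y - b y \<noteq> a x - b x" for y
      proof -
        obtain m n :: int where mn: "a x = b x + 2 * pi * m" "a y = b y + 2 * pi * n"
          using assms(3)[of x] assms(3)[of y] unfolding cis_eq_iff by blast
        then have "1 \<le> \<bar>n - m\<bar>" using that by auto
        then have "1 \<le> \<bar>real_of_int n - real_of_int m\<bar>" by linarith
        moreover have "norm (a y - b y - (a x - b x)) = 2 * pi * \<bar>real_of_int n - real_of_int m\<bar>"
          unfolding mn by (simp add: abs_mult right_diff_distrib[symmetric])
        ultimately show ?thesis by simp
      qed
      then show "\<exists>e>0. \<forall>y. y \<in> UNIV \<and> a y - b y \<noteq> a x - b x \<longrightarrow> e \<le> norm (a y - b y - (a x - b x))"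
        by (intro exI[of _ "2 * pi"]) auto
    qed
    then show ?thesis by (auto simp: constant_on_def)
  qed
  then obtain c where c: "\<And>t. a t - b t = c" by blast
  obtain n :: int where "a 0 = b 0 + 2 * pi * n"
    using assms(3)[of 0] unfolding cis_eq_iff by blast
  with c[of 0] have cn: "c = 2 * pi * n" by simp
  have "a t = b t + 2 * pi * n" for t using c[of t] cn by simp
  then show thesis by (rule that)
qed

lemma lift_degree:
  assumes "continuous_on UNIV a" "\<And>t::real. f (cis t) = cis (a t)"
  obtains m :: int where "\<And>t. a (t + 2 * pi) = a t + 2 * pi * m"
proof -
  have "continuous_on UNIV (\<lambda>t. a (t + 2 * pi))"
    by (rule continuous_on_compose2[OF assms(1)]) (auto intro!: continuous_intros)
  moreover have "cis (a (t + 2 * pi)) = cis (a t)" for t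
    by (simp flip: assms(2) add: cis_mult[symmetric])
  ultimately obtain m :: int where "\<And>t. a (t + 2 * pi) = a t + 2 * pi * m"
    using continuous_cis_eq_imp_constant[OF _ assms(1)] by blast
  then show thesis by (rule that)
qed

lemma lift_degree_iterate:
  assumes "\<And>t::real. a (t + 2 * pi) = a t + 2 * pi * real_of_int m"
  shows "a (t + 2 * pi * real_of_int n) = a t + 2 * pi * real_of_int (m * n)"
proof -
  have pos: "a (t + 2 * pi * real k) = a t + 2 * pi * real_of_int m * real k" for t k
  proof (induction k)
    case (Suc k)
    have "a (t + 2 * pi * real (Suc k)) = a ((t + 2 * pi * real k) + 2 * pi)"
      by (simp add: algebra_simps)
    also have "\<dots> = a t + 2 * pi * real_of_int m * real k + 2 * pi * m"
      by (simp only: assms Suc)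
    finally show ?case by (simp add: algebra_simps)
  qed simp
  show ?thesis
  proof (cases "n \<ge> 0")
    case True
    then show ?thesis using pos[of t "nat n"] by (simp add: algebra_simps)
  next
    case False
    then show ?thesis using pos[of "t + 2 * pi * n" "nat (- n)"] by (simp add: algebra_simps)
  qed
qed

text \<open>The inverse is lifted as well. The composed lift \<open>b (a t)\<close> is
  \<open>t\<close> up to a constant, so the two degrees multiply to 1. Both signs remain, since
  \<open>\<phi>\<close> may reverse orientation.\<close>

lemma circle_homeomorphism_lift:
  assumes "homeomorphism (sphere 0 1) (sphere 0 1) \<phi> \<psi>"
  obtains a :: "real \<Rightarrow> real" and m :: int where "continuous_on UNIV a" "\<And>t. \<phi> (cis t) = cis (a t)"
    "\<And>t. a (t + 2 * pi) = a t + 2 * pi * m" "m = 1 \<or> m = -1"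
proof -
  have h: "continuous_on (sphere 0 1) \<phi>" "\<phi> ` sphere 0 1 \<subseteq> sphere 0 1"
    "continuous_on (sphere 0 1) \<psi>" "\<psi> ` sphere 0 1 \<subseteq> sphere 0 1"
    and inv: "\<And>x. x \<in> sphere 0 1 \<Longrightarrow> \<psi> (\<phi> x) = x"
    using assms by (auto simp: homeomorphism_def)
  obtain a where a: "continuous_on UNIV a" "\<And>t. \<phi> (cis t) = cis (a t)"
    using circle_map_lift[OF h(1,2)] by blast
  obtain b where b: "continuous_on UNIV b" "\<And>t. \<psi> (cis t) = cis (b t)"
    using circle_map_lift[OF h(3,4)] by blast
  obtain m :: int where m: "\<And>t. a (t + 2 * pi) = a t + 2 * pi * m"
    using lift_degree[of a \<phi>, OF a] by blast
  obtain n :: int where n: "\<And>t. b (t + 2 * pi) = b t + 2 * pi * n"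
    using lift_degree[of b \<psi>, OF b] by blast
  have "cis (b (a t)) = cis t" for t
    by (simp flip: a(2) b(2) add: inv)
  moreover have "continuous_on UNIV (\<lambda>t. b (a t))"
    by (rule continuous_on_compose2[OF b(1) a(1)]) auto
  ultimately obtain k :: int where k: "\<And>t. b (a t) = t + 2 * pi * k"
    using continuous_cis_eq_imp_constant[of "\<lambda>t. b (a t)" "\<lambda>t. t"] by (metis continuous_on_id)
  have "b (a (0 + 2 * pi)) = b (a 0) + 2 * pi * (n * m)"
    unfolding m using lift_degree_iterate[of b n "a 0" m] n by simp
  then have "2 * pi = 2 * pi * real_of_int (n * m)"
    unfolding k by (simp add: algebra_simps)
  then have "n * m = 1"
    by (metis mult_cancel_left2 of_int_eq_1_iff pi_neq_zero zero_neq_numeral mult_eq_0_iff)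
  then have "m = 1 \<or> m = -1"
    by (metis mult.commute pos_zmult_eq_1_iff_lemma zmult_eq_1_iff)
  with that a m show thesis by blast
qed

lemma has_vector_derivative_cis:
  "((\<lambda>s. cis s) has_vector_derivative (\<i> * cis t)) (at t within S)"
  unfolding has_vector_derivative_def using has_derivative_cis[of "\<lambda>x. x" "\<lambda>x. x" t S]
  by (simp add: has_derivative_ident algebra_simps scaleR_conv_of_real)

text \<open>
  Integration by parts against the derivative of \<open>\<phi>\<close>, which need not exist: with \<open>P\<close> a primitive of
  \<open>s \<mapsto> cis s * g (\<psi> (cis s))\<close> and \<open>a\<close> a lift of \<open>\<phi>\<close>, the function
  \<open>t \<mapsto> g (cis t) * cis (a t) - \<i> * P (a t)\<close> is differentiable because the two non-smooth parts
  cancel to first order.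
\<close>

lemma circle_integration_by_parts:
  fixes g :: "complex \<Rightarrow> complex"
  assumes hom: "homeomorphism (sphere 0 1) (sphere 0 1) \<phi> \<psi>"
    and a: "continuous_on UNIV a" "\<And>t. \<phi> (cis t) = cis (a t)" "\<And>t. a (t + 2 * pi) = a t + 2 * pi * real_of_int m"
      "m = 1 \<or> m = -1"
    and contg: "continuous_on (sphere 0 1) g"
    and g: "\<And>t. ((\<lambda>t. g (cis t)) has_vector_derivative g' t) (at t)" "\<And>t. norm (g' t) \<le> K"
  shows "((\<lambda>t. g' t * \<phi> (cis t)) has_integral
           - \<i> * of_int m * integral {0..2 * pi} (\<lambda>s. cis s * g (\<psi> (cis s)))) {0..2 * pi}"
proof -
  let ?D = "\<lambda>t s. \<i> * cis s * (g (cis t) - g (\<psi> (cis s)))"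
  let ?R = "\<lambda>t y. (g (cis y) - g (cis t)) - (y - t) *\<^sub>R g' t"
  have c\<psi>: "continuous_on (sphere 0 1) \<psi>" "\<psi> ` sphere 0 1 \<subseteq> sphere 0 1"
    and inv: "\<And>x. x \<in> sphere 0 1 \<Longrightarrow> \<psi> (\<phi> x) = x"
    using hom by (auto simp: homeomorphism_def)
  have K: "K \<ge> 0" using g(2)[of 0] norm_ge_zero order_trans by blast
  have lip: "norm (g (cis s) - g (cis t)) \<le> K * \<bar>s - t\<bar>" for s t
  proof -
    have "norm ((\<lambda>t. g (cis t)) s - (\<lambda>t. g (cis t)) t) \<le> K * norm (s - t)"
    proof (rule differentiable_bound[where S=UNIV and f'="\<lambda>t h. h *\<^sub>R g' t"])
      show "onorm (\<lambda>h. h *\<^sub>R g' x) \<le> K" for x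
        using g(2)[of x] by (intro onorm_le) (simp add: mult_left_mono mult.commute[of K])
    qed (use g(1) in \<open>auto simp: has_vector_derivative_def\<close>)
    then show ?thesis by simp
  qed
  define F where "F s = cis s * g (\<psi> (cis s))" for s
  have contF: "continuous_on UNIV F" 
    unfolding F_def
    by (intro continuous_intros continuous_on_compose2[OF contg] continuous_on_compose2[OF c\<psi>(1)])
      (use c\<psi>(2) in auto)
  obtain P where P: "\<And>x. (P has_vector_derivative F x) (at x)"
    using einterval_antiderivative[of "-\<infinity>" "\<infinity>" F] contF
    by (auto simp: continuous_on_eq_continuous_at)
  define \<Phi> where "\<Phi> t = g (cis t) * cis (a t) - \<i> * P (a t)" for t
  \<comment> \<open>This is the cancellation. By connectedness every \<open>s\<close> between
    \<open>a t\<close> and \<open>a y\<close> is \<open>a \<tau>\<close> with \<open>\<tau>\<close>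
    between \<open>t\<close> and \<open>y\<close>; there \<open>\<psi> (cis s) = cis \<tau>\<close>,
    so the derivative \<open>?D t s\<close> is at most \<open>K * \<bar>y - t\<bar>\<close>. The
    increment is then a product of \<open>\<bar>y - t\<bar>\<close> and a factor that tends to 0 by
    continuity of \<open>a\<close>.\<close>
  have bound: "norm (g (cis t) * (cis (a y) - cis (a t)) - \<i> * (P (a y) - P (a t))) \<le> K * \<bar>y - t\<bar> * \<bar>a y - a t\<bar>" for t y
  proof -
    define H where "H s = g (cis t) * cis s - \<i> * P s" for s
    have seg: "closed_segment (a t) (a y) \<subseteq> a ` closed_segment t y"
    proof (rule closed_segment_subset)
      have "connected (a ` closed_segment t y)"
        by (intro connected_continuous_image continuous_on_subset[OF a(1)]) auto
      then show "convex (a ` closed_segment t y)"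
        by (simp add: is_interval_connected_1[symmetric] is_interval_convex_1)
    qed auto
    have "norm (H (a y) - H (a t)) \<le> (K * \<bar>y - t\<bar>) * norm (a y - a t)"
    proof (rule differentiable_bound[where S="closed_segment (a t) (a y)"
          and f'="\<lambda>s h. h *\<^sub>R (?D t s)"])
      fix s assume "s \<in> closed_segment (a t) (a y)"
      then obtain \<tau> where \<tau>: "s = a \<tau>" "\<tau> \<in> closed_segment t y"
        using seg by blast
      have "(H has_vector_derivative (g (cis t) * (\<i> * cis s) - \<i> * F s)) (at s within closed_segment (a t) (a y))"
        unfolding H_def by (auto intro!: derivative_eq_intros has_vector_derivative_cis has_vector_derivative_at_within[OF P])
      moreover have "g (cis t) * (\<i> * cis s) - \<i> * F s = ?D t s"
        by (simp add: F_def algebra_simps)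
      ultimately show "(H has_derivative (\<lambda>h. h *\<^sub>R (?D t s)))
          (at s within closed_segment (a t) (a y))"
        by (simp add: has_vector_derivative_def)
      have "\<psi> (cis s) = cis \<tau>"
        unfolding \<tau>(1) by (simp flip: a(2) add: inv)
      then have "norm (g (cis t) - g (\<psi> (cis s))) \<le> K * \<bar>t - \<tau>\<bar>"
        using lip[of t \<tau>] by simp
      also have "\<dots> \<le> K * \<bar>y - t\<bar>"
        using K \<tau>(2) by (intro mult_left_mono) (auto simp: closed_segment_eq_real_ivl split: if_splits)
      finally have "norm (?D t s) \<le> K * \<bar>y - t\<bar>"
        by (simp add: norm_mult)
      then show "onorm (\<lambda>h. h *\<^sub>R (?D t s)) \<le> K * \<bar>y - t\<bar>"
        by (intro onorm_le) (simp add: mult_left_mono mult.commute[of "K * _"])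
    qed auto
    then show ?thesis by (simp add: H_def algebra_simps)
  qed
  have d\<Phi>: "(\<Phi> has_vector_derivative g' t * \<phi> (cis t)) (at t)" for t
    unfolding has_vector_derivative_def
  proof (rule has_derivativeI_sandwich[where e=1])
    \<comment> \<open>The three terms are the cancelled increment, the Taylor remainder of
      \<open>g\<close> along the circle, and the change of \<open>cis (a y)\<close> multiplied by
      \<open>g'\<close>. Only continuity of \<open>a\<close> makes the first and the last
      vanish.\<close>
    let ?H = "\<lambda>y. K * \<bar>a y - a t\<bar> + norm (?R t y) / norm (y - t)
       + norm (g' t) * norm (cis (a y) - cis (a t))"
    have la: "(a \<longlongrightarrow> a t) (at t)"
      using a(1) by (auto simp: continuous_on_def)
    have "((\<lambda>y. norm (?R t y) / norm (y - t)) \<longlongrightarrow> 0) (at t)"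
      using g(1)[of t] unfolding has_vector_derivative_def has_derivative_iff_norm by auto
    then have "(?H \<longlongrightarrow> K * \<bar>a t - a t\<bar> + 0 + norm (g' t) * norm (cis (a t) - cis (a t))) (at t)"
      by (intro tendsto_intros la)
    then show "(?H \<longlongrightarrow> 0) (at t)" by simp
    fix y assume y: "y \<noteq> t"
    have "(\<Phi> y - \<Phi> t) - (y - t) *\<^sub>R (g' t * \<phi> (cis t))
        = (g (cis t) * (cis (a y) - cis (a t)) - \<i> * (P (a y) - P (a t)))
          + (?R t y) * cis (a y)
          + (y - t) *\<^sub>R (g' t * (cis (a y) - cis (a t)))"
      unfolding \<Phi>_def a(2) by (simp add: algebra_simps)
    also have "norm \<dots> \<le> K * \<bar>y - t\<bar> * \<bar>a y - a t\<bar>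
        + norm (?R t y)
        + \<bar>y - t\<bar> * (norm (g' t) * norm (cis (a y) - cis (a t)))"
      by (intro order_trans[OF norm_triangle_ineq] add_mono bound) (simp_all add: norm_mult)
    also have "\<dots> = ?H y * norm (y - t)"
      using y by (simp add: algebra_simps)
    finally show "norm ((\<Phi> y - \<Phi> t) - (y - t) *\<^sub>R (g' t * \<phi> (cis t))) / norm (y - t) \<le> ?H y"
      using y by (simp add: divide_le_eq)
  qed (auto intro: bounded_linear_scaleR_left)
  have FTC: "((\<lambda>t. g' t * \<phi> (cis t)) has_integral \<Phi> (2 * pi) - \<Phi> 0) {0..2 * pi}"
    by (rule fundamental_theorem_of_calculus) (auto intro: has_vector_derivative_at_within d\<Phi>)
  have F_int: "P (2 * pi) - P 0 = integral {0..2 * pi} F"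
    using fundamental_theorem_of_calculus[of 0 "2 * pi" P F] P
    by (simp add: has_vector_derivative_at_within integral_unique)
  \<comment> \<open>The integrand \<open>F\<close> has period \<open>2 * pi\<close>, so the growth
    of \<open>P\<close> over one period does not depend on where it starts.\<close>
  have P_per: "P (x + 2 * pi) - P x = P (2 * pi) - P 0" for x
  proof -
    have "((\<lambda>x. P (x + 2 * pi) - P x) has_vector_derivative 0) (at x)" for x
    proof -
      have "((\<lambda>x. P (x + 2 * pi)) has_vector_derivative 1 *\<^sub>R F (x + 2 * pi)) (at x)"
        by (rule vector_diff_chain_at[where f="\<lambda>x. x + 2 * pi" and g=P, unfolded o_def])
          (auto intro!: derivative_eq_intros P)
      from has_vector_derivative_diff[OF this P[of x]] show ?thesis
        by (simp add: F_def cis_mult[symmetric])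
    qed
    then have "((\<lambda>x. P (x + 2 * pi) - P x) has_derivative (\<lambda>h. 0)) (at y within UNIV)" for y
      by (simp add: has_vector_derivative_def)
    then obtain c where "\<And>x. P (x + 2 * pi) - P x = c"
      using has_derivative_zero_constant[of UNIV "\<lambda>x. P (x + 2 * pi) - P x"] by auto
    then show ?thesis by (metis add_0)
  qed
  \<comment> \<open>The degree enters here: over one turn of \<open>t\<close> the lift runs through
    one period of \<open>P\<close>, forwards or backwards. In the second case the period starts at
    \<open>a 0 - 2 * pi\<close>.\<close>
  have "P (a 0 + 2 * pi * real_of_int m) - P (a 0) = of_int m * integral {0..2 * pi} F"
    using a(4)
  proof
    assume "m = 1" then show ?thesis using P_per[of "a 0"] F_int by simp
  next
    assume "m = -1" then show ?thesis using P_per[of "a 0 - 2 * pi"] F_int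
      by (simp add: algebra_simps)
  qed
  moreover have "cis (a (2 * pi)) = cis (a 0)"
    by (simp flip: a(2))
  ultimately have "\<Phi> (2 * pi) - \<Phi> 0 = - \<i> * of_int m * integral {0..2 * pi} F"
    using a(3)[of 0] cis_2pi unfolding \<Phi>_def by (simp only: cis_zero) (simp add: algebra_simps)
  then show ?thesis using FTC by (simp add: F_def[abs_def])
qed

section \<open>Cauchy integrals of the inverse and the differential of the extension\<close>

definition cauchy_transform :: "(complex \<Rightarrow> complex) \<Rightarrow> (complex \<Rightarrow> complex) \<Rightarrow> complex \<Rightarrow> complex" where
  "cauchy_transform \<psi> v z = (LINT \<eta>|arc_length. v \<eta> / (\<psi> \<eta> - z))"

text \<open>The triangle inequality is attained in the direction \<open>cis s\<close>, chosen so
  that both summands get the common argument \<open>(Arg a - Arg b) / 2\<close>.\<close>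

lemma onorm_linear_plus_antilinear:
  "onorm (\<lambda>v. a * v + cnj (b * v)) = norm a + norm b"
proof (rule antisym)
  have bl: "bounded_linear (\<lambda>v. a * v + cnj (b * v))"
    by (intro bounded_linear_add bounded_linear_mult_right
        bounded_linear_compose[OF bounded_linear_cnj bounded_linear_mult_right])
  show "onorm (\<lambda>v. a * v + cnj (b * v)) \<le> norm a + norm b"
  proof (rule onorm_le)
    fix v
    have "norm (a * v + cnj (b * v)) \<le> norm (a * v) + norm (cnj (b * v))" by (rule norm_triangle_ineq)
    then show "norm (a * v + cnj (b * v)) \<le> (norm a + norm b) * norm v"
      by (simp add: norm_mult algebra_simps)
  qed
  define s where "s = - (Arg a + Arg b) / 2"
  have a: "a = of_real (norm a) * cis (Arg a)" and b: "b = of_real (norm b) * cis (Arg b)"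
    using rcis_cmod_Arg[of a] rcis_cmod_Arg[of b] by (simp_all add: rcis_def)
  have "a * cis s = of_real (norm a) * cis ((Arg a - Arg b) / 2)"
    by (subst a) (simp add: s_def mult.assoc cis_mult field_simps)
  moreover have "cnj (b * cis s) = of_real (norm b) * cis ((Arg a - Arg b) / 2)"
    by (subst b) (simp add: s_def mult.assoc cis_mult cis_cnj field_simps)
  ultimately have "a * cis s + cnj (b * cis s) = of_real (norm a + norm b) * cis ((Arg a - Arg b) / 2)"
    by (simp add: algebra_simps)
  then have "norm (a * cis s + cnj (b * cis s)) = norm a + norm b"
    by (simp add: norm_mult flip: of_real_add)
  with onorm[OF bl, of "cis s"] show "norm a + norm b \<le> onorm (\<lambda>v. a * v + cnj (b * v))"
    by simp
qed

lemma circle_minus_disc_nonzero: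
  assumes "norm (w :: complex) = 1" "norm z < 1"
  shows "w - z \<noteq> 0" "1 - z * cnj w \<noteq> 0"
proof -
  show "w - z \<noteq> 0" using assms by auto
  have "norm (z * cnj w) < 1" using assms by (simp add: norm_mult)
  then show "1 - z * cnj w \<noteq> 0" by auto
qed

text \<open>With \<open>u = z * cnj w\<close> the kernel is a holomorphic function of
  \<open>z\<close> plus the conjugate of another one. The harmonic extension therefore splits in the
  same way, and its differential is linear plus antilinear.\<close>

lemma poisson_kernel_split:
  assumes "norm w = 1" "norm z < 1"
  shows "of_real ((1 - (norm z)\<^sup>2) / (norm (z - w))\<^sup>2)
       = 1 / (1 - z * cnj w) + cnj (z * cnj w / (1 - z * cnj w))"
proof -
  define u where "u = z * cnj w"
  have ww: "w * cnj w = 1" using assms(1) by (simp add: complex_norm_square[symmetric])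
  have "z - w = - w * (1 - u)" by (simp add: u_def algebra_simps ww)
  then have n: "norm (z - w) = norm (1 - u)" using assms(1) by (simp add: norm_mult)
  have nu: "norm u = norm z" using assms(1) by (simp add: u_def norm_mult)
  have ne: "1 - u \<noteq> 0" "1 - cnj u \<noteq> 0"
  proof -
    show "1 - u \<noteq> 0" using circle_minus_disc_nonzero(2)[OF assms] by (simp add: u_def)
    then have "cnj (1 - u) \<noteq> 0" by (simp only: complex_cnj_zero_iff not_False_eq_True)
    then show "1 - cnj u \<noteq> 0" by simp
  qed
  have "of_real ((1 - (norm z)\<^sup>2) / (norm (z - w))\<^sup>2) = (1 - u * cnj u) / ((1 - u) * (1 - cnj u))"
    unfolding n nu[symmetric] of_real_divide by (simp add: complex_norm_square del: of_real_power)
  also have "\<dots> = 1 / (1 - u) + cnj u / (1 - cnj u)"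
    using ne by (subst add_frac_eq) (simp_all add: algebra_simps)
  finally show ?thesis by (simp add: u_def)
qed

lemma cauchy_kernel_integral_by_parts:
  assumes hom: "homeomorphism (sphere 0 1) (sphere 0 1) \<phi> \<psi>"
    and a: "continuous_on UNIV a" "\<And>t. \<phi> (cis t) = cis (a t)" "\<And>t. a (t + 2 * pi) = a t + 2 * pi * real_of_int m"
      "m = 1 \<or> m = -1"
    and z: "norm z < 1"
  shows "integral {0..2 * pi} (\<lambda>t. \<phi> (cis t) * (cis (-t) / (1 - z * cis (-t))\<^sup>2))
         = of_int m * cauchy_transform \<psi> (\<lambda>\<eta>. \<eta>) z" (is ?th1)
    and "integral {0..2 * pi} (\<lambda>t. cnj (\<phi> (cis t)) * (cis (-t) / (1 - z * cis (-t))\<^sup>2))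
         = - of_int m * cauchy_transform \<psi> cnj z" (is ?th2)
proof -
  let ?I = "cauchy_transform \<psi> (\<lambda>\<eta>. \<eta>) z"
  let ?J = "cauchy_transform \<psi> cnj z"
  have c\<psi>: "continuous_on (sphere 0 1) \<psi>" "\<psi> ` sphere 0 1 \<subseteq> sphere 0 1"
    using hom by (auto simp: homeomorphism_def)
  define g where "g w = 1 / (w - z)" for w
  define g' where "g' t = - \<i> * (cis (-t) / (1 - z * cis (-t))\<^sup>2)" for t
  have cg: "continuous_on (sphere 0 1) g"
    unfolding g_def using circle_minus_disc_nonzero(1)[OF _ z] by (intro continuous_intros) auto
  \<comment> \<open>Two forms of one derivative: the one in \<open>cis (-t)\<close> matches the
    differentiated kernel, the one in \<open>cis t\<close> comes out of the chain rule.\<close>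
  have g'_eq: "g' t = - \<i> * cis t / (cis t - z)\<^sup>2" for t
  proof -
    have "cis t * (1 - z * cis (-t)) = cis t - z"
      by (simp add: algebra_simps cis_mult)
    then have "(cis t - z)\<^sup>2 = cis t * cis t * (1 - z * cis (-t))\<^sup>2"
      by (metis power2_eq_square power_mult_distrib)
    then have "cis t / (cis t - z)\<^sup>2 = (cis (-t) * (cis t * cis t)) / ((1 - z * cis (-t))\<^sup>2 * (cis t * cis t))"
      by (simp add: cis_mult mult.commute)
    also have "\<dots> = cis (-t) / (1 - z * cis (-t))\<^sup>2"
      by (rule mult_divide_mult_cancel_right) simp
    finally show ?thesis by (simp add: g'_def flip: times_divide_eq_right)
  qed
  have dg: "((\<lambda>t. g (cis t)) has_vector_derivative g' t) (at t)" for t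
  proof -
    have "(g has_field_derivative (- 1 / (cis t - z)\<^sup>2)) (at (cis t))"
      unfolding g_def using circle_minus_disc_nonzero(1)[of "cis t", OF _ z]
      by (auto intro!: derivative_eq_intros simp: power2_eq_square)
    then have "((g \<circ> cis) has_vector_derivative (\<i> * cis t) * (- 1 / (cis t - z)\<^sup>2)) (at t)"
      by (intro field_vector_diff_chain_at has_vector_derivative_cis)
    then show ?thesis by (simp add: g'_eq o_def)
  qed
  have bg: "norm (g' t) \<le> 1 / (1 - norm z)\<^sup>2" for t
  proof -
    have "1 - norm z \<le> norm (cis t - z)"
      using norm_triangle_ineq2[of "cis t" z] by simp
    then have "(1 - norm z)\<^sup>2 \<le> (norm (cis t - z))\<^sup>2"
      using z by (intro power_mono) auto
    then show ?thesis
      using z by (simp add: g'_eq norm_mult norm_divide norm_power frac_le)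
  qed
  have cont1: "continuous_on (sphere 0 1) (\<lambda>\<eta>. v \<eta> / (\<psi> \<eta> - z))" if "continuous_on (sphere 0 1) v" for v
    using that c\<psi> circle_minus_disc_nonzero(1)[OF _ z] by (intro continuous_intros) force+
  have "((\<lambda>t. g' t * \<phi> (cis t)) has_integral
           - \<i> * of_int m * integral {0..2 * pi} (\<lambda>s. cis s * g (\<psi> (cis s)))) {0..2 * pi}"
    by (rule circle_integration_by_parts[OF hom a cg dg bg])
  moreover have "integral {0..2 * pi} (\<lambda>s. cis s * g (\<psi> (cis s))) = ?I"
    unfolding cauchy_transform_def by (subst integral_arc_length) (auto intro!: cont1 continuous_intros simp: g_def)
  ultimately have "((\<lambda>t. g' t * \<phi> (cis t)) has_integral
           - \<i> * of_int m * ?I) {0..2 * pi}" by simp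
  from has_integral_mult_right[OF this, of \<i>] show ?th1
    by (intro integral_unique) (simp add: g'_def algebra_simps)
  \<comment> \<open>The second identity applies the integration by parts to the conjugate of
    \<open>g\<close> and conjugates the result. This turns \<open>- \<i>\<close> into
    \<open>\<i>\<close> and accounts for the opposite sign.\<close>
  have "((\<lambda>t. cnj (g' t) * \<phi> (cis t)) has_integral
           - \<i> * of_int m * integral {0..2 * pi} (\<lambda>s. cis s * cnj (g (\<psi> (cis s))))) {0..2 * pi}"
    using cg by (rule circle_integration_by_parts[OF hom a, where K="1 / (1 - norm z)\<^sup>2" and g="\<lambda>w. cnj (g w)", OF continuous_on_cnj])
      (use bg dg in \<open>auto intro!: has_vector_derivative_cnj\<close>)
  then have "((\<lambda>t. cnj (cnj (g' t) * \<phi> (cis t))) has_integral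
           cnj (- \<i> * of_int m * integral {0..2 * pi} (\<lambda>s. cis s * cnj (g (\<psi> (cis s)))))) {0..2 * pi}"
    by (simp only: has_integral_cnj[unfolded comp_def])
  moreover have "cnj (integral {0..2 * pi} (\<lambda>s. cis s * cnj (g (\<psi> (cis s))))) = ?J"
    unfolding cauchy_transform_def Henstock_Kurzweil_Integration.integral_cnj
    by (subst integral_arc_length) (auto intro!: cont1 continuous_intros simp: g_def cis_cnj)
  ultimately have "((\<lambda>t. g' t * cnj (\<phi> (cis t))) has_integral
           \<i> * of_int m * ?J) {0..2 * pi}" by simp
  from has_integral_mult_right[OF this, of \<i>] show ?th2
    by (intro integral_unique) (simp add: g'_def algebra_simps)
qed

text \<open>Both holomorphic halves are differentiated under the integral sign, and the
  differentiated kernel is the one that was integrated by parts. The degree \<open>m\<close> has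
  modulus one, so orientation disappears from the norm.\<close>

lemma norm_D_poisson_extension:
  assumes hom: "homeomorphism (sphere 0 1) (sphere 0 1) \<phi> \<psi>"
    and z: "norm z < 1"
  shows "norm_D (poisson_extension \<phi>) z
       = (norm (cauchy_transform \<psi> (\<lambda>\<eta>. \<eta>) z) + norm (cauchy_transform \<psi> cnj z)) / (2 * pi)"
proof -
  let ?K = "\<lambda>z t. cis (-t) / (1 - z * cis (-t))\<^sup>2"
  let ?A = "cauchy_transform \<psi> (\<lambda>\<eta>. \<eta>) z"
  let ?B = "cauchy_transform \<psi> cnj z"
  let ?f = "\<lambda>z t. \<phi> (cis t) * (1 / (1 - z * cis (-t)))"
  let ?k = "\<lambda>z t. cnj (\<phi> (cis t)) * (z * cis (-t) / (1 - z * cis (-t)))"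
  obtain a :: "real \<Rightarrow> real" and m :: int where a: "continuous_on UNIV a" "\<And>t. \<phi> (cis t) = cis (a t)"
    "\<And>t. a (t + 2 * pi) = a t + 2 * pi * m" "m = 1 \<or> m = -1"
    using circle_homeomorphism_lift[OF hom] by blast
  have c\<phi>: "continuous_on (sphere 0 1) \<phi>" using hom by (simp add: homeomorphism_def)
  have c\<phi>': "continuous_on A (\<lambda>t. \<phi> (cis (u t)))" if "continuous_on A u" for A :: "'a :: topological_space set" and u
    by (rule continuous_on_compose2[OF c\<phi>]) (auto intro!: continuous_intros that)
  have nz: "1 - w * cis (-s) \<noteq> 0" if "norm w < 1" for w s
    using circle_minus_disc_nonzero(2)[OF _ that, of "cis s"] by (simp add: cis_cnj)
  define f where "f z = integral (cbox 0 (2 * pi)) (\<lambda>t. ?f z t)" for z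
  define k where "k z = integral (cbox 0 (2 * pi)) (\<lambda>t. ?k z t)" for z
  have h: "poisson_extension \<phi> z = (1 / (2 * pi)) *\<^sub>R (f z + cnj (k z))" if z: "norm z < 1" for z
  proof -
    have c1: "continuous_on {0..2*pi} (\<lambda>t. ?f z t)"
      "continuous_on {0..2*pi} (\<lambda>t. cnj (?k z t))"
      using nz z by (auto intro!: continuous_intros c\<phi>' continuous_on_cnj simp del: complex_cnj_mult complex_cnj_divide)
    have "(LINT \<zeta>|arc_length. ((1 - (norm z)\<^sup>2) / (norm (z - \<zeta>))\<^sup>2) *\<^sub>R \<phi> \<zeta>)
        = integral {0..2 * pi} (\<lambda>t. ((1 - (norm z)\<^sup>2) / (norm (z - cis t))\<^sup>2) *\<^sub>R \<phi> (cis t))"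
      using circle_minus_disc_nonzero(1)[OF _ z] by (intro integral_arc_length continuous_intros c\<phi>) force
    also have "\<dots> = integral {0..2 * pi} (\<lambda>t. ?f z t
        + cnj (?k z t))"
      using poisson_kernel_split[of "cis t" z for t] z
      by (intro integral_cong) (simp add: scaleR_conv_of_real algebra_simps cis_cnj)
    also have "\<dots> = f z + cnj (k z)"
      unfolding f_def k_def Henstock_Kurzweil_Integration.integral_cnj box_real
      by (intro Henstock_Kurzweil_Integration.integral_add integrable_continuous_interval c1)
    finally show ?thesis by (simp add: poisson_extension_def)
  qed
  have df: "(f has_field_derivative of_int m * ?A) (at z)"
  proof -
    have "((\<lambda>z. integral (cbox 0 (2 * pi)) (\<lambda>t. ?f z t))
        has_field_derivative integral (cbox 0 (2 * pi)) (\<lambda>t. \<phi> (cis t) * (?K z t))) (at z within ball 0 1)"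
    proof (rule leibniz_rule_field_derivative)
      fix x :: complex and t :: real assume x: "x \<in> ball 0 1"
      then show "((\<lambda>x. \<phi> (cis t) * (1 / (1 - x * cis (- t)))) has_field_derivative
          \<phi> (cis t) * (cis (- t) / (1 - x * cis (- t))\<^sup>2)) (at x within ball 0 1)"
        using nz by (auto intro!: derivative_eq_intros simp: power2_eq_square)
    next
      fix x :: complex assume x: "x \<in> ball 0 1"
      then show "(\<lambda>t. \<phi> (cis t) * (1 / (1 - x * cis (-t)))) integrable_on cbox 0 (2 * pi)"
        using nz by (auto intro!: integrable_continuous_interval continuous_intros c\<phi>')
    next
      show "continuous_on (ball 0 1 \<times> cbox 0 (2 * pi)) (\<lambda>(x, t). \<phi> (cis t) * (cis (- t) / (1 - x * cis (- t))\<^sup>2))"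
        using nz by (auto simp: case_prod_unfold intro!: continuous_intros c\<phi>')
    qed (use z in auto)
    then show ?thesis
      using z cauchy_kernel_integral_by_parts(1)[OF hom a z]
      by (simp add: f_def[abs_def] at_within_open[of z "ball 0 1"])
  qed
  have dk: "(k has_field_derivative - of_int m * ?B) (at z)"
  proof -
    have "((\<lambda>z. integral (cbox 0 (2 * pi)) (\<lambda>t. ?k z t))
        has_field_derivative integral (cbox 0 (2 * pi)) (\<lambda>t. cnj (\<phi> (cis t)) * (?K z t))) (at z within ball 0 1)"
    proof (rule leibniz_rule_field_derivative)
      fix x :: complex and t :: real assume x: "x \<in> ball 0 1"
      then show "((\<lambda>x. cnj (\<phi> (cis t)) * (x * cis (-t) / (1 - x * cis (- t)))) has_field_derivative
          cnj (\<phi> (cis t)) * (cis (- t) / (1 - x * cis (- t))\<^sup>2)) (at x within ball 0 1)"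
        using nz by (auto intro!: derivative_eq_intros simp: power2_eq_square field_simps)
    next
      fix x :: complex assume x: "x \<in> ball 0 1"
      then show "(\<lambda>t. cnj (\<phi> (cis t)) * (x * cis (-t) / (1 - x * cis (-t)))) integrable_on cbox 0 (2 * pi)"
        using nz by (auto intro!: integrable_continuous_interval continuous_intros c\<phi>')
    next
      show "continuous_on (ball 0 1 \<times> cbox 0 (2 * pi)) (\<lambda>(x, t). cnj (\<phi> (cis t)) * (cis (- t) / (1 - x * cis (- t))\<^sup>2))"
        using nz by (auto simp: case_prod_unfold intro!: continuous_intros c\<phi>')
    qed (use z in auto)
    then show ?thesis
      using z cauchy_kernel_integral_by_parts(2)[OF hom a z]
      by (simp add: k_def[abs_def] at_within_open[of z "ball 0 1"])
  qed
  define A where "A = of_int m * ?A / (2 * pi)"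
  define B where "B = - of_int m * ?B / (2 * pi)"
  have "((\<lambda>z. (1 / (2 * pi)) *\<^sub>R (f z + cnj (k z))) has_derivative
      (\<lambda>v. (1 / (2 * pi)) *\<^sub>R (of_int m * ?A * v + cnj (- of_int m * ?B * v)))) (at z)"
    using df dk unfolding has_field_derivative_def
    by (intro has_derivative_scaleR_right has_derivative_add has_derivative_cnj)
  also have "(\<lambda>v. (1 / (2 * pi)) *\<^sub>R (of_int m * ?A * v + cnj (- of_int m * ?B * v)))
      = (\<lambda>v. A * v + cnj (B * v))"
    by (simp add: A_def B_def scaleR_conv_of_real fun_eq_iff field_simps)
  finally have "(poisson_extension \<phi> has_derivative (\<lambda>v. A * v + cnj (B * v))) (at z)"
    by (rule has_derivative_transform_within_open[where s="ball 0 1"]) (use z h in auto)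
  then have "frechet_derivative (poisson_extension \<phi>) (at z) = (\<lambda>v. A * v + cnj (B * v))"
    by (rule frechet_derivative_at[symmetric])
  then have "norm_D (poisson_extension \<phi>) z = norm A + norm B"
    by (simp only: norm_D_def onorm_linear_plus_antilinear)
  also have "\<dots> = (norm (?A) + norm (?B)) / (2 * pi)"
    using a(4) by (auto simp: A_def B_def norm_mult norm_divide add_divide_distrib)
  finally show ?thesis .
qed

section \<open>Energy on circles\<close>

lemma integrable_bounded_arc_length:
  fixes f :: "complex \<Rightarrow> 'a :: {banach, second_countable_topology}"
  assumes "f \<in> borel_measurable arc_length" "\<And>x. x \<in> sphere 0 1 \<Longrightarrow> norm (f x) \<le> C"
  shows "integrable arc_length f"
  using assms by (intro arc_length.integrable_const_bound[where B=C] AE_I2) auto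

lemma integrable_bounded_arc_pair:
  fixes f :: "complex \<times> complex \<Rightarrow> 'a :: {banach, second_countable_topology}"
  assumes "f \<in> borel_measurable (arc_length \<Otimes>\<^sub>M arc_length)"
    "\<And>x y. x \<in> sphere 0 1 \<Longrightarrow> y \<in> sphere 0 1 \<Longrightarrow> norm (f (x, y)) \<le> C"
  shows "integrable (arc_length \<Otimes>\<^sub>M arc_length) f"
proof -
  interpret P: finite_measure "arc_length \<Otimes>\<^sub>M arc_length"
    by (rule finite_measure_pair_measure) unfold_locales
  show ?thesis
    using assms by (intro P.integrable_const_bound[where B=C] AE_I2) (auto simp: space_pair_measure)
qed

lemma borel_measurable_cnj [measurable (raw)]:
  "f \<in> borel_measurable M \<Longrightarrow> (\<lambda>x. cnj (f x)) \<in> borel_measurable M"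
  by (rule borel_measurable_continuous_on[where f=cnj]) (auto intro: continuous_intros)

text \<open>A squared modulus is the integral times its conjugate \<open>S\<close>. Two uses of
  Fubini, justified because everything is bounded on a finite measure, bring the integral over
  \<open>\<omega>\<close> inside, where it becomes a Gram kernel of \<open>K\<close>.\<close>

lemma arc_length_square_integral:
  fixes K :: "complex \<Rightarrow> complex \<Rightarrow> complex" and v :: "complex \<Rightarrow> complex"
  assumes K [measurable]: "(\<lambda>(x, y). K x y) \<in> borel_measurable (arc_length \<Otimes>\<^sub>M arc_length)"
    and Kb: "\<And>x y. x \<in> sphere 0 1 \<Longrightarrow> y \<in> sphere 0 1 \<Longrightarrow> norm (K x y) \<le> C"
    and v [measurable]: "v \<in> borel_measurable arc_length"
    and vb: "\<And>x. x \<in> sphere 0 1 \<Longrightarrow> norm (v x) \<le> 1"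
  shows "(LINT \<omega>|arc_length. of_real ((norm (LINT \<eta>|arc_length. v \<eta> * K \<eta> \<omega>))\<^sup>2))
       = (LINT \<eta>|arc_length. LINT \<xi>|arc_length. v \<eta> * cnj (v \<xi>) * (LINT \<omega>|arc_length. K \<eta> \<omega> * cnj (K \<xi> \<omega>)))"
proof -
  define S where "S \<omega> = cnj (LINT \<eta>|arc_length. v \<eta> * K \<eta> \<omega>)" for \<omega>
  have [measurable]: "S \<in> borel_measurable arc_length"
    unfolding S_def by measurable
  have C0: "C \<ge> 0" using Kb[of 1 1] norm_ge_zero[of "K 1 1"] by (simp del: norm_ge_zero)
  have vK: "norm (v x * K x y) \<le> C" if "x \<in> sphere 0 1" "y \<in> sphere 0 1" for x y
    using mult_mono[OF vb[OF that(1)] Kb[OF that]] by (simp add: norm_mult)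
  have Sb: "norm (S \<omega>) \<le> 2 * pi * C" if "\<omega> \<in> sphere 0 1" for \<omega>
  proof -
    have "norm (S \<omega>) \<le> (LINT \<eta>|arc_length. norm (v \<eta> * K \<eta> \<omega>))"
      unfolding S_def by (simp only: complex_mod_cnj) (rule integral_norm_bound)
    also have "\<dots> \<le> (LINT \<eta>|arc_length. C)"
      using vK that by (intro integral_mono' integrable_bounded_arc_length[where C=C]) (auto simp: C0)
    also have "\<dots> = 2 * pi * C"
      by (simp add: measure_def emeasure_arc_length_space)
    finally show ?thesis .
  qed
  have "(LINT \<omega>|arc_length. of_real ((norm (LINT \<eta>|arc_length. v \<eta> * K \<eta> \<omega>))\<^sup>2))
      = (LINT \<omega>|arc_length. LINT \<eta>|arc_length. v \<eta> * K \<eta> \<omega> * S \<omega>)"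
    by (simp add: S_def complex_norm_square del: of_real_power)
  also have "\<dots> = (LINT \<eta>|arc_length. LINT \<omega>|arc_length. v \<eta> * K \<eta> \<omega> * S \<omega>)"
  proof (rule arc_pair.Fubini_integral)
    show "integrable (arc_length \<Otimes>\<^sub>M arc_length) (\<lambda>(x, y). v x * K x y * S y)"
    proof (rule integrable_bounded_arc_pair[where C="C * (2 * pi * C)"])
      show "norm (case (x, y) of (x, y) \<Rightarrow> v x * K x y * S y) \<le> C * (2 * pi * C)"
        if "x \<in> sphere 0 1" "y \<in> sphere 0 1" for x y
        using mult_mono[OF vK[OF that] Sb[OF that(2)]] C0 by (simp add: norm_mult)
    qed measurable
  qed
  also have "\<dots> = (LINT \<eta>|arc_length. LINT \<xi>|arc_length. v \<eta> * cnj (v \<xi>) * (LINT \<omega>|arc_length. K \<eta> \<omega> * cnj (K \<xi> \<omega>)))"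
  proof (rule Bochner_Integration.integral_cong[OF refl])
    fix \<eta> assume "\<eta> \<in> space arc_length"
    then have \<eta>: "\<eta> \<in> sphere 0 1" by simp
    have [measurable]: "K \<eta> \<in> borel_measurable arc_length"
      using measurable_Pair2[OF K, of \<eta>] \<eta> by simp
    have "(LINT \<omega>|arc_length. v \<eta> * K \<eta> \<omega> * S \<omega>)
        = (LINT \<omega>|arc_length. LINT \<xi>|arc_length. v \<eta> * K \<eta> \<omega> * cnj (v \<xi> * K \<xi> \<omega>))"
    proof (rule Bochner_Integration.integral_cong[OF refl])
      fix \<omega>
      have "S \<omega> = (LINT \<xi>|arc_length. cnj (v \<xi> * K \<xi> \<omega>))"
        unfolding S_def by (rule Bochner_Integration.integral_cnj[symmetric])
      then show "v \<eta> * K \<eta> \<omega> * S \<omega> = (LINT \<xi>|arc_length. v \<eta> * K \<eta> \<omega> * cnj (v \<xi> * K \<xi> \<omega>))"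
        by (simp only: integral_mult_right_zero)
    qed
    also have "\<dots> = (LINT \<xi>|arc_length. LINT \<omega>|arc_length. v \<eta> * K \<eta> \<omega> * cnj (v \<xi> * K \<xi> \<omega>))"
    proof (rule arc_pair.Fubini_integral)
      show "integrable (arc_length \<Otimes>\<^sub>M arc_length) (\<lambda>(x, y). v \<eta> * K \<eta> y * cnj (v x * K x y))"
      proof (rule integrable_bounded_arc_pair[where C="C * C"])
        show "norm (case (x, y) of (x, y) \<Rightarrow> v \<eta> * K \<eta> y * cnj (v x * K x y)) \<le> C * C"
          if "x \<in> sphere 0 1" "y \<in> sphere 0 1" for x y
          using mult_mono[OF vK[OF \<eta> that(2)] vK[OF that]] C0 by (simp add: norm_mult)
      qed measurable
    qed
    also have "\<dots> = (LINT \<xi>|arc_length. v \<eta> * cnj (v \<xi>) * (LINT \<omega>|arc_length. K \<eta> \<omega> * cnj (K \<xi> \<omega>)))"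
    proof (rule Bochner_Integration.integral_cong[OF refl])
      fix \<xi>
      have "(LINT \<omega>|arc_length. v \<eta> * K \<eta> \<omega> * cnj (v \<xi> * K \<xi> \<omega>))
          = (LINT \<omega>|arc_length. (v \<eta> * cnj (v \<xi>)) * (K \<eta> \<omega> * cnj (K \<xi> \<omega>)))"
        by (intro Bochner_Integration.integral_cong) (auto simp: mult_ac)
      then show "(LINT \<omega>|arc_length. v \<eta> * K \<eta> \<omega> * cnj (v \<xi> * K \<xi> \<omega>))
          = v \<eta> * cnj (v \<xi>) * (LINT \<omega>|arc_length. K \<eta> \<omega> * cnj (K \<xi> \<omega>))"
        by simp
    qed
    finally show "(LINT \<omega>|arc_length. v \<eta> * K \<eta> \<omega> * S \<omega>)
      = (LINT \<xi>|arc_length. v \<eta> * cnj (v \<xi>) * (LINT \<omega>|arc_length. K \<eta> \<omega> * cnj (K \<xi> \<omega>)))" .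
  qed
  finally show ?thesis .
qed

text \<open>On the unit circle \<open>cnj \<omega>\<close> is the inverse of
  \<open>\<omega>\<close>, which turns the conjugated factor into a Cauchy kernel with pole
  \<open>r * b\<close> inside the disc. The other factor has its pole \<open>a / r\<close> outside,
  so Cauchy's formula evaluates it at \<open>r * b\<close>.\<close>

lemma arc_length_product_of_cauchy_kernels:
  assumes a: "norm a = 1" and b: "norm b = 1" and r: "0 < r" "r < 1"
  shows "(LINT \<omega>|arc_length. 1 / (a - of_real r * \<omega>) * cnj (1 / (b - of_real r * \<omega>)))
       = 2 * pi * (cnj a * b) / (1 - of_real (r\<^sup>2) * (cnj a * b))"
proof -
  have aa: "a * cnj a = 1" "b * cnj b = 1" using a b by (simp_all add: complex_norm_square[symmetric])
  have ne: "c - of_real r * w \<noteq> 0" if "norm c = 1" "norm w \<le> 1" for c w :: complex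
  proof
    assume "c - of_real r * w = 0"
    then have "norm c = r * norm w" using r by (simp add: norm_mult)
    also have "\<dots> < 1" using r that by (metis mult_le_one norm_ge_zero less_eq_real_def mult.right_neutral mult_left_mono order_le_less_trans)
    finally show False using that by simp
  qed
  define f where "f w = 1 / ((a - of_real r * w) * cnj b)" for w
  have fh: "f holomorphic_on cball 0 1"
    unfolding f_def using ne[OF a] b by (intro holomorphic_intros) auto
  have "((\<lambda>u. f u / (u - of_real r * b)) has_contour_integral 2 * of_real pi * \<i> * f (of_real r * b)) (circlepath 0 1)"
    by (rule Cauchy_integral_circlepath_simple[OF fh]) (use r b in \<open>simp add: norm_mult\<close>)
  then have "((\<lambda>t. f (cis t) / (cis t - of_real r * b) * \<i> * cis t) has_integral 2 * of_real pi * \<i> * f (of_real r * b)) {0..2 * pi}"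
    unfolding circlepath_def by (subst (asm) has_contour_integral_part_circlepath_iff) simp_all
  from has_integral_mult_right[OF this, of "-\<i>"]
  have "((\<lambda>t. f (cis t) / (cis t - of_real r * b) * cis t) has_integral 2 * of_real pi * f (of_real r * b)) {0..2 * pi}"
    by (simp add: mult_ac)
  moreover have "f (cis t) / (cis t - of_real r * b) * cis t
      = 1 / (a - of_real r * cis t) * cnj (1 / (b - of_real r * cis t))" for t
  proof -
    have "cnj b * (cis t - of_real r * b) = cis t * cnj (b - of_real r * cis t)"
      using aa(2) by (simp add: algebra_simps cis_cnj cis_mult)
    moreover have "cis t - of_real r * b \<noteq> 0" "cnj (b - of_real r * cis t) \<noteq> 0"
      using ne[of "cis t" b] ne[of b "cis t"] b by (auto simp del: complex_cnj_diff complex_cnj_mult)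
    ultimately have "cis t / (cnj b * (cis t - of_real r * b)) = 1 / cnj (b - of_real r * cis t)"
      by simp
    then show ?thesis
      unfolding f_def by (metis (no_types, opaque_lifting) complex_cnj_divide complex_cnj_one divide_divide_eq_left
          mult.assoc times_divide_eq_left times_divide_eq_right mult_1)
  qed
  ultimately have "((\<lambda>t. 1 / (a - of_real r * cis t) * cnj (1 / (b - of_real r * cis t))) has_integral 2 * of_real pi * f (of_real r * b)) {0..2 * pi}"
    by simp
  then have "(LINT \<omega>|arc_length. 1 / (a - of_real r * \<omega>) * cnj (1 / (b - of_real r * \<omega>))) = 2 * of_real pi * f (of_real r * b)"
    using ne[OF a] ne[OF b]
    by (subst integral_arc_length) (auto intro!: continuous_intros continuous_on_cnj integral_unique simp del: complex_cnj_divide)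
  also have "f (of_real r * b) = (cnj a * b) / (1 - of_real (r\<^sup>2) * (cnj a * b))"
  proof -
    have n1: "a - of_real (r\<^sup>2) * b \<noteq> 0"
      using ne[OF a, of "of_real r * b"] r b by (simp add: norm_mult power2_eq_square mult.assoc)
    have "(cnj a * b) * ((a - of_real (r\<^sup>2) * b) * cnj b) = (a * cnj a) * (b * cnj b) - of_real (r\<^sup>2) * (cnj a * b) * (b * cnj b)"
      by (simp add: algebra_simps)
    then have e: "(cnj a * b) * ((a - of_real (r\<^sup>2) * b) * cnj b) = 1 - of_real (r\<^sup>2) * (cnj a * b)"
      by (simp add: aa)
    have "(a - of_real (r\<^sup>2) * b) * cnj b \<noteq> 0" "cnj a * b \<noteq> 0" using n1 a b by auto
    then have "(cnj a * b) / (1 - of_real (r\<^sup>2) * (cnj a * b)) = 1 / ((a - of_real (r\<^sup>2) * b) * cnj b)"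
      unfolding e[symmetric] by simp
    then show ?thesis by (simp add: f_def power2_eq_square mult.assoc)
  qed
  finally show ?thesis by simp
qed

text \<open>The Poisson kernel of radius \<open>r\<^sup>2\<close>, as a function of the chordal distance.\<close>

definition chord_kernel :: "real \<Rightarrow> real \<Rightarrow> real" where
  "chord_kernel r d = (1 - r ^ 4) / ((1 - r\<^sup>2)\<^sup>2 + r\<^sup>2 * d\<^sup>2)"

lemma chord_kernel_nonneg: "0 \<le> r \<Longrightarrow> r \<le> 1 \<Longrightarrow> 0 \<le> chord_kernel r d"
  by (auto simp: chord_kernel_def power_le_one intro!: divide_nonneg_nonneg)

lemma chord_kernel_le: 
  assumes "0 \<le> r" "r < 1"
  shows "chord_kernel r d \<le> 1 / (1 - r\<^sup>2)\<^sup>2"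
proof -
  have "r\<^sup>2 < 1" using assms by (simp add: power_less_one_iff abs_square_less_1)
  then show ?thesis
    unfolding chord_kernel_def using assms by (intro frac_le) auto
qed

text \<open>For unimodular \<open>u\<close> and \<open>\<rho> = r\<twosuperior>\<close>,
  \<open>1 + 2 * \<rho> * u / (1 - \<rho> * u)\<close> equals
  \<open>(1 + \<rho> * u) / (1 - \<rho> * u)\<close>, whose real part is the Poisson kernel of
  radius \<open>\<rho>\<close>. The chord enters through \<open>Re u\<close>.\<close>

lemma Re_cauchy_kernel_eq_chord_kernel:
  assumes a: "norm a = 1" and b: "norm b = 1" and r: "0 < r" "r < 1"
  shows "2 * r\<^sup>2 * Re ((cnj a * b) / (1 - of_real (r\<^sup>2) * (cnj a * b))) = chord_kernel r (norm (a - b)) - 1"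
proof -
  define u where "u = cnj a * b"
  have na: "(Re a)\<^sup>2 + (Im a)\<^sup>2 = 1" and nb: "(Re b)\<^sup>2 + (Im b)\<^sup>2 = 1"
    using a b by (simp_all flip: cmod_power2)
  have "norm u = 1" using a b by (simp add: u_def norm_mult)
  then have nu: "(Re u)\<^sup>2 + (Im u)\<^sup>2 = 1" by (simp flip: cmod_power2)
  have "(norm (a - b))\<^sup>2 = 2 - 2 * Re u"
    using na nb unfolding cmod_power2 u_def by (simp add: power2_eq_square algebra_simps)
  then have den: "(1 - r\<^sup>2)\<^sup>2 + r\<^sup>2 * (norm (a - b))\<^sup>2 = (norm (1 - of_real (r\<^sup>2) * u))\<^sup>2"
    using nu unfolding cmod_power2 by (simp add: power2_eq_square) algebra
  have r2: "r\<^sup>2 < 1" using r by (simp add: power_less_one_iff abs_square_less_1)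
  have pos: "(norm (1 - of_real (r\<^sup>2) * u))\<^sup>2 > 0"
    using r2 unfolding den[symmetric] by (intro add_pos_nonneg) auto
  have "Re (u / (1 - of_real (r\<^sup>2) * u)) = (Re u - r\<^sup>2) / (norm (1 - of_real (r\<^sup>2) * u))\<^sup>2"
    using nu unfolding Re_divide cmod_power2
    by (intro arg_cong2[where f="(/)"] refl) (simp add: power2_eq_square, algebra)
  then have "2 * r\<^sup>2 * Re (u / (1 - of_real (r\<^sup>2) * u)) = (2 * r\<^sup>2 * (Re u - r\<^sup>2)) / (norm (1 - of_real (r\<^sup>2) * u))\<^sup>2"
    by simp
  also have "2 * r\<^sup>2 * (Re u - r\<^sup>2) = (1 - r ^ 4) - (norm (1 - of_real (r\<^sup>2) * u))\<^sup>2"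
    using nu unfolding cmod_power2 by (simp add: power2_eq_square power4_eq_xxxx) algebra
  also have "\<dots> / (norm (1 - of_real (r\<^sup>2) * u))\<^sup>2 = (1 - r ^ 4) / (norm (1 - of_real (r\<^sup>2) * u))\<^sup>2 - 1"
    using pos by (simp only: diff_divide_distrib) simp
  finally show ?thesis
    unfolding chord_kernel_def den u_def[symmetric] .
qed

section \<open>The energy of a circle as a double integral over chords\<close>

locale circle_homeomorphism =
  fixes \<phi> \<psi> :: "complex \<Rightarrow> complex"
  assumes homeo: "homeomorphism (sphere 0 1) (sphere 0 1) \<phi> \<psi>"
begin

lemma norm_psi: "norm x = 1 \<Longrightarrow> norm (\<psi> x) = 1"
  using homeo by (auto simp: homeomorphism_def)

lemma measurable_psi [measurable]: "\<psi> \<in> borel_measurable arc_length"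
  using homeo by (intro measurable_arc_lengthI) (simp add: homeomorphism_def)

lemma measurable_ident_arc_length [measurable]: "(\<lambda>x. x) \<in> borel_measurable arc_length"
  by (intro measurable_arc_lengthI continuous_intros)

lemma inj_psi: "norm x = 1 \<Longrightarrow> norm y = 1 \<Longrightarrow> \<psi> x = \<psi> y \<longleftrightarrow> x = y"
  using homeo unfolding homeomorphism_def by (metis mem_sphere_0)

text \<open>\<open>norm_D\<close> is the sum of these two norms divided by \<open>2 * pi\<close>.
  The sum of squares is the quantity that expands into a double integral, and it matches the square
  of the sum up to a factor 2.\<close>

definition energy :: "complex \<Rightarrow> real" where
  "energy z = (norm (cauchy_transform \<psi> (\<lambda>\<eta>. \<eta>) z))\<^sup>2 + (norm (cauchy_transform \<psi> cnj z))\<^sup>2"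

lemma cauchy_kernel_bound:
  assumes "norm x = 1" "norm z < 1"
  shows "norm (1 / (\<psi> x - z)) \<le> 1 / (1 - norm z)"
proof -
  have "1 - norm z \<le> norm (\<psi> x - z)"
    using norm_triangle_ineq2[of "\<psi> x" z] norm_psi[OF assms(1)] by simp
  then show ?thesis using assms by (simp add: norm_divide frac_le)
qed

lemma cauchy_transform_bound:
  assumes z: "norm z < 1" and v: "v \<in> borel_measurable arc_length" "\<And>x. norm x = 1 \<Longrightarrow> norm (v x) \<le> 1"
  shows "norm (cauchy_transform \<psi> v z) \<le> 2 * pi / (1 - norm z)"
proof -
  have "norm (cauchy_transform \<psi> v z) \<le> (LINT \<eta>|arc_length. norm (v \<eta> / (\<psi> \<eta> - z)))"
    unfolding cauchy_transform_def by (rule integral_norm_bound)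
  also have "\<dots> \<le> (LINT \<eta>|arc_length. 1 / (1 - norm z))"
  proof (rule integral_mono')
    fix x assume "x \<in> space arc_length"
    then have x: "norm x = 1" by simp
    then show "norm (v x / (\<psi> x - z)) \<le> 1 / (1 - norm z)"
      using mult_mono[OF v(2)[OF x] cauchy_kernel_bound[OF x z]] by (simp add: norm_mult norm_divide)
  qed (use z in auto)
  also have "\<dots> = 2 * pi / (1 - norm z)"
    by (simp add: measure_def emeasure_arc_length_space)
  finally show ?thesis .
qed

text \<open>This growth bound supplies the constant \<open>K = 2\<close> when one logarithm is
  exchanged for the other.\<close>

lemma norm_D_bound:
  assumes "norm z < 1"
  shows "norm_D (poisson_extension \<phi>) z \<le> 2 / (1 - norm z)"
proof -
  have "norm (cauchy_transform \<psi> (\<lambda>\<eta>. \<eta>) z) \<le> 2 * pi / (1 - norm z)"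
    "norm (cauchy_transform \<psi> cnj z) \<le> 2 * pi / (1 - norm z)"
    using assms by (auto intro!: cauchy_transform_bound)
  then have "norm_D (poisson_extension \<phi>) z \<le> (2 * pi / (1 - norm z) + 2 * pi / (1 - norm z)) / (2 * pi)"
    unfolding norm_D_poisson_extension[OF homeo assms] by (intro divide_right_mono) auto
  also have "(2 * pi / a + 2 * pi / a) / (2 * pi) = 2 / a" for a :: real
    by (cases "a = 0") (auto simp: field_simps)
  finally show ?thesis .
qed

lemma norm_D_energy:
  assumes "norm z < 1"
  shows "energy z \<le> (2 * pi)\<^sup>2 * (norm_D (poisson_extension \<phi>) z)\<^sup>2"
    "(2 * pi)\<^sup>2 * (norm_D (poisson_extension \<phi>) z)\<^sup>2 \<le> 2 * energy z"
proof -
  define a b where "a = norm (cauchy_transform \<psi> (\<lambda>\<eta>. \<eta>) z)" and "b = norm (cauchy_transform \<psi> cnj z)"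
  have ab: "a \<ge> 0" "b \<ge> 0" by (auto simp: a_def b_def)
  have n: "(2 * pi)\<^sup>2 * (norm_D (poisson_extension \<phi>) z)\<^sup>2 = (a + b)\<^sup>2"
    unfolding norm_D_poisson_extension[OF homeo assms] a_def b_def by (simp add: power_divide)
  show "energy z \<le> (2 * pi)\<^sup>2 * (norm_D (poisson_extension \<phi>) z)\<^sup>2"
    unfolding n energy_def a_def[symmetric] b_def[symmetric] using ab by (simp add: power2_sum)
  show "(2 * pi)\<^sup>2 * (norm_D (poisson_extension \<phi>) z)\<^sup>2 \<le> 2 * energy z"
    unfolding n energy_def a_def[symmetric] b_def[symmetric]
    using sum_squares_ge_zero[of "a - b" 0] by (simp add: power2_eq_square algebra_simps)
qed

lemma measurable_cauchy_transform [measurable]: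
  assumes [measurable]: "v \<in> borel_measurable arc_length"
  shows "cauchy_transform \<psi> v \<in> borel_measurable borel"
  unfolding cauchy_transform_def by measurable

lemma measurable_energy [measurable]: "energy \<in> borel_measurable borel"
  unfolding energy_def by measurable

text \<open>Because this mean vanishes, the \<open>- 1\<close> next to the chord kernel contributes
  nothing to the energy.\<close>

lemma integral_arc_length_ident: "(LINT \<eta>|arc_length. \<eta>) = 0"
proof -
  have "((\<lambda>t. cis t) has_integral (- \<i> * cis (2 * pi)) - (- \<i> * cis 0)) {0..2 * pi}"
  proof (rule fundamental_theorem_of_calculus)
    fix x :: real
    from has_vector_derivative_mult_right[OF has_vector_derivative_cis, of "-\<i>"]
    show "((\<lambda>t. - \<i> * cis t) has_vector_derivative cis x) (at x within {0..2 * pi})"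
      by (simp add: has_vector_derivative_at_within)
  qed simp
  then show ?thesis
    by (subst integral_arc_length) (auto intro!: continuous_intros simp: integral_unique)
qed

definition chord_energy :: "real \<Rightarrow> real" where
  "chord_energy r = (LINT \<eta>|arc_length. LINT \<xi>|arc_length. chord_kernel r (norm (\<psi> \<eta> - \<psi> \<xi>)))"

definition twisted_chord_energy :: "real \<Rightarrow> real" where
  "twisted_chord_energy r =
     (LINT \<eta>|arc_length. LINT \<xi>|arc_length. Re (\<eta> * cnj \<xi>) * chord_kernel r (norm (\<psi> \<eta> - \<psi> \<xi>)))"

lemma integrable_chord_kernel:
  assumes r: "0 < r" "r < 1"
    and w: "(\<lambda>(\<eta>, \<xi>). w \<eta> \<xi>) \<in> borel_measurable (arc_length \<Otimes>\<^sub>M arc_length)"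
      "\<And>\<eta> \<xi>. norm \<eta> = 1 \<Longrightarrow> norm \<xi> = 1 \<Longrightarrow> \<bar>w \<eta> \<xi>\<bar> \<le> (1::real)"
  shows "integrable (arc_length \<Otimes>\<^sub>M arc_length) (\<lambda>(\<eta>, \<xi>). w \<eta> \<xi> * chord_kernel r (norm (\<psi> \<eta> - \<psi> \<xi>)))"
proof (rule integrable_bounded_arc_pair[where C="1 / (1 - r\<^sup>2)\<^sup>2"])
  note w(1)[measurable]
  show "(\<lambda>(\<eta>, \<xi>). w \<eta> \<xi> * chord_kernel r (norm (\<psi> \<eta> - \<psi> \<xi>))) \<in> borel_measurable (arc_length \<Otimes>\<^sub>M arc_length)"
    unfolding chord_kernel_def by measurable
  fix x y :: complex assume "x \<in> sphere 0 1" "y \<in> sphere 0 1"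
  then have "\<bar>w x y\<bar> \<le> 1" using w(2) by simp
  moreover have "0 \<le> chord_kernel r (norm (\<psi> x - \<psi> y))" "chord_kernel r (norm (\<psi> x - \<psi> y)) \<le> 1 / (1 - r\<^sup>2)\<^sup>2"
    using r by (auto intro!: chord_kernel_nonneg chord_kernel_le)
  ultimately show "norm (case (x, y) of (\<eta>, \<xi>) \<Rightarrow> w \<eta> \<xi> * chord_kernel r (norm (\<psi> \<eta> - \<psi> \<xi>))) \<le> 1 / (1 - r\<^sup>2)\<^sup>2"
    using mult_mono[of "\<bar>w x y\<bar>" 1 "chord_kernel r (norm (\<psi> x - \<psi> y))" "1 / (1 - r\<^sup>2)\<^sup>2"]
    by (simp add: abs_mult)
qed

lemma abs_Re_mult_cnj_le_1: "norm \<eta> = 1 \<Longrightarrow> norm \<xi> = 1 \<Longrightarrow> \<bar>Re (\<eta> * cnj \<xi>)\<bar> \<le> 1"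
  using abs_Re_le_cmod[of "\<eta> * cnj \<xi>"] by (simp only: norm_mult complex_mod_cnj)

text \<open>The expansions for \<open>\<eta>\<close> and for \<open>cnj \<eta>\<close> carry the
  weights \<open>\<eta> * cnj \<xi>\<close> and its conjugate, against the same kernel
  \<open>?q\<close>. Their sum is a real weight, so taking real parts only sees
  \<open>Re (?q \<eta> \<xi>)\<close>, which is the chord kernel minus 1 up to a factor.\<close>

lemma energy_circle:
  assumes r: "0 < r" "r < 1"
  shows "r\<^sup>2 * (LINT \<omega>|arc_length. energy (of_real r * \<omega>)) = 2 * pi * twisted_chord_energy r"
proof -
  let ?C = "\<lambda>v \<omega>. cauchy_transform \<psi> v (of_real r * \<omega>)"
  let ?C1 = "?C (\<lambda>\<eta>. \<eta>)"
  let ?C2 = "?C cnj"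
  let ?u = "\<lambda>\<eta> \<xi>. cnj (\<psi> \<eta>) * \<psi> \<xi>"
  let ?q = "\<lambda>\<eta> \<xi>. ?u \<eta> \<xi> / (1 - of_real (r\<^sup>2) * ?u \<eta> \<xi>)"
  let ?Q = "\<lambda>\<eta> \<xi>. chord_kernel r (norm (\<psi> \<eta> - \<psi> \<xi>))"
  have rsq: "r\<^sup>2 < 1" using r by (simp add: power_less_one_iff abs_square_less_1)
  have nrm: "norm (of_real r * \<omega>) = r" if "norm \<omega> = 1" for \<omega> :: complex
    using that r by (simp add: norm_mult)
  have qb: "norm (?q \<eta> \<xi>) \<le> 1 / (1 - r\<^sup>2)" if "norm \<eta> = 1" "norm \<xi> = 1" for \<eta> \<xi>
  proof -
    have "1 - r\<^sup>2 \<le> norm (1 - of_real (r\<^sup>2) * ?u \<eta> \<xi>)"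
      using norm_triangle_ineq2[of 1 "of_real (r\<^sup>2) * ?u \<eta> \<xi>"] norm_psi that r by (simp add: norm_mult norm_power)
    then show ?thesis using rsq norm_psi that by (simp add: norm_divide norm_mult frac_le)
  qed
  have sq: "(LINT \<omega>|arc_length. of_real ((norm (?C v \<omega>))\<^sup>2))
      = (LINT \<eta>|arc_length. LINT \<xi>|arc_length. v \<eta> * cnj (v \<xi>) * (2 * pi * ?q \<eta> \<xi>))"
    if v [measurable]: "v \<in> borel_measurable arc_length" and vb: "\<And>x. norm x = 1 \<Longrightarrow> norm (v x) \<le> 1" for v
  proof -
    have "(LINT \<omega>|arc_length. of_real ((norm (?C v \<omega>))\<^sup>2))
      = (LINT \<omega>|arc_length. of_real ((norm (LINT \<eta>|arc_length. v \<eta> * (1 / (\<psi> \<eta> - of_real r * \<omega>))))\<^sup>2))"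
      by (simp add: cauchy_transform_def)
    also have "\<dots> = (LINT \<eta>|arc_length. LINT \<xi>|arc_length. v \<eta> * cnj (v \<xi>) *
        (LINT \<omega>|arc_length. (1 / (\<psi> \<eta> - of_real r * \<omega>)) * cnj (1 / (\<psi> \<xi> - of_real r * \<omega>))))"
    proof (rule arc_length_square_integral[where C="1 / (1 - r)"])
      show "norm (1 / (\<psi> x - of_real r * y)) \<le> 1 / (1 - r)" if "x \<in> sphere 0 1" "y \<in> sphere 0 1" for x y
        using cauchy_kernel_bound[of x "of_real r * y"] nrm[of y] that r by simp
    qed (use vb in auto)
    also have "\<dots> = (LINT \<eta>|arc_length. LINT \<xi>|arc_length. v \<eta> * cnj (v \<xi>) * (2 * pi * ?q \<eta> \<xi>))"
    proof (intro Bochner_Integration.integral_cong refl arg_cong2[where f="(*)"])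
      fix \<eta> \<xi> assume "\<eta> \<in> space arc_length" "\<xi> \<in> space arc_length"
      then have "norm (\<psi> \<eta>) = 1" "norm (\<psi> \<xi>) = 1" by (auto intro: norm_psi)
      from arc_length_product_of_cauchy_kernels[OF this r]
      show "(LINT \<omega>|arc_length. (1 / (\<psi> \<eta> - of_real r * \<omega>)) * cnj (1 / (\<psi> \<xi> - of_real r * \<omega>))) = 2 * pi * ?q \<eta> \<xi>"
        by (simp only: times_divide_eq_right mult.assoc)
    qed
    finally show ?thesis .
  qed
  have int2: "integrable (arc_length \<Otimes>\<^sub>M arc_length) (\<lambda>(\<eta>, \<xi>). w \<eta> * cnj (w \<xi>) * (2 * pi * ?q \<eta> \<xi>))"
    if w [measurable]: "w \<in> borel_measurable arc_length" and wb: "\<And>x. norm x = 1 \<Longrightarrow> norm (w x) \<le> 1" for w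
  proof (rule integrable_bounded_arc_pair[where C="2 * pi * (1 / (1 - r\<^sup>2))"])
    fix x y :: complex assume "x \<in> sphere 0 1" "y \<in> sphere 0 1"
    then have xy: "norm x = 1" "norm y = 1" by auto
    have "norm (w x) * norm (w y) \<le> 1" using wb[OF xy(1)] wb[OF xy(2)] by (simp add: mult_le_one)
    have gen: "norm (a * cnj b * (2 * pi * t)) = norm a * norm b * (2 * pi * norm t)" for a b t :: complex
      by (simp add: norm_mult)
    from mult_mono[OF \<open>norm (w x) * norm (w y) \<le> 1\<close> mult_left_mono[OF qb[OF xy], of "2 * pi"]]
    show "norm (case (x, y) of (\<eta>, \<xi>) \<Rightarrow> w \<eta> * cnj (w \<xi>) * (2 * pi * ?q \<eta> \<xi>)) \<le> 2 * pi * (1 / (1 - r\<^sup>2))"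
      unfolding prod.case gen by simp
  qed measurable
  let ?F = "(\<lambda>(\<eta>, \<xi>). \<eta> * cnj \<xi> * (2 * pi * ?q \<eta> \<xi>))" and ?F' = "(\<lambda>(\<eta>, \<xi>). cnj \<eta> * cnj (cnj \<xi>) * (2 * pi * ?q \<eta> \<xi>))"
  let ?R = "(\<lambda>(\<eta>, \<xi>). Re (\<eta> * cnj \<xi>) * ?Q \<eta> \<xi>)" and ?E2 = "(\<lambda>(\<eta>, \<xi>). \<eta> * cnj \<xi>)"
  let ?P = "arc_length \<Otimes>\<^sub>M arc_length"
  let ?E = "LINT \<omega>|arc_length. energy (of_real r * \<omega>)"
  have intE: "integrable arc_length (\<lambda>\<omega>. (norm (?C v \<omega>))\<^sup>2)"
    if v [measurable]: "v \<in> borel_measurable arc_length" and vb: "\<And>x. norm x = 1 \<Longrightarrow> norm (v x) \<le> 1" for v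
  proof (rule integrable_bounded_arc_length[where C="(2 * pi / (1 - r))\<^sup>2"])
    fix x :: complex assume "x \<in> sphere 0 1"
    then have "norm (cauchy_transform \<psi> v (of_real r * x)) \<le> 2 * pi / (1 - r)"
      using cauchy_transform_bound[OF _ v vb, of "of_real r * x"] nrm[of x] r by simp
    then show "norm ((norm (cauchy_transform \<psi> v (of_real r * x)))\<^sup>2) \<le> (2 * pi / (1 - r))\<^sup>2"
      by (simp add: power_mono)
  qed measurable
  have "complex_of_real ?E = of_real ((LINT \<omega>|arc_length. (norm (?C1 \<omega>))\<^sup>2)
      + (LINT \<omega>|arc_length. (norm (?C2 \<omega>))\<^sup>2))"
    unfolding energy_def by (subst Bochner_Integration.integral_add) (auto intro!: intE)
  also have "\<dots> = (LINT \<omega>|arc_length. of_real ((norm (?C1 \<omega>))\<^sup>2))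
      + (LINT \<omega>|arc_length. of_real ((norm (?C2 \<omega>))\<^sup>2))"
    by (simp only: of_real_add integral_complex_of_real)
  also have "\<dots> = (LINT \<eta>|arc_length. LINT \<xi>|arc_length. \<eta> * cnj \<xi> * (2 * pi * ?q \<eta> \<xi>))
      + (LINT \<eta>|arc_length. LINT \<xi>|arc_length. cnj \<eta> * cnj (cnj \<xi>) * (2 * pi * ?q \<eta> \<xi>))"
    by (intro arg_cong2[where f="(+)"] sq) auto
  also have "\<dots> = (LINT p|?P. ?F p)
      + (LINT p|?P. ?F' p)"
    by (intro arg_cong2[where f="(+)"] arc_pair.integral_fst int2) auto
  also have "\<dots> = (LINT p|?P. ?F p
      + ?F' p)"
    by (intro Bochner_Integration.integral_add[symmetric] int2) auto
  finally have "?E = Re (LINT p|?P. ?F p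
      + ?F' p)"
    by (metis Re_complex_of_real)
  also have "\<dots> = (LINT p|?P. Re (?F p
      + ?F' p))"
    by (intro integral_Re[symmetric] Bochner_Integration.integrable_add int2) auto
  finally have "r\<^sup>2 * ?E = (LINT p|?P. r\<^sup>2 * Re (?F p
      + ?F' p))"
    by (simp only: integral_mult_right_zero)
  also have "\<dots> = (LINT p|?P. 2 * pi * (?R p - Re (?E2 p)))"
  proof (rule Bochner_Integration.integral_cong[OF refl])
    fix p assume "p \<in> space ?P"
    then obtain \<eta> \<xi> where p: "p = (\<eta>, \<xi>)" "norm \<eta> = 1" "norm \<xi> = 1"
      by (auto simp: space_pair_measure)
    have "\<eta> * cnj \<xi> * (2 * pi * ?q \<eta> \<xi>) + cnj \<eta> * cnj (cnj \<xi>) * (2 * pi * ?q \<eta> \<xi>)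
        = (\<eta> * cnj \<xi> + cnj (\<eta> * cnj \<xi>)) * (2 * pi * ?q \<eta> \<xi>)"
      by (simp only: distrib_right complex_cnj_mult)
    also have "\<dots> = of_real (4 * pi * Re (\<eta> * cnj \<xi>)) * ?q \<eta> \<xi>"
      unfolding complex_add_cnj by (simp only: of_real_mult of_real_numeral mult_ac)
         (simp add: mult_ac)
    finally have "r\<^sup>2 * Re (\<eta> * cnj \<xi> * (2 * pi * ?q \<eta> \<xi>) + cnj \<eta> * cnj (cnj \<xi>) * (2 * pi * ?q \<eta> \<xi>))
        = 2 * pi * Re (\<eta> * cnj \<xi>) * (2 * r\<^sup>2 * Re (?q \<eta> \<xi>))"
      by (simp only: Re_complex_of_real Im_complex_of_real times_complex.sel) simp
    also have "2 * r\<^sup>2 * Re (?q \<eta> \<xi>) = ?Q \<eta> \<xi> - 1"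
      using p norm_psi r by (intro Re_cauchy_kernel_eq_chord_kernel) auto
    finally show "r\<^sup>2 * Re (?F p
      + ?F' p)
      = 2 * pi * (?R p - Re (?E2 p))"
      unfolding p prod.case by (simp only: right_diff_distrib mult.assoc mult_1_right)
  qed
  also have "\<dots> = 2 * pi * ((LINT p|?P. ?R p)
       - Re (LINT p|?P. ?E2 p))"
  proof -
    have i1: "integrable ?P (\<lambda>(\<eta>, \<xi>). Re (\<eta> * cnj \<xi>) * ?Q \<eta> \<xi>)"
      using r abs_Re_mult_cnj_le_1 by (intro integrable_chord_kernel) auto
    have i2: "integrable ?P (\<lambda>(\<eta>, \<xi>). \<eta> * cnj \<xi>)"
      by (rule integrable_bounded_arc_pair[where C=1]) (auto simp: norm_mult)
    show ?thesis
      by (simp only: integral_mult_right_zero Bochner_Integration.integral_diff[OF i1 integrable_Re[OF i2]] integral_Re[OF i2])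
  qed
  also have "(LINT p|?P. ?E2 p) = (LINT \<eta>|arc_length. LINT \<xi>|arc_length. \<eta> * cnj \<xi>)"
    by (intro arc_pair.integral_fst[symmetric] integrable_bounded_arc_pair[where C=1]) (auto simp: norm_mult)
  also have "\<dots> = 0"
    by (simp add: integral_arc_length_ident)
  also have "(LINT p|?P. ?R p) = twisted_chord_energy r"
    unfolding twisted_chord_energy_def
    using r abs_Re_mult_cnj_le_1 by (intro arc_pair.integral_fst[symmetric] integrable_chord_kernel) auto
  finally show ?thesis by simp
qed

section \<open>Dropping the sign-changing factor\<close>

lemma Re_mult_cnj_near_diagonal:
  obtains \<delta> where "\<delta> > 0"
    "\<And>\<eta> \<xi>. norm \<eta> = 1 \<Longrightarrow> norm \<xi> = 1 \<Longrightarrow> norm (\<psi> \<eta> - \<psi> \<xi>) < \<delta> \<Longrightarrow> 1 / 2 \<le> Re (\<eta> * cnj \<xi>)"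
proof -
  \<comment> \<open>Small chords between the values of \<open>\<psi>\<close> force small chords
    between \<open>\<eta>\<close> and \<open>\<xi>\<close> by uniform continuity of
    \<open>\<phi>\<close>. A chord below 1 suffices, since for unit vectors
    \<open>Re (\<eta> * cnj \<xi>)\<close> is 1 minus half the squared chord.\<close>
  have "uniformly_continuous_on (sphere 0 1) \<phi>"
    using homeo by (intro compact_uniformly_continuous) (auto simp: homeomorphism_def)
  then obtain \<delta> where d: "\<delta> > 0"
    "\<And>x y. norm x = 1 \<Longrightarrow> norm y = 1 \<Longrightarrow> dist y x < \<delta> \<Longrightarrow> dist (\<phi> y) (\<phi> x) < 1"
    unfolding uniformly_continuous_on_def by (metis mem_sphere_0 zero_less_one)
  have "1 / 2 \<le> Re (\<eta> * cnj \<xi>)" if n: "norm \<eta> = 1" "norm \<xi> = 1" "norm (\<psi> \<eta> - \<psi> \<xi>) < \<delta>" for \<eta> \<xi>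
  proof -
    have "\<phi> (\<psi> \<eta>) = \<eta>" "\<phi> (\<psi> \<xi>) = \<xi>"
      using homeo n by (auto simp: homeomorphism_def)
    then have "norm (\<eta> - \<xi>) < 1"
      using d(2)[of "\<psi> \<xi>" "\<psi> \<eta>"] norm_psi n by (simp add: dist_norm)
    then have "(norm (\<eta> - \<xi>))\<^sup>2 \<le> 1" by (simp add: power_le_one)
    moreover have "(Re \<eta>)\<^sup>2 + (Im \<eta>)\<^sup>2 = 1" "(Re \<xi>)\<^sup>2 + (Im \<xi>)\<^sup>2 = 1"
      using n by (simp_all flip: cmod_power2)
    ultimately show ?thesis
      unfolding cmod_power2 by (simp add: power2_eq_square algebra_simps)
  qed
  with d(1) that show thesis by blast
qed

lemma twisted_chord_energy_comparison:
  obtains C where "C \<ge> 0" "\<And>r. 0 < r \<Longrightarrow> r < 1 \<Longrightarrow> twisted_chord_energy r \<le> chord_energy r"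
    "\<And>r. 0 < r \<Longrightarrow> r < 1 \<Longrightarrow> chord_energy r \<le> 2 * twisted_chord_energy r + C"
proof -
  obtain \<delta> where \<delta>: "\<delta> > 0"
    "\<And>\<eta> \<xi>. norm \<eta> = 1 \<Longrightarrow> norm \<xi> = 1 \<Longrightarrow> norm (\<psi> \<eta> - \<psi> \<xi>) < \<delta> \<Longrightarrow> 1 / 2 \<le> Re (\<eta> * cnj \<xi>)"
    using Re_mult_cnj_near_diagonal by blast
  \<comment> \<open>For chords of length at least \<open>\<delta>\<close> the kernel is at most 4 if
    \<open>r\<twosuperior> \<le> 1/2\<close> and at most \<open>2 / \<delta>\<twosuperior>\<close>
    otherwise. The factor 3 covers the worst sign: if \<open>x \<ge> - q\<close> and
    \<open>q \<le> f\<close> then \<open>q \<le> 2 * x + 3 * f\<close>.\<close>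
  define C where "C = 3 * (4 + 2 / \<delta>\<^sup>2)"
  let ?P = "arc_length \<Otimes>\<^sub>M arc_length"
  let ?Q = "\<lambda>r \<eta> \<xi>. chord_kernel r (norm (\<psi> \<eta> - \<psi> \<xi>))"
  have C: "C \<ge> 0" by (simp add: C_def)
  have far: "chord_kernel r d \<le> 4 + 2 / \<delta>\<^sup>2" if r: "0 < r" "r < 1" and d: "\<delta> \<le> d" for r d
  proof -
    have num: "1 - r ^ 4 \<le> 1" "0 \<le> 1 - r ^ 4" using r by (auto simp: power_le_one)
    have d2: "\<delta>\<^sup>2 \<le> d\<^sup>2" using d \<delta> by (intro power_mono) auto
    show ?thesis
    proof (cases "r\<^sup>2 \<le> 1/2")
      case True
      then have "(1/2)\<^sup>2 \<le> (1 - r\<^sup>2)\<^sup>2" by (intro power_mono) auto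
      then have "1/4 \<le> (1 - r\<^sup>2)\<^sup>2 + r\<^sup>2 * d\<^sup>2" by (simp add: power2_eq_square add_increasing2)
      then have "chord_kernel r d \<le> 1 / (1/4)"
        unfolding chord_kernel_def using num by (intro frac_le) auto
      moreover have "0 \<le> 2 / \<delta>\<^sup>2" by simp
      ultimately show ?thesis by (simp add: add_increasing2)
    next
      case False
      then have "1/2 * \<delta>\<^sup>2 \<le> r\<^sup>2 * d\<^sup>2" using d2 by (intro mult_mono) auto
      then have "1/2 * \<delta>\<^sup>2 \<le> (1 - r\<^sup>2)\<^sup>2 + r\<^sup>2 * d\<^sup>2" by (simp add: add_increasing)
      then have "chord_kernel r d \<le> 1 / (1/2 * \<delta>\<^sup>2)"
        unfolding chord_kernel_def using num \<delta>(1) by (intro frac_le) auto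
      then show ?thesis by simp
    qed
  qed
  have main: "twisted_chord_energy r \<le> chord_energy r \<and> chord_energy r \<le> 2 * twisted_chord_energy r + C * (2 * pi)\<^sup>2"
    if r: "0 < r" "r < 1" for r
  proof -
    have i1: "integrable ?P (\<lambda>(\<eta>, \<xi>). 1 * ?Q r \<eta> \<xi>)"
      using r by (intro integrable_chord_kernel) auto
    then have i1: "integrable ?P (\<lambda>(\<eta>, \<xi>). ?Q r \<eta> \<xi>)" by simp
    have i2: "integrable ?P (\<lambda>(\<eta>, \<xi>). Re (\<eta> * cnj \<xi>) * ?Q r \<eta> \<xi>)"
      using r abs_Re_mult_cnj_le_1 by (intro integrable_chord_kernel) auto
    have i3: "integrable ?P (\<lambda>p. C)"
      by (rule integrable_bounded_arc_pair[where C=C]) (auto simp: C)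
    have e1: "chord_energy r = (LINT p|?P. (\<lambda>(\<eta>, \<xi>). ?Q r \<eta> \<xi>) p)"
      unfolding chord_energy_def by (rule arc_pair.integral_fst[OF i1])
    have e2: "twisted_chord_energy r = (LINT p|?P. (\<lambda>(\<eta>, \<xi>). Re (\<eta> * cnj \<xi>) * ?Q r \<eta> \<xi>) p)"
      unfolding twisted_chord_energy_def by (rule arc_pair.integral_fst[OF i2])
    have e3: "(LINT p|?P. C) = C * (2 * pi)\<^sup>2"
    proof -
      have "(LINT p|?P. C) = (LINT x|arc_length. LINT y|arc_length. C)"
        using arc_pair.integral_fst[of "\<lambda>x y. C"] i3 by (simp only: case_prod_unfold)
      then show ?thesis
        by (simp add: measure_def emeasure_arc_length_space power2_eq_square mult.assoc)
    qed
    have "twisted_chord_energy r \<le> chord_energy r"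
      unfolding e1 e2
    proof (rule integral_mono[OF i2 i1])
      fix p assume "p \<in> space ?P"
      then obtain \<eta> \<xi> where p: "p = (\<eta>, \<xi>)" "norm \<eta> = 1" "norm \<xi> = 1"
        by (auto simp: space_pair_measure)
      have "Re (\<eta> * cnj \<xi>) * ?Q r \<eta> \<xi> \<le> 1 * ?Q r \<eta> \<xi>"
        using abs_Re_mult_cnj_le_1[OF p(2,3)] r by (intro mult_right_mono chord_kernel_nonneg) auto
      then show "(\<lambda>(\<eta>, \<xi>). Re (\<eta> * cnj \<xi>) * ?Q r \<eta> \<xi>) p \<le> (\<lambda>(\<eta>, \<xi>). ?Q r \<eta> \<xi>) p"
        by (simp add: p)
    qed
    moreover have "chord_energy r \<le> (LINT p|?P. 2 * (\<lambda>(\<eta>, \<xi>). Re (\<eta> * cnj \<xi>) * ?Q r \<eta> \<xi>) p + C)"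
      unfolding e1
    proof (rule integral_mono[OF i1 Bochner_Integration.integrable_add[OF integrable_mult_right[OF i2] i3]])
      fix p assume "p \<in> space ?P"
      then obtain \<eta> \<xi> where p: "p = (\<eta>, \<xi>)" "norm \<eta> = 1" "norm \<xi> = 1"
        by (auto simp: space_pair_measure)
      have Q0: "0 \<le> ?Q r \<eta> \<xi>" using r by (intro chord_kernel_nonneg) auto
      have "?Q r \<eta> \<xi> \<le> 2 * (Re (\<eta> * cnj \<xi>) * ?Q r \<eta> \<xi>) + C"
      proof (cases "norm (\<psi> \<eta> - \<psi> \<xi>) < \<delta>")
        case True
        have "1 * ?Q r \<eta> \<xi> \<le> (2 * Re (\<eta> * cnj \<xi>)) * ?Q r \<eta> \<xi>"
          using \<delta>(2)[OF p(2,3) True] Q0 by (intro mult_right_mono) auto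
        then have "?Q r \<eta> \<xi> \<le> 2 * (Re (\<eta> * cnj \<xi>) * ?Q r \<eta> \<xi>)"
          by (simp only: mult_1_left mult.assoc)
        then show ?thesis using C by linarith
      next
        case False
        then have "?Q r \<eta> \<xi> \<le> 4 + 2 / \<delta>\<^sup>2" using far[OF r] by simp
        moreover have "(-1) * ?Q r \<eta> \<xi> \<le> Re (\<eta> * cnj \<xi>) * ?Q r \<eta> \<xi>"
          using abs_Re_mult_cnj_le_1[OF p(2,3)] Q0 by (intro mult_right_mono) auto
        moreover have "q \<le> 2 * x + 3 * f" if "q \<le> f" "(-1) * q \<le> x" for q x f :: real
          using that by linarith
        ultimately show ?thesis unfolding C_def by blast
      qed
      then show "(\<lambda>(\<eta>, \<xi>). ?Q r \<eta> \<xi>) p \<le> 2 * (\<lambda>(\<eta>, \<xi>). Re (\<eta> * cnj \<xi>) * ?Q r \<eta> \<xi>) p + C"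
        by (simp add: p)
    qed
    moreover have "(LINT p|?P. 2 * (\<lambda>(\<eta>, \<xi>). Re (\<eta> * cnj \<xi>) * ?Q r \<eta> \<xi>) p + C) = 2 * twisted_chord_energy r + C * (2 * pi)\<^sup>2"
      unfolding e2 e3[symmetric]
      by (simp only: Bochner_Integration.integral_add[OF integrable_mult_right[OF i2] i3] integral_mult_right_zero)
    ultimately show ?thesis by simp
  qed
  show thesis
    using that[of "C * (2 * pi)\<^sup>2"] main C by auto
qed

end

section \<open>Logarithmic weights\<close>

text \<open>Which of the two bounds on \<open>L\<close> is decisive depends on the sign of
  \<open>lam\<close>; adding both powers gives one constant for either sign.\<close>

lemma powr_comparable:
  fixes c C l L lam :: real
  assumes "0 < c" "0 < l" "c * l \<le> L" "L \<le> C * l"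
  shows "L powr lam \<le> (c powr lam + C powr lam) * l powr lam"
proof -
  have L: "0 < L" using assms(1-3) by (smt (verit) mult_pos_pos)
  then have C: "0 < C" using assms(2,4) by (smt (verit) zero_less_mult_pos2)
  show ?thesis
  proof (cases "lam \<ge> 0")
    case True
    then have "L powr lam \<le> (C * l) powr lam" using L assms by (intro powr_mono2) auto
    then show ?thesis using assms C by (simp add: powr_mult distrib_right add_increasing)
  next
    case False
    then have "L powr lam \<le> (c * l) powr lam" using L assms by (intro powr_mono2') auto
    then show ?thesis using assms C by (simp add: powr_mult distrib_right add_increasing2)
  qed
qed

text \<open>For positive \<open>lam\<close> the bound of \<open>ln x\<close> by
  \<open>x powr a / a\<close> is used with \<open>a = e / lam\<close> and then raised to
  \<open>lam\<close>. The summand 1 keeps the base at least 1, which settles the other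
  signs.\<close>

lemma log_powr_bound:
  fixes lam e :: real
  assumes "e > 0"
  obtains C where "C \<ge> 1" "\<And>x. x \<ge> 1 \<Longrightarrow> (1 + ln x) powr lam \<le> C * x powr e"
proof (cases "lam > 0")
  case True
  define a where "a = e / lam"
  have a: "a > 0" using True assms by (simp add: a_def)
  have "(1 + ln x) powr lam \<le> (1 + 1 / a) powr lam * x powr e" if x: "x \<ge> 1" for x
  proof -
    have "ln x \<le> x powr a / a" by (rule ln_powr_bound[OF x a])
    moreover have "1 \<le> x powr a" using x a by (simp add: ge_one_powr_ge_zero)
    ultimately have "1 + ln x \<le> (1 + 1 / a) * x powr a" by (simp add: algebra_simps)
    then have "(1 + ln x) powr lam \<le> ((1 + 1 / a) * x powr a) powr lam"
      using x True by (intro powr_mono2) auto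
    also have "\<dots> = (1 + 1 / a) powr lam * x powr e"
      using x a True by (simp add: powr_mult powr_powr a_def)
    finally show ?thesis .
  qed
  moreover have "(1 + 1 / a) powr lam \<ge> 1" using a True by (intro ge_one_powr_ge_zero) auto
  ultimately show thesis using that by blast
next
  case False
  have "(1 + ln x) powr lam \<le> 1 * x powr e" if x: "x \<ge> 1" for x
  proof -
    have "(1 + ln x) powr lam \<le> 1 powr lam" using x False by (intro powr_mono2') auto
    moreover have "1 \<le> x powr e" using x assms by (simp add: ge_one_powr_ge_zero)
    ultimately show ?thesis by simp
  qed
  then show thesis using that[of 1] by auto
qed

lemma ln_two_over_bounds:
  fixes s :: real
  assumes "0 < s" "s \<le> 1"
  shows "ln 2 * (1 + ln (1 / s)) \<le> ln (2 / s)" "ln (2 / s) \<le> 1 + ln (1 / s)" "1 \<le> 1 + ln (1 / s)"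
proof -
  have e: "ln (2 / s) = ln 2 + ln (1 / s)" using assms by (simp add: ln_div)
  have n: "0 \<le> ln (1 / s)" using assms by simp
  then show "1 \<le> 1 + ln (1 / s)" by simp
  have l2: "ln 2 \<le> (1::real)" using ln_le_minus_one[of 2] by simp
  then show "ln (2 / s) \<le> 1 + ln (1 / s)" using e by simp
  have "ln 2 * ln (1 / s) \<le> 1 * ln (1 / s)" using n l2 by (intro mult_right_mono) auto
  then show "ln 2 * (1 + ln (1 / s)) \<le> ln (2 / s)" using e by (simp add: algebra_simps)
qed

lemma one_over_powr: "0 < s \<Longrightarrow> (1 / s) powr e = s powr (- e)" for s e :: real
  by (simp add: powr_minus powr_divide inverse_eq_divide)

lemma log_weight_bound:
  fixes lam e :: real
  assumes "e > 0"
  obtains C where "C \<ge> 0" "\<And>s. 0 < s \<Longrightarrow> s \<le> 1 \<Longrightarrow> ln (2 / s) powr lam \<le> C * s powr (- e)"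
proof -
  obtain C where C: "C \<ge> 1" "\<And>x. x \<ge> 1 \<Longrightarrow> (1 + ln x) powr lam \<le> C * x powr e"
    using log_powr_bound[OF assms] by blast
  let ?D = "ln 2 powr lam + 1 powr lam"
  have "ln (2 / s) powr lam \<le> (?D * C) * s powr (- e)" if s: "0 < s" "s \<le> 1" for s
  proof -
    have "ln (2 / s) powr lam \<le> ?D * (1 + ln (1 / s)) powr lam"
      using ln_two_over_bounds[OF s] by (intro powr_comparable) auto
    also have "\<dots> \<le> ?D * (C * (1 / s) powr e)"
      using s by (intro mult_left_mono C(2)) auto
    also have "\<dots> = (?D * C) * s powr (- e)"
      using s by (simp add: one_over_powr)
    finally show ?thesis .
  qed
  then show thesis using that[of "?D * C"] C(1) by auto
qed

text \<open>
  Where \<open>x < s powr (-1/4)\<close> both quantities are absorbed by the error term; elsewhere the two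
  logarithms are comparable.
\<close>

lemma log_weights_comparable:
  fixes lam K :: real
  assumes K: "K \<ge> 0"
  obtains C where "C \<ge> 0"
    "\<And>s x. 0 < s \<Longrightarrow> s \<le> 1 \<Longrightarrow> 0 \<le> x \<Longrightarrow> x \<le> K / s \<Longrightarrow>
      x\<^sup>2 * ln (exp 1 + x) powr lam \<le> C * (x\<^sup>2 * ln (2 / s) powr lam + s powr (- 3 / 4))"
    "\<And>s x. 0 < s \<Longrightarrow> s \<le> 1 \<Longrightarrow> 0 \<le> x \<Longrightarrow> x \<le> K / s \<Longrightarrow>
      x\<^sup>2 * ln (2 / s) powr lam \<le> C * (x\<^sup>2 * ln (exp 1 + x) powr lam + s powr (- 3 / 4))"
proof -
  obtain C0 where C0: "C0 \<ge> 1" "\<And>x. x \<ge> 1 \<Longrightarrow> (1 + ln x) powr lam \<le> C0 * x powr (1/4)"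
    using log_powr_bound[of "1/4" lam] by auto
  \<comment> \<open>\<open>H\<close> serves \<open>l \<le> H * N\<close>: the hypothesis
    \<open>x \<le> K / s\<close> gives \<open>exp 1 + x \<le> (exp 1 + K) / s\<close>, and
    \<open>H \<ge> 1\<close> turns the resulting sum of logarithms into a product.\<close>
  define H where "H = ln (exp 1 + K)"
  have epos: "exp 1 + K > 0" using K by (simp add: add_pos_nonneg)
  have H1: "H \<ge> 1"
    unfolding H_def using K by (subst ln_ge_iff) (auto simp: add_pos_nonneg)
  \<comment> \<open>\<open>D1\<close> and \<open>D2\<close> exchange \<open>l\<close> and
    \<open>L\<close> for large \<open>x\<close>; \<open>D3\<close> and \<open>D4\<close> serve small
    \<open>x\<close>, where each logarithmic weight is estimated separately by a power of
    \<open>s\<close>.\<close>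
  define D1 where "D1 = (1/5) powr lam + (H / ln 2) powr lam"
  define D2 where "D2 = (ln 2 / H) powr lam + 5 powr lam"
  define D3 where "D3 = ln 2 powr lam + 1 powr lam"
  define D4 where "D4 = 1 + H powr lam"
  define C where "C = D1 + D2 + D3 * C0 + D4 * C0"
  have D0: "D1 \<ge> 0" "D2 \<ge> 0" "D3 \<ge> 0" "D4 \<ge> 1" by (auto simp: D1_def D2_def D3_def D4_def)
  have C_ge: "C \<ge> D1" "C \<ge> D2" "C \<ge> D3 * C0" "C \<ge> D4 * C0" "C \<ge> 0"
    using D0 C0(1) by (auto simp: C_def add_nonneg_nonneg)
  have "x\<^sup>2 * ln (exp 1 + x) powr lam \<le> C * (x\<^sup>2 * ln (2 / s) powr lam + s powr (- 3 / 4))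
      \<and> x\<^sup>2 * ln (2 / s) powr lam \<le> C * (x\<^sup>2 * ln (exp 1 + x) powr lam + s powr (- 3 / 4))"
    if s: "0 < s" "s \<le> 1" and x: "0 \<le> x" "x \<le> K / s" for s x
  proof -
    define N where "N = 1 + ln (1 / s)"
    define L where "L = ln (2 / s)"
    define l where "l = ln (exp 1 + x)"
    have N: "ln 2 * N \<le> L" "L \<le> N" "1 \<le> N"
      using ln_two_over_bounds[OF s] by (auto simp: N_def L_def)
    have Lpos: "L > 0" using N(1,3) by (smt (verit) ln_gt_zero mult_pos_pos)
    have l1: "1 \<le> l"
      unfolding l_def using x by (subst ln_ge_iff) (auto simp: add_pos_nonneg)
    have "exp 1 + x \<le> (exp 1 + K) * (1 / s)"
    proof -
      have "exp 1 * 1 \<le> exp (1::real) * (1 / s)" using s by (intro mult_left_mono) auto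
      then show ?thesis using x by (simp add: add_divide_distrib)
    qed
    then have "l \<le> ln ((exp 1 + K) * (1 / s))"
      unfolding l_def using s x K by (subst ln_le_cancel_iff) (auto simp: add_pos_nonneg)
    also have "\<dots> = H + ln (1 / s)"
      unfolding H_def using s epos by (subst ln_mult) auto
    also have "\<dots> \<le> H * N"
    proof -
      have "0 \<le> ln (1 / s)" using N(3) by (simp add: N_def)
      then have "1 * ln (1 / s) \<le> H * ln (1 / s)" using H1 by (intro mult_right_mono) auto
      then show ?thesis by (simp add: N_def algebra_simps)
    qed
    finally have lN: "l \<le> H * N" .
    show ?thesis
    proof (cases "x \<ge> s powr (- 1 / 4)")
      case True
      \<comment> \<open>This direction does not follow from the size bound: above the threshold
        \<open>l\<close> is at least a quarter of \<open>ln (1 / s)\<close>.\<close>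
      have "ln (s powr (- 1 / 4)) \<le> l"
        unfolding l_def using True s x by (subst ln_le_cancel_iff) (auto simp: add_pos_nonneg intro: order_trans)
      then have "ln (1 / s) \<le> 4 * l" using s by (simp add: ln_powr ln_div)
      then have N5: "N \<le> 5 * l" using l1 by (simp add: N_def)
      have l2: "(1/5) * L \<le> l" "L \<le> 5 * l" using N5 N(2) by auto
      have "H * (ln 2 * N) \<le> H * L" using N(1) H1 by (intro mult_left_mono) auto
      moreover have "ln 2 * l \<le> ln 2 * (H * N)" using lN by (intro mult_left_mono) auto
      moreover have "ln 2 * (H * N) = H * (ln 2 * N)" by simp
      ultimately have "ln 2 * l \<le> H * L" by linarith
      then have l3: "l \<le> (H / ln 2) * L" "(ln 2 / H) * l \<le> L" using H1 by (auto simp: field_simps)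
      have "l powr lam \<le> D1 * L powr lam"
        unfolding D1_def using l2 l3 Lpos by (intro powr_comparable) auto
      also have "\<dots> \<le> C * L powr lam" using C_ge by (intro mult_right_mono) auto
      finally have a: "x\<^sup>2 * l powr lam \<le> x\<^sup>2 * (C * L powr lam)" by (intro mult_left_mono) auto
      have "L powr lam \<le> D2 * l powr lam"
        unfolding D2_def using l2 l3 l1 H1 by (intro powr_comparable) auto
      also have "\<dots> \<le> C * l powr lam" using C_ge by (intro mult_right_mono) auto
      finally have b: "x\<^sup>2 * L powr lam \<le> x\<^sup>2 * (C * l powr lam)" by (intro mult_left_mono) auto
      have "0 \<le> C * s powr (- 3 / 4)" using C_ge by simp
      with a b show ?thesis
        unfolding l_def L_def by (simp add: algebra_simps)
    next
      case False
      \<comment> \<open>Below the threshold the square costs \<open>s powr (- 1/2)\<close> and a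
        logarithmic weight at most \<open>s powr (- 1/4)\<close> up to a constant. The total
        exponent \<open>3/4\<close> stays below 1, so the error is integrable.\<close>
      then have x2: "x\<^sup>2 \<le> s powr (- 1 / 2)"
      proof -
        have "x\<^sup>2 \<le> (s powr (- 1 / 4))\<^sup>2" using False x by (intro power_mono) auto
        also have "\<dots> = s powr (- 1 / 2)" by (simp add: power2_eq_square flip: powr_add)
        finally show ?thesis .
      qed
      have N4: "N powr lam \<le> C0 * s powr (- 1 / 4)"
        using C0(2)[of "1 / s"] s by (simp add: N_def one_over_powr)
      have s4: "1 \<le> C0 * s powr (- 1 / 4)"
      proof -
        have "1 \<le> (1 / s) powr (1/4)" using s by (intro ge_one_powr_ge_zero) auto
        then have "1 * 1 \<le> C0 * (1 / s) powr (1/4)" using C0(1) by (intro mult_mono) auto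
        then show ?thesis using s by (simp add: one_over_powr)
      qed
      have sp: "s powr (- 1 / 2) * s powr (- 1 / 4) = s powr (- 3 / 4)" by (simp flip: powr_add)
      have "L powr lam \<le> D3 * N powr lam"
        unfolding D3_def using N by (intro powr_comparable) auto
      also have "\<dots> \<le> D3 * (C0 * s powr (- 1 / 4))" using N4 D0 by (intro mult_left_mono) auto
      also have "\<dots> \<le> C * s powr (- 1 / 4)"
        using C_ge(3) by (simp add: mult_right_mono flip: mult.assoc)
      finally have "x\<^sup>2 * L powr lam \<le> s powr (- 1 / 2) * (C * s powr (- 1 / 4))"
        using x2 by (intro mult_mono) auto
      then have a: "x\<^sup>2 * L powr lam \<le> C * s powr (- 3 / 4)" unfolding sp[symmetric] by (simp only: mult_ac)
      have "l powr lam \<le> D4 * (C0 * s powr (- 1 / 4))"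
      proof (cases "lam \<ge> 0")
        case True
        then have "l powr lam \<le> (H * N) powr lam" using l1 lN by (intro powr_mono2) auto
        also have "\<dots> = H powr lam * N powr lam" using H1 N by (simp add: powr_mult)
        also have "\<dots> \<le> D4 * (C0 * s powr (- 1 / 4))"
          using N4 by (intro mult_mono) (auto simp: D4_def)
        finally show ?thesis .
      next
        case False
        then have "l powr lam \<le> 1 powr lam" using l1 by (intro powr_mono2') auto
        also have "\<dots> \<le> D4 * (C0 * s powr (- 1 / 4))"
          using mult_mono[OF D0(4) s4] D0 by simp
        finally show ?thesis .
      qed
      also have "\<dots> \<le> C * s powr (- 1 / 4)"
        using C_ge(4) by (simp add: mult_right_mono flip: mult.assoc)
      finally have "x\<^sup>2 * l powr lam \<le> s powr (- 1 / 2) * (C * s powr (- 1 / 4))"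
        using x2 by (intro mult_mono) auto
      then have b: "x\<^sup>2 * l powr lam \<le> C * s powr (- 3 / 4)" unfolding sp[symmetric] by (simp only: mult_ac)
      have "0 \<le> C * (x\<^sup>2 * L powr lam)" "0 \<le> C * (x\<^sup>2 * l powr lam)" using C_ge by auto
      with a b show ?thesis
        unfolding l_def L_def by (simp add: algebra_simps)
    qed
  qed
  then show thesis using that[of C] C_ge(5) by blast
qed

section \<open>Radial integration of the chord kernel\<close>

lemma nn_integral_log_weight:
  fixes lam :: real
  assumes lam: "lam > -1" and d: "0 < d" "d \<le> b" "b \<le> 1"
  shows "(\<integral>\<^sup>+s. ennreal (ln (2 / s) powr lam / s) * indicator {d..b} s \<partial>lborel)
     = ennreal ((ln (2 / d) powr (lam + 1) - ln (2 / b) powr (lam + 1)) / (lam + 1))"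
proof -
  \<comment> \<open>The primitive is the source of the exponent \<open>lam + 1\<close> in (iii). The
    2 in the logarithm keeps its value positive up to \<open>s = 1\<close>.\<close>
  define F where "F s = - (ln (2 / s) powr (lam + 1)) / (lam + 1)" for s
  have "(\<integral>\<^sup>+s. ennreal (ln (2 / s) powr lam / s) * indicator {d..b} s \<partial>lborel) = F b - F d"
  proof (rule nn_integral_FTC_Icc)
    fix s assume s: "s \<in> {d..b}"
    then have s': "0 < s" "s \<le> 1" using d by auto
    then have pos: "ln (2 / s) > 0" by simp
    have "((\<lambda>s. ln (2 / s)) has_real_derivative - (1 / s)) (at s)"
      using s' by (auto intro!: derivative_eq_intros simp: power2_eq_square)
    from DERIV_cdivide[OF DERIV_minus[OF DERIV_fun_powr[OF this pos, of "lam + 1"]], of "lam + 1"]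
    show "(F has_real_derivative ln (2 / s) powr lam / s) (at s)"
      using lam by (simp add: F_def[abs_def])
    show "0 \<le> ln (2 / s) powr lam / s" using s' by simp
  qed (use d in auto)
  then show ?thesis by (simp add: F_def diff_divide_distrib)
qed

text \<open>With \<open>s = 1 - r\<close> the kernel has the size of
  \<open>s / (s\<twosuperior> + d\<twosuperior>)\<close>: about \<open>1 / s\<close> at scales above
  the chord and \<open>s / d\<twosuperior>\<close> below. The numerator lies between
  \<open>s\<close> and \<open>4 * s\<close>; the 9 rounds up generously.\<close>

lemma chord_kernel_bounds:
  assumes s: "0 < s" "s \<le> 1 / 2" and d: "0 \<le> d"
  shows "chord_kernel (1 - s) d \<le> 4 / s"
    and "0 < d \<Longrightarrow> chord_kernel (1 - s) d \<le> 16 * s / d\<^sup>2"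
    and "d \<le> s \<Longrightarrow> 1 / (9 * s) \<le> chord_kernel (1 - s) d"
proof -
  let ?D = "(1 - (1 - s)\<^sup>2)\<^sup>2 + (1 - s)\<^sup>2 * d\<^sup>2"
  have n1: "1 - (1 - s) ^ 4 \<le> 4 * s"
    using Bernoulli_inequality[of "- s" 4] s by simp
  have n2: "s \<le> 1 - (1 - s) ^ 4"
    using power_decreasing[of 1 4 "1 - s"] s by simp
  have e: "1 - (1 - s)\<^sup>2 = s * (2 - s)" by (simp add: power2_eq_square algebra_simps)
  have D1: "s\<^sup>2 \<le> ?D"
  proof -
    have "s * 1 \<le> s * (2 - s)" using s by (intro mult_left_mono) auto
    then have "s\<^sup>2 \<le> (1 - (1 - s)\<^sup>2)\<^sup>2" unfolding e using s by (intro power_mono) auto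
    then show ?thesis by (simp add: add_increasing2)
  qed
  have D2: "d\<^sup>2 / 4 \<le> ?D"
  proof -
    have "(1/2)\<^sup>2 \<le> (1 - s)\<^sup>2" using s by (intro power_mono) auto
    then have "(1/2)\<^sup>2 * d\<^sup>2 \<le> (1 - s)\<^sup>2 * d\<^sup>2" by (intro mult_right_mono) auto
    then show ?thesis by (simp add: power2_eq_square add_increasing)
  qed
  have "chord_kernel (1 - s) d \<le> 4 * s / s\<^sup>2"
    unfolding chord_kernel_def using n1 n2 s D1 by (intro frac_le) auto
  then show "chord_kernel (1 - s) d \<le> 4 / s" using s by (simp add: power2_eq_square)
  show "chord_kernel (1 - s) d \<le> 16 * s / d\<^sup>2" if "0 < d"
  proof -
    have "chord_kernel (1 - s) d \<le> 4 * s / (d\<^sup>2 / 4)"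
      unfolding chord_kernel_def using n1 n2 s D2 that by (intro frac_le) auto
    then show ?thesis by simp
  qed
  show "1 / (9 * s) \<le> chord_kernel (1 - s) d" if ds: "d \<le> s"
  proof -
    have "s * (2 - s) \<le> s * 2" using s by (intro mult_left_mono) auto
    then have "(1 - (1 - s)\<^sup>2)\<^sup>2 \<le> (s * 2)\<^sup>2" unfolding e using s by (intro power_mono) auto
    moreover have "(1 - s)\<^sup>2 * d\<^sup>2 \<le> 1\<^sup>2 * s\<^sup>2" using s ds d by (intro mult_mono power_mono) auto
    ultimately have "?D \<le> (s * 2)\<^sup>2 + 1\<^sup>2 * s\<^sup>2" by (rule add_mono)
    also have "\<dots> \<le> 9 * s\<^sup>2" by (simp add: power_mult_distrib)
    finally have D9: "?D \<le> 9 * s\<^sup>2" .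
    have pos: "?D > 0" using D1 s by (smt (verit) zero_less_power)
    have "1 / (9 * s) = s / (9 * s\<^sup>2)" using s by (simp add: power2_eq_square)
    also have "\<dots> \<le> chord_kernel (1 - s) d"
      unfolding chord_kernel_def using n2 s D9 pos by (intro frac_le) auto
    finally show ?thesis .
  qed
qed

text \<open>A logarithm of \<open>t / s\<close> is absorbed by \<open>t / s\<close> itself. The
  restriction \<open>t \<le> 1 / 2\<close> makes \<open>ln (2 / t) \<ge> 1\<close>, so that
  \<open>ln (2 / s)\<close> is at most the product of \<open>ln (2 / t)\<close> and
  \<open>1 + ln (t / s)\<close>.\<close>

lemma log_weight_quasi_monotone:
  fixes lam :: real
  obtains C where "C \<ge> 0"
    "\<And>s t. 0 < s \<Longrightarrow> s \<le> t \<Longrightarrow> t \<le> 1 / 2 \<Longrightarrow> s * ln (2 / s) powr lam \<le> C * (t * ln (2 / t) powr lam)"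
proof -
  obtain C where C: "C \<ge> 1" "\<And>x. x \<ge> 1 \<Longrightarrow> (1 + ln x) powr lam \<le> C * x powr 1"
    using log_powr_bound[of 1 lam] by auto
  have "s * ln (2 / s) powr lam \<le> C * (t * ln (2 / t) powr lam)" if s: "0 < s" "s \<le> t" "t \<le> 1 / 2" for s t
  proof -
    have "4 \<le> 2 / t" using s by (simp add: field_simps)
    then have "exp 1 \<le> 2 / t" using exp_le by linarith
    then have lt: "1 \<le> ln (2 / t)" using s by (subst ln_ge_iff) auto
    have eq: "ln (2 / s) = ln (2 / t) + ln (t / s)" using s by (simp add: ln_div)
    have ln0: "0 \<le> ln (t / s)" using s by simp
    have "ln (2 / s) powr lam \<le> ln (2 / t) powr lam * (C * (t / s))"
    proof (cases "lam \<ge> 0")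
      case True
      have "1 * ln (t / s) \<le> ln (2 / t) * ln (t / s)" using lt ln0 by (intro mult_right_mono) auto
      then have "ln (2 / s) \<le> ln (2 / t) * (1 + ln (t / s))" by (simp add: eq algebra_simps)
      then have "ln (2 / s) powr lam \<le> (ln (2 / t) * (1 + ln (t / s))) powr lam"
        using True eq lt ln0 by (intro powr_mono2) auto
      also have "\<dots> = ln (2 / t) powr lam * (1 + ln (t / s)) powr lam"
        by (rule powr_mult)
      also have "\<dots> \<le> ln (2 / t) powr lam * (C * (t / s))"
        using C(2)[of "t / s"] s by (intro mult_left_mono) auto
      finally show ?thesis .
    next
      case False
      then have "ln (2 / s) powr lam \<le> ln (2 / t) powr lam"
        using eq lt ln0 by (intro powr_mono2') auto
      moreover have "1 * 1 \<le> C * (t / s)" using C(1) s by (intro mult_mono) auto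
      ultimately show ?thesis using mult_left_mono[of 1 "C * (t / s)" "ln (2 / t) powr lam"] by simp
    qed
    then have "s * ln (2 / s) powr lam \<le> s * (ln (2 / t) powr lam * (C * (t / s)))"
      using s by (intro mult_left_mono) auto
    then show ?thesis using s by (simp add: field_simps)
  qed
  then show thesis using that[of C] C(1) by simp
qed

text \<open>Radii below \<open>1/2\<close> contribute a bounded amount. Leaving them out keeps the
  factor \<open>r\<close> of the area element away from zero.\<close>

definition radial_kernel :: "real \<Rightarrow> real \<Rightarrow> ennreal" where
  "radial_kernel lam d =
     (\<integral>\<^sup>+r. ennreal (ln (2 / (1 - r)) powr lam * chord_kernel r d) * indicator {1/2..<1} r \<partial>lborel)"

lemma radial_kernel_eq:
  "radial_kernel lam d =
     (\<integral>\<^sup>+s. ennreal (ln (2 / s) powr lam * chord_kernel (1 - s) d) * indicator {0<..1/2} s \<partial>lborel)"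
  unfolding radial_kernel_def chord_kernel_def
  by (subst nn_integral_real_affine[where c="-1" and t=1])
    (auto intro!: nn_integral_cong simp: indicator_def)

text \<open>Only the scales from \<open>d\<close> to \<open>1/2\<close> are kept, where the kernel
  is at least \<open>1 / (9 * s)\<close>; \<open>9 * (lam + 1)\<close> undoes this constant and the
  one of the primitive. The value of the logarithm at \<open>s = 1/2\<close> is \<open>ln 4\<close>,
  which also bounds \<open>\<bar>ln d\<bar>\<close> for larger \<open>d\<close>.\<close>

lemma radial_kernel_lower:
  fixes lam :: real
  assumes lam: "lam > -1" and d: "0 < d" "d \<le> 2"
  shows "ennreal (\<bar>ln d\<bar> powr (lam + 1))
    \<le> ennreal (9 * (lam + 1) + ln 4 powr (lam + 1)) * (radial_kernel lam d + 1)"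
proof -
  define p where "p = lam + 1"
  have p: "p > 0" using lam by (simp add: p_def)
  have l4: "ln 4 powr p \<ge> 0" by simp
  have "ennreal (\<bar>ln d\<bar> powr p) \<le> ennreal (9 * p) * radial_kernel lam d + ennreal (ln 4 powr p)"
  proof (cases "d \<le> 1/2")
    case True
    have "ennreal (1 / 9) * ennreal ((ln (2 / d) powr p - ln 4 powr p) / p)
       = (\<integral>\<^sup>+s. ennreal (1 / 9) * (ennreal (ln (2 / s) powr lam / s) * indicator {d..1/2} s) \<partial>lborel)"
      using nn_integral_log_weight[OF lam d(1) True]
      by (subst nn_integral_cmult) (auto simp: p_def)
    also have "\<dots> \<le> radial_kernel lam d"
      unfolding radial_kernel_eq
    proof (rule nn_integral_mono)
      fix s
      show "ennreal (1 / 9) * (ennreal (ln (2 / s) powr lam / s) * indicator {d..1/2} s)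
          \<le> ennreal (ln (2 / s) powr lam * chord_kernel (1 - s) d) * indicator {0<..1/2} s"
      proof (cases "s \<in> {d..1/2}")
        case True
        then have s: "0 < s" "s \<le> 1/2" "d \<le> s" using d by auto
        have "ln (2 / s) powr lam * (1 / (9 * s)) \<le> ln (2 / s) powr lam * chord_kernel (1 - s) d"
          using chord_kernel_bounds(3)[OF s(1,2) _ s(3)] d by (intro mult_left_mono) auto
        then show ?thesis using s by (auto simp: ennreal_mult[symmetric] intro!: ennreal_leI)
      qed auto
    qed
    finally have k: "ennreal (1 / 9) * ennreal ((ln (2 / d) powr p - ln 4 powr p) / p) \<le> radial_kernel lam d" .
    have ld: "ln (2 / d) = ln 2 + \<bar>ln d\<bar>" using d True by (simp add: ln_div)
    have "ln 4 \<le> ln (2 / d)" using d True by (subst ln_le_cancel_iff) (auto simp: field_simps)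
    then have nn: "0 \<le> ln (2 / d) powr p - ln 4 powr p" using p by (simp add: powr_mono2)
    have "\<bar>ln d\<bar> powr p \<le> ln (2 / d) powr p"
      using p ld by (intro powr_mono2) auto
    also have "\<dots> = (9 * p) * ((1/9) * ((ln (2 / d) powr p - ln 4 powr p) / p)) + ln 4 powr p"
      using p by simp
    finally have "ennreal (\<bar>ln d\<bar> powr p) \<le> ennreal ((9 * p) * ((1/9) * ((ln (2 / d) powr p - ln 4 powr p) / p)) + ln 4 powr p)"
      by (rule ennreal_leI)
    also have "\<dots> = ennreal (9 * p) * (ennreal (1 / 9) * ennreal ((ln (2 / d) powr p - ln 4 powr p) / p)) + ennreal (ln 4 powr p)"
      using p nn by (simp only: ennreal_plus ennreal_mult'[symmetric] divide_nonneg_pos mult_nonneg_nonneg l4)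
    also have "\<dots> \<le> ennreal (9 * p) * radial_kernel lam d + ennreal (ln 4 powr p)"
      using k by (intro add_right_mono mult_left_mono) auto
    finally show ?thesis .
  next
    case False
    have "ln d \<le> ln 2" "ln (1/2) \<le> ln d" using d False by (subst ln_le_cancel_iff; simp)+
    then have "\<bar>ln d\<bar> \<le> ln 4" by (simp add: ln_div abs_le_iff) (smt (verit) ln_le_cancel_iff)
    then have "\<bar>ln d\<bar> powr p \<le> ln 4 powr p" using p by (intro powr_mono2) auto
    then show ?thesis by (intro add_increasing ennreal_leI) auto
  qed
  also have "\<dots> \<le> ennreal (9 * p + ln 4 powr p) * (radial_kernel lam d + 1)"
    using p by (auto simp: ennreal_plus distrib_left distrib_right intro!: add_mono add_increasing add_increasing2)
  finally show ?thesis by (simp add: p_def)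
qed

text \<open>The range is split at \<open>t = min d (1/2)\<close>. Below \<open>t\<close>,
  quasi-monotonicity bounds the integrand by a multiple of \<open>w / t\<close>, giving a multiple
  of \<open>w\<close> after integration over a length \<open>t\<close>; above \<open>t\<close>, the
  bound \<open>4 / s\<close> leads to the primitive.\<close>

lemma radial_kernel_upper:
  fixes lam :: real
  assumes lam: "lam > -1"
  obtains C where "C \<ge> 0" "\<And>d. 0 < d \<Longrightarrow> d \<le> 2 \<Longrightarrow> radial_kernel lam d \<le> ennreal (C * (\<bar>ln d\<bar> powr (lam + 1) + 1))"
proof -
  define p where "p = lam + 1"
  have p: "p > 0" using lam by (simp add: p_def)
  obtain C where C: "C \<ge> 0"
    "\<And>s t. 0 < s \<Longrightarrow> s \<le> t \<Longrightarrow> t \<le> 1 / 2 \<Longrightarrow> s * ln (2 / s) powr lam \<le> C * (t * ln (2 / t) powr lam)"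
    using log_weight_quasi_monotone[of lam] by blast
  define C' where "C' = (16 * C + 4 / p) * (2 powr p + 4 powr p)"
  have "radial_kernel lam d \<le> ennreal (C' * (\<bar>ln d\<bar> powr p + 1))" if d: "0 < d" "d \<le> 2" for d
  proof -
    define t where "t = min d (1/2)"
    have t: "0 < t" "t \<le> 1/2" "t \<le> d" using d by (auto simp: t_def)
    define w where "w = ln (2 / t) powr lam"
    have "radial_kernel lam d \<le> (\<integral>\<^sup>+s. ennreal (16 * C * w / t) * indicator {0..t} s
        + ennreal 4 * (ennreal (ln (2 / s) powr lam / s) * indicator {t..1/2} s) \<partial>lborel)"
      unfolding radial_kernel_eq
    proof (rule nn_integral_mono)
      fix s :: real
      consider "s \<notin> {0<..1/2}" | "0 < s" "s \<le> t" | "t \<le> s" "s \<le> 1/2" by force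
      then show "ennreal (ln (2 / s) powr lam * chord_kernel (1 - s) d) * indicator {0<..1/2} s
          \<le> ennreal (16 * C * w / t) * indicator {0..t} s
            + ennreal 4 * (ennreal (ln (2 / s) powr lam / s) * indicator {t..1/2} s)"
      proof cases
        case 2
        have "chord_kernel (1 - s) d \<le> 16 * s / d\<^sup>2"
          using 2 t d by (intro chord_kernel_bounds(2)) auto
        also have "\<dots> \<le> 16 * s / t\<^sup>2" using 2 t by (intro divide_left_mono power_mono) auto
        finally have "ln (2 / s) powr lam * chord_kernel (1 - s) d \<le> ln (2 / s) powr lam * (16 * s / t\<^sup>2)"
          by (intro mult_left_mono) auto
        also have "\<dots> = 16 / t\<^sup>2 * (s * ln (2 / s) powr lam)" by simp
        also have "\<dots> \<le> 16 / t\<^sup>2 * (C * (t * w))"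
          unfolding w_def using C(2)[OF 2 t(2)] by (intro mult_left_mono) auto
        also have "\<dots> = 16 * C * w / t" using t by (simp add: power2_eq_square)
        finally show ?thesis using 2 t by (intro add_increasing2) (auto intro: ennreal_leI)
      next
        case 3
        have "ln (2 / s) powr lam * chord_kernel (1 - s) d \<le> ln (2 / s) powr lam * (4 / s)"
          using 3 t d by (intro mult_left_mono chord_kernel_bounds(1)) auto
        also have "\<dots> = 4 * (ln (2 / s) powr lam / s)" by simp
        finally have "ennreal (ln (2 / s) powr lam * chord_kernel (1 - s) d) \<le> ennreal 4 * ennreal (ln (2 / s) powr lam / s)"
          using 3 t by (subst ennreal_mult[symmetric]) (auto intro!: ennreal_leI)
        then show ?thesis using 3 t by (intro add_increasing) (auto simp: indicator_def)
      qed auto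
    qed
    also have "\<dots> = ennreal (16 * C * w / t) * ennreal t
        + ennreal 4 * ennreal ((ln (2 / t) powr p - ln 4 powr p) / p)"
      using nn_integral_log_weight[OF lam t(1,2)] t
      by (subst nn_integral_add) (auto simp: nn_integral_cmult p_def)
    also have "\<dots> = ennreal (16 * C * w / t * t + 4 * ((ln (2 / t) powr p - ln 4 powr p) / p))"
    proof -
      have "ln 4 \<le> ln (2 / t)" using t by (subst ln_le_cancel_iff) (auto simp: field_simps)
      then have "ln 4 powr p \<le> ln (2 / t) powr p" using p by (simp add: powr_mono2)
      then have n1: "0 \<le> (ln (2 / t) powr p - ln 4 powr p) / p" using p by simp
      have n2: "0 \<le> 16 * C * w / t" using t C by (simp add: w_def)
      show ?thesis
        using n1 n2 t by (simp only: ennreal_mult[symmetric] ennreal_plus[symmetric] mult_nonneg_nonneg zero_le_numeral less_imp_le)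
    qed
    also have "\<dots> \<le> ennreal (C' * (\<bar>ln d\<bar> powr p + 1))"
    proof (rule ennreal_leI)
      have "4 \<le> 2 / t" using t by (simp add: field_simps)
      then have "exp 1 \<le> 2 / t" using exp_le by linarith
      then have lt: "1 \<le> ln (2 / t)" using t by (subst ln_ge_iff) auto
      have "w \<le> ln (2 / t) powr p" unfolding w_def p_def using lt by (intro powr_mono) auto
      moreover have "ln (2 / t) powr p / p - ln 4 powr p / p \<le> ln (2 / t) powr p / p" using p by simp
      ultimately have "16 * C * w / t * t + 4 * ((ln (2 / t) powr p - ln 4 powr p) / p)
          \<le> 16 * C * ln (2 / t) powr p + 4 * (ln (2 / t) powr p / p)"
        using t C by (intro add_mono mult_left_mono) (auto simp: diff_divide_distrib mult_left_mono)
      also have "\<dots> = (16 * C + 4 / p) * ln (2 / t) powr p" by (simp add: algebra_simps)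
      also have "\<dots> \<le> (16 * C + 4 / p) * ((2 powr p + 4 powr p) * (\<bar>ln d\<bar> powr p + 1))"
      proof (intro mult_left_mono)
        have "ln 4 = 2 * ln (2::real)" using ln_realpow[of 2 2] by simp
        then have l4: "ln 4 \<le> (2::real)" using ln_le_minus_one[of 2] by simp
        \<comment> \<open>The maximum with 2 is needed near \<open>d = 1\<close>, where
          \<open>\<bar>ln d\<bar>\<close> vanishes but the kernel does not; it becomes the additive
          1 of the statement.\<close>
        have "ln (2 / t) \<le> 2 * max \<bar>ln d\<bar> 2"
        proof (cases "d \<le> 1/2")
          case True
          then have "ln (2 / t) = ln 2 + \<bar>ln d\<bar>" using d by (simp add: t_def ln_div)
          then show ?thesis using ln_le_minus_one[of 2] by (simp add: max_def)
        next
          case False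
          then have "ln (2 / t) = ln 4" by (simp add: t_def)
          then show ?thesis using l4 by (simp add: max_def)
        qed
        then have "ln (2 / t) powr p \<le> (2 * max \<bar>ln d\<bar> 2) powr p"
          using lt p by (intro powr_mono2) auto
        also have "\<dots> \<le> 2 powr p * \<bar>ln d\<bar> powr p + 4 powr p"
          by (cases "\<bar>ln d\<bar> \<le> 2") (auto simp: max_def powr_mult)
        also have "\<dots> \<le> (2 powr p + 4 powr p) * (\<bar>ln d\<bar> powr p + 1)"
          by (simp add: algebra_simps)
        finally show "ln (2 / t) powr p \<le> (2 powr p + 4 powr p) * (\<bar>ln d\<bar> powr p + 1)" .
      qed (use C p in auto)
      finally show "16 * C * w / t * t + 4 * ((ln (2 / t) powr p - ln 4 powr p) / p) \<le> C' * (\<bar>ln d\<bar> powr p + 1)"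
        by (simp add: C'_def mult.assoc)
    qed
    finally show ?thesis .
  qed
  moreover have "C' \<ge> 0" using C p by (simp add: C'_def)
  ultimately show thesis using that[of C'] by (simp add: p_def)
qed

lemma nn_integral_powr_from_0:
  fixes e :: real
  assumes "e < 1"
  shows "(\<integral>\<^sup>+s. ennreal (s powr (- e)) * indicator {0<..1} s \<partial>lborel) < \<infinity>"
proof -
  have "((\<lambda>s. s powr (- e)) has_integral (1 powr (- e + 1) / (- e + 1))) {0..1}"
    using assms by (intro has_integral_powr_from_0) auto
  from nn_integral_has_integral_lebesgue[OF _ this]
  have "(\<integral>\<^sup>+s. ennreal (indicator {0..1} s * s powr (- e)) \<partial>lborel) = ennreal (1 powr (- e + 1) / (- e + 1))"
    by simp
  moreover have "(\<integral>\<^sup>+s. ennreal (s powr (- e)) * indicator {0<..1} s \<partial>lborel)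
     \<le> (\<integral>\<^sup>+s. ennreal (indicator {0..1} s * s powr (- e)) \<partial>lborel)"
    by (intro nn_integral_mono) (auto simp: indicator_def)
  ultimately show ?thesis
    by (metis ennreal_less_top infinity_ennreal_def order_le_less_trans)
qed

lemma nn_integral_radial_weight:
  fixes e :: real
  assumes "e < 1"
  shows "(\<integral>\<^sup>+r. ennreal ((1 - r) powr (- e)) * indicator {0..<1} r \<partial>lborel) < \<infinity>"
proof -
  have "(\<integral>\<^sup>+r. ennreal ((1 - r) powr (- e)) * indicator {0..<1} r \<partial>lborel)
      = (\<integral>\<^sup>+s. ennreal (s powr (- e)) * indicator {0<..1} s \<partial>lborel)"
    by (subst nn_integral_real_affine[where c="-1" and t=1])
      (auto intro!: nn_integral_cong simp: indicator_def)
  then show ?thesis using nn_integral_powr_from_0[OF assms] by simp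
qed

section \<open>Weighted energy and logarithmic distance\<close>

lemma nn_integral_finite_comparison:
  fixes f g e :: "'a \<Rightarrow> real"
  assumes C: "C \<ge> 0" and le: "\<And>x. x \<in> A \<Longrightarrow> f x \<le> C * (g x + e x)"
    and nn: "\<And>x. x \<in> A \<Longrightarrow> 0 \<le> g x" "\<And>x. x \<in> A \<Longrightarrow> 0 \<le> e x"
    and [measurable]: "g \<in> borel_measurable M" "e \<in> borel_measurable M" "A \<in> sets M"
    and g: "(\<integral>\<^sup>+x\<in>A. ennreal (g x) \<partial>M) < \<infinity>" and e: "(\<integral>\<^sup>+x\<in>A. ennreal (e x) \<partial>M) < \<infinity>"
  shows "(\<integral>\<^sup>+x\<in>A. ennreal (f x) \<partial>M) < \<infinity>"
proof -
  have "(\<integral>\<^sup>+x\<in>A. ennreal (f x) \<partial>M)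
     \<le> (\<integral>\<^sup>+x. ennreal C * (ennreal (g x) * indicator A x + ennreal (e x) * indicator A x) \<partial>M)"
  proof (rule nn_integral_mono)
    fix x
    show "ennreal (f x) * indicator A x \<le> ennreal C * (ennreal (g x) * indicator A x + ennreal (e x) * indicator A x)"
      using le[of x] nn[of x] C
      by (cases "x \<in> A") (auto simp: ennreal_plus[symmetric] ennreal_mult[symmetric] simp del: ennreal_plus intro!: ennreal_leI)
  qed
  also have "\<dots> = ennreal C * ((\<integral>\<^sup>+x\<in>A. ennreal (g x) \<partial>M) + (\<integral>\<^sup>+x\<in>A. ennreal (e x) \<partial>M))"
    by (subst nn_integral_cmult) (auto simp: nn_integral_add)
  also have "\<dots> < \<infinity>" using g e by (simp add: ennreal_mult_less_top)
  finally show ?thesis .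
qed

lemma ball_in_sets_borel [measurable]: "ball (a :: complex) r \<in> sets borel"
  by simp

lemma nn_integral_disc_radial_weight:
  fixes e :: real
  assumes "e < 1"
  shows "(\<integral>\<^sup>+z\<in>ball 0 1. ennreal ((1 - norm z) powr (- e)) \<partial>(lborel :: complex measure)) < \<infinity>"
proof -
  let ?g = "\<lambda>r. ennreal ((1 - r) powr (- e)) * indicator {0..<1} r"
  let ?f = "\<lambda>r \<zeta>. ennreal ((1 - norm (of_real r * \<zeta>)) powr (- e)) * indicator (ball 0 1) (of_real r * \<zeta>)"
  have "(\<integral>\<^sup>+z\<in>ball 0 1. ennreal ((1 - norm z) powr (- e)) \<partial>(lborel :: complex measure))
     = (\<integral>\<^sup>+r. ennreal r * (\<integral>\<^sup>+\<zeta>. ?f r \<zeta> \<partial>arc_length)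
          * indicator {0<..} r \<partial>lborel)"
    by (rule nn_integral_polar) measurable
  also have "\<dots> \<le> (\<integral>\<^sup>+r. ennreal (2 * pi) * (?g r) \<partial>lborel)"
  proof (rule nn_integral_mono)
    fix r :: real
    show "ennreal r * (\<integral>\<^sup>+\<zeta>. ?f r \<zeta> \<partial>arc_length)
          * indicator {0<..} r \<le> ennreal (2 * pi) * (?g r)"
    proof (cases "r > 0")
      case True
      have "(\<integral>\<^sup>+\<zeta>. ?f r \<zeta> \<partial>arc_length)
          = (\<integral>\<^sup>+\<zeta>. ?g r \<partial>arc_length)"
        using True by (intro nn_integral_cong) (auto simp: norm_mult indicator_def)
      also have "\<dots> = ?g r * ennreal (2 * pi)"
        by (simp add: emeasure_arc_length_space)
      finally have *: "(\<integral>\<^sup>+\<zeta>. ?f r \<zeta> \<partial>arc_length)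
          = ?g r * ennreal (2 * pi)" .
      show ?thesis
      proof (cases "r < 1")
        case r1: True
        then have "ennreal r * (?g r * ennreal (2 * pi))
           \<le> 1 * (?g r * ennreal (2 * pi))"
          using True by (intro mult_right_mono) auto
        then show ?thesis unfolding * using True by (simp add: mult_ac)
      qed (simp add: *)
    qed simp
  qed
  also have "\<dots> = ennreal (2 * pi) * (\<integral>\<^sup>+r. ?g r \<partial>lborel)"
    by (rule nn_integral_cmult) measurable
  also have "\<dots> < \<infinity>"
    using nn_integral_radial_weight[OF assms] by (simp add: ennreal_mult_less_top)
  finally show ?thesis .
qed

context circle_homeomorphism
begin

text \<open>(iii) and all quantities linking it to (ii) and (iv) take this form, so comparing them
  reduces to comparing functions of the chord on \<open>(0, 2]\<close>.\<close>

definition double_integral :: "(real \<Rightarrow> ennreal) \<Rightarrow> ennreal" where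
  "double_integral F = (\<integral>\<^sup>+\<xi>. (\<integral>\<^sup>+\<eta>. F (norm (\<psi> \<eta> - \<psi> \<xi>)) \<partial>arc_length) \<partial>arc_length)"

text \<open>Since \<open>\<psi>\<close> is injective, the chord vanishes for fixed
  \<open>\<xi>\<close> only at \<open>\<eta> = \<xi>\<close>, a null point. The value of
  \<open>F\<close> at 0, in particular the convention for \<open>ln 0\<close>, is thus
  irrelevant.\<close>

lemma double_integral_mono:
  assumes "\<And>d. 0 < d \<Longrightarrow> d \<le> 2 \<Longrightarrow> F d \<le> G d"
  shows "double_integral F \<le> double_integral G"
  unfolding double_integral_def
proof (rule nn_integral_mono)
  fix \<xi> assume "\<xi> \<in> space arc_length"
  then have \<xi>: "norm \<xi> = 1" by simp
  show "(\<integral>\<^sup>+\<eta>. F (norm (\<psi> \<eta> - \<psi> \<xi>)) \<partial>arc_length) \<le> (\<integral>\<^sup>+\<eta>. G (norm (\<psi> \<eta> - \<psi> \<xi>)) \<partial>arc_length)"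
  proof (rule nn_integral_mono_AE)
    have "AE \<eta> in arc_length. \<eta> \<noteq> \<xi> \<and> \<eta> \<in> space arc_length"
      using AE_arc_length_neq by (auto intro: AE_space)
    then show "AE \<eta> in arc_length. F (norm (\<psi> \<eta> - \<psi> \<xi>)) \<le> G (norm (\<psi> \<eta> - \<psi> \<xi>))"
    proof eventually_elim
      case (elim \<eta>)
      then have "norm \<eta> = 1" "\<psi> \<eta> \<noteq> \<psi> \<xi>" using \<xi> inj_psi by auto
      then show ?case
        using norm_triangle_ineq4[of "\<psi> \<eta>" "\<psi> \<xi>"] \<xi> norm_psi by (intro assms) auto
    qed
  qed
qed

lemma double_integral_finite_comparison:
  assumes "\<And>d. 0 < d \<Longrightarrow> d \<le> 2 \<Longrightarrow> F d \<le> ennreal C * (G d + 1)"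
    and [measurable]: "G \<in> borel_measurable borel"
    and fin: "double_integral G < \<infinity>"
  shows "double_integral F < \<infinity>"
proof -
  have "double_integral F \<le> double_integral (\<lambda>d. ennreal C * (G d + 1))"
    by (rule double_integral_mono) fact
  also have "\<dots> = ennreal C * (double_integral G + ennreal (2 * pi) * ennreal (2 * pi))"
    unfolding double_integral_def
    by (simp add: nn_integral_cmult nn_integral_add emeasure_arc_length_space)
  also have "\<dots> < \<infinity>"
    using fin by (auto simp: ennreal_mult_less_top)
  finally show ?thesis .
qed

text \<open>Outside the disc \<open>norm_D\<close> is not under control. The formula with Cauchy
  integrals is measurable on the whole plane and agrees with it inside.\<close>

lemma norm_D_measurable_version:
  obtains D where "D \<in> borel_measurable borel" "\<And>z. 0 \<le> D z"
    "\<And>z. norm z < 1 \<Longrightarrow> norm_D (poisson_extension \<phi>) z = D z"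
proof
  let ?D = "\<lambda>z. (norm (cauchy_transform \<psi> (\<lambda>\<eta>. \<eta>) z) + norm (cauchy_transform \<psi> cnj z)) / (2 * pi)"
  show "?D \<in> borel_measurable borel" by measurable
qed (auto simp: norm_D_poisson_extension[OF homeo])

lemma energy_nonneg: "0 \<le> energy z" by (simp add: energy_def)

text \<open>The exchange of logarithms is applied with \<open>s = 1 - norm z\<close> and
  \<open>x\<close> the norm of the differential. Its error \<open>(1 - norm z) powr (- 3/4)\<close>
  is integrable over the disc.\<close>

lemma log_energy_iff_weighted_energy:
  "(\<integral>\<^sup>+z\<in>ball 0 1. ennreal ((norm_D (poisson_extension \<phi>) z)\<^sup>2 * ln (exp 1 + norm_D (poisson_extension \<phi>) z) powr lam) \<partial>lborel) < \<infinity>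
   \<longleftrightarrow> (\<integral>\<^sup>+z\<in>ball 0 1. ennreal ((norm_D (poisson_extension \<phi>) z)\<^sup>2 * ln (2 / (1 - norm z)) powr lam) \<partial>lborel) < \<infinity>"
proof -
  let ?N = "norm_D (poisson_extension \<phi>)"
  obtain D where D [measurable]: "D \<in> borel_measurable borel" "\<And>z. 0 \<le> D z"
    and DD: "\<And>z. norm z < 1 \<Longrightarrow> ?N z = D z"
    using norm_D_measurable_version by blast
  obtain C where C: "C \<ge> 0"
    "\<And>s x. 0 < s \<Longrightarrow> s \<le> 1 \<Longrightarrow> 0 \<le> x \<Longrightarrow> x \<le> 2 / s \<Longrightarrow>
      x\<^sup>2 * ln (exp 1 + x) powr lam \<le> C * (x\<^sup>2 * ln (2 / s) powr lam + s powr (- 3 / 4))"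
    "\<And>s x. 0 < s \<Longrightarrow> s \<le> 1 \<Longrightarrow> 0 \<le> x \<Longrightarrow> x \<le> 2 / s \<Longrightarrow>
      x\<^sup>2 * ln (2 / s) powr lam \<le> C * (x\<^sup>2 * ln (exp 1 + x) powr lam + s powr (- 3 / 4))"
    using log_weights_comparable[of 2 lam] by auto
  have bd: "D z \<le> 2 / (1 - norm z)" if "norm z < 1" for z
    using norm_D_bound[OF that] DD[OF that] by simp
  have e: "(\<integral>\<^sup>+z\<in>ball 0 1. ennreal ((1 - norm z) powr (- 3 / 4)) \<partial>(lborel :: complex measure)) < \<infinity>"
    using nn_integral_disc_radial_weight[of "3 / 4"] by simp
  have e1: "(\<integral>\<^sup>+z\<in>ball 0 1. ennreal ((?N z)\<^sup>2 * ln (exp 1 + ?N z) powr lam) \<partial>lborel)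
     = (\<integral>\<^sup>+z\<in>ball 0 1. ennreal ((D z)\<^sup>2 * ln (exp 1 + D z) powr lam) \<partial>lborel)"
    by (intro nn_integral_cong) (auto simp: indicator_def DD)
  have e2: "(\<integral>\<^sup>+z\<in>ball 0 1. ennreal ((?N z)\<^sup>2 * ln (2 / (1 - norm z)) powr lam) \<partial>lborel)
     = (\<integral>\<^sup>+z\<in>ball 0 1. ennreal ((D z)\<^sup>2 * ln (2 / (1 - norm z)) powr lam) \<partial>lborel)"
    by (intro nn_integral_cong) (auto simp: indicator_def DD)
  have i1: "(\<integral>\<^sup>+z\<in>ball 0 1. ennreal ((D z)\<^sup>2 * ln (exp 1 + D z) powr lam) \<partial>lborel) < \<infinity>"
    if "(\<integral>\<^sup>+z\<in>ball 0 1. ennreal ((D z)\<^sup>2 * ln (2 / (1 - norm z)) powr lam) \<partial>lborel) < \<infinity>"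
    by (rule nn_integral_finite_comparison[OF C(1) _ _ _ _ _ _ that e]) (use D(2) bd in \<open>auto intro!: C(2)[simplified]\<close>)
  have i2: "(\<integral>\<^sup>+z\<in>ball 0 1. ennreal ((D z)\<^sup>2 * ln (2 / (1 - norm z)) powr lam) \<partial>lborel) < \<infinity>"
    if "(\<integral>\<^sup>+z\<in>ball 0 1. ennreal ((D z)\<^sup>2 * ln (exp 1 + D z) powr lam) \<partial>lborel) < \<infinity>"
    by (rule nn_integral_finite_comparison[OF C(1) _ _ _ _ _ _ that e]) (use D(2) bd in \<open>auto intro!: C(3)[simplified]\<close>)
  show ?thesis unfolding e1 e2 by (rule iffI[OF i2 i1])
qed

lemma weighted_energy_iff:
  "(\<integral>\<^sup>+z\<in>ball 0 1. ennreal ((norm_D (poisson_extension \<phi>) z)\<^sup>2 * ln (2 / (1 - norm z)) powr lam) \<partial>lborel) < \<infinity>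
   \<longleftrightarrow> (\<integral>\<^sup>+z\<in>ball 0 1. ennreal (energy z * ln (2 / (1 - norm z)) powr lam) \<partial>lborel) < \<infinity>"
proof -
  let ?N = "norm_D (poisson_extension \<phi>)"
  obtain D where D [measurable]: "D \<in> borel_measurable borel" "\<And>z. 0 \<le> D z"
    and DD: "\<And>z. norm z < 1 \<Longrightarrow> ?N z = D z"
    using norm_D_measurable_version by blast
  have le1: "energy z * w \<le> (2 * pi)\<^sup>2 * ((D z)\<^sup>2 * w + 0)" if "norm z < 1" "w \<ge> 0" for z w
    using mult_right_mono[OF norm_D_energy(1)[OF that(1)] that(2)] DD[OF that(1)] by (simp add: mult.assoc)
  have le2: "(D z)\<^sup>2 * w \<le> 2 / (2 * pi)\<^sup>2 * (energy z * w + 0)" if "norm z < 1" "w \<ge> 0" for z w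
    using mult_right_mono[OF norm_D_energy(2)[OF that(1)] that(2)] DD[OF that(1)]
    by (simp add: field_simps)
  have e: "(\<integral>\<^sup>+z\<in>ball 0 1. ennreal ((?N z)\<^sup>2 * ln (2 / (1 - norm z)) powr lam) \<partial>lborel)
     = (\<integral>\<^sup>+z\<in>ball 0 1. ennreal ((D z)\<^sup>2 * ln (2 / (1 - norm z)) powr lam) \<partial>lborel)"
    by (intro nn_integral_cong) (auto simp: indicator_def DD)
  have i1: "(\<integral>\<^sup>+z\<in>ball 0 1. ennreal (energy z * ln (2 / (1 - norm z)) powr lam) \<partial>lborel) < \<infinity>"
    if "(\<integral>\<^sup>+z\<in>ball 0 1. ennreal ((D z)\<^sup>2 * ln (2 / (1 - norm z)) powr lam) \<partial>lborel) < \<infinity>"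
    by (rule nn_integral_finite_comparison[OF _ le1 _ _ _ _ _ that]) auto
  have i2: "(\<integral>\<^sup>+z\<in>ball 0 1. ennreal ((D z)\<^sup>2 * ln (2 / (1 - norm z)) powr lam) \<partial>lborel) < \<infinity>"
    if "(\<integral>\<^sup>+z\<in>ball 0 1. ennreal (energy z * ln (2 / (1 - norm z)) powr lam) \<partial>lborel) < \<infinity>"
    by (rule nn_integral_finite_comparison[OF _ le2 _ _ _ _ _ that]) (auto simp: energy_nonneg)
  show ?thesis unfolding e by (rule iffI[OF i1 i2])
qed

definition circle_energy :: "real \<Rightarrow> real" where
  "circle_energy r = (LINT \<omega>|arc_length. energy (of_real r * \<omega>))"

lemma measurable_circle_energy [measurable]: "circle_energy \<in> borel_measurable borel"
  unfolding circle_energy_def by measurable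

lemma measurable_chord_energy [measurable]: "chord_energy \<in> borel_measurable borel"
  unfolding chord_energy_def chord_kernel_def by measurable

lemma circle_energy_nonneg: "0 \<le> circle_energy r"
  unfolding circle_energy_def by (intro integral_nonneg_AE AE_I2 energy_nonneg)

lemma energy_bound:
  assumes "norm z < 1"
  shows "energy z \<le> 2 * (2 * pi / (1 - norm z))\<^sup>2"
proof -
  have "norm (cauchy_transform \<psi> (\<lambda>\<eta>. \<eta>) z) \<le> 2 * pi / (1 - norm z)"
    "norm (cauchy_transform \<psi> cnj z) \<le> 2 * pi / (1 - norm z)"
    using assms by (auto intro!: cauchy_transform_bound)
  then have "(norm (cauchy_transform \<psi> (\<lambda>\<eta>. \<eta>) z))\<^sup>2 \<le> (2 * pi / (1 - norm z))\<^sup>2"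
    "(norm (cauchy_transform \<psi> cnj z))\<^sup>2 \<le> (2 * pi / (1 - norm z))\<^sup>2"
    by (auto intro!: power_mono)
  then show ?thesis by (simp add: energy_def)
qed

lemma energy_circle_bound:
  assumes "norm \<omega> = 1" "0 \<le> r" "r < 1"
  shows "energy (of_real r * \<omega>) \<le> 2 * (2 * pi / (1 - r))\<^sup>2"
  using energy_bound[of "of_real r * \<omega>"] assms by (simp add: norm_mult)

lemma integrable_energy_circle:
  assumes "0 \<le> r" "r < 1"
  shows "integrable arc_length (\<lambda>\<omega>. energy (of_real r * \<omega>))"
  by (rule integrable_bounded_arc_length[where C="2 * (2 * pi / (1 - r))\<^sup>2"])
    (use assms energy_circle_bound energy_nonneg in auto)

lemma circle_energy_bound:
  assumes "0 \<le> r" "r < 1"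
  shows "circle_energy r \<le> 2 * pi * (2 * (2 * pi / (1 - r))\<^sup>2)"
proof -
  have "circle_energy r \<le> (LINT \<omega>|arc_length. 2 * (2 * pi / (1 - r))\<^sup>2)"
    unfolding circle_energy_def using assms
    by (intro integral_mono integrable_energy_circle) (auto intro: energy_circle_bound)
  then show ?thesis by (simp add: measure_def emeasure_arc_length_space)
qed

lemma weighted_energy_polar:
  "(\<integral>\<^sup>+z\<in>ball 0 1. ennreal (energy z * ln (2 / (1 - norm z)) powr lam) \<partial>lborel)
   = (\<integral>\<^sup>+r\<in>{0<..<1}. ennreal (r * (ln (2 / (1 - r)) powr lam * circle_energy r)) \<partial>lborel)"
proof -
  let ?w = "\<lambda>r. ln (2 / (1 - r)) powr lam"
  let ?f = "\<lambda>r \<zeta>. ennreal (energy (of_real r * \<zeta>) * ln (2 / (1 - norm (of_real r * \<zeta>))) powr lam) * indicator (ball 0 1) (of_real r * \<zeta>)"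
  let ?g = "\<lambda>r \<zeta>. ennreal (energy (of_real r * \<zeta>))"
  have "(\<integral>\<^sup>+z\<in>ball 0 1. ennreal (energy z * ln (2 / (1 - norm z)) powr lam) \<partial>lborel)
    = (\<integral>\<^sup>+r. ennreal r * (\<integral>\<^sup>+\<zeta>. ?f r \<zeta> \<partial>arc_length) * indicator {0<..} r \<partial>lborel)"
    by (rule nn_integral_polar) measurable
  also have "\<dots> = (\<integral>\<^sup>+r\<in>{0<..<1}. ennreal (r * (?w r * circle_energy r)) \<partial>lborel)"
  proof (rule nn_integral_cong)
    fix r :: real
    show "ennreal r * (\<integral>\<^sup>+\<zeta>. ?f r \<zeta> \<partial>arc_length) * indicator {0<..} r
       = ennreal (r * (?w r * circle_energy r)) * indicator {0<..<1} r"
    proof (cases "0 < r")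
      case True
      have "(\<integral>\<^sup>+\<zeta>. ?f r \<zeta> \<partial>arc_length)
        = (\<integral>\<^sup>+\<zeta>. ?g r \<zeta> * (ennreal (?w r) * indicator {0<..<1} r) \<partial>arc_length)"
        using True energy_nonneg by (intro nn_integral_cong) (auto simp: norm_mult indicator_def ennreal_mult)
      also have "\<dots> = (\<integral>\<^sup>+\<zeta>. ?g r \<zeta> \<partial>arc_length) * (ennreal (?w r) * indicator {0<..<1} r)"
        by (rule nn_integral_multc) measurable
      finally have *: "(\<integral>\<^sup>+\<zeta>. ?f r \<zeta> \<partial>arc_length)
        = (\<integral>\<^sup>+\<zeta>. ?g r \<zeta> \<partial>arc_length) * (ennreal (?w r) * indicator {0<..<1} r)" .
      show ?thesis
      proof (cases "r < 1")
        case r1: True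
        have "(\<integral>\<^sup>+\<zeta>. ?g r \<zeta> \<partial>arc_length) = ennreal (circle_energy r)"
          unfolding circle_energy_def using True r1
          by (intro nn_integral_eq_integral integrable_energy_circle) (auto simp: energy_nonneg)
        then show ?thesis
          unfolding * using True r1 circle_energy_nonneg by (simp add: ennreal_mult mult_ac)
      qed (simp add: *)
    qed simp
  qed
  finally show ?thesis .
qed

lemma chord_energy_nonneg: "0 \<le> r \<Longrightarrow> r \<le> 1 \<Longrightarrow> 0 \<le> chord_energy r"
  unfolding chord_energy_def by (intro integral_nonneg_AE AE_I2 chord_kernel_nonneg)

lemma radial_log_weight_finite:
  "(\<integral>\<^sup>+r\<in>{0<..<1}. ennreal (ln (2 / (1 - r)) powr lam) \<partial>lborel) < \<infinity>"
proof -
  obtain C where C: "C \<ge> 0" "\<And>s. 0 < s \<Longrightarrow> s \<le> 1 \<Longrightarrow> ln (2 / s) powr lam \<le> C * s powr (- (1/2))"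
    using log_weight_bound[of "1/2" lam] by auto
  have "(\<integral>\<^sup>+r\<in>{0..<1}. ennreal ((1 - r) powr (- (1/2))) \<partial>lborel) < \<infinity>"
    by (rule nn_integral_radial_weight) simp
  then have "(\<integral>\<^sup>+r\<in>{0..<1}. ennreal (ln (2 / (1 - r)) powr lam) \<partial>lborel) < \<infinity>"
    by (rule nn_integral_finite_comparison[where e="\<lambda>x. 0", OF C(1), rotated 6]) (auto intro: C(2))
  moreover have "(\<integral>\<^sup>+r\<in>{0<..<1}. ennreal (ln (2 / (1 - r)) powr lam) \<partial>lborel)
     \<le> (\<integral>\<^sup>+r\<in>{0..<1}. ennreal (ln (2 / (1 - r)) powr lam) \<partial>lborel)"
    by (intro nn_integral_mono) (auto simp: indicator_def)
  ultimately show ?thesis by (rule le_less_trans[rotated])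
qed

text \<open>Bounded errors are harmless because the logarithmic weight is integrable up to radius 1.
  This absorbs both the additive constant from dropping the sign-changing factor and the radii below
  \<open>1/2\<close>.\<close>

lemma weighted_energy_iff_chord_energy:
  "(\<integral>\<^sup>+r\<in>{0<..<1}. ennreal (r * (ln (2 / (1 - r)) powr lam * circle_energy r)) \<partial>lborel) < \<infinity>
   \<longleftrightarrow> (\<integral>\<^sup>+r\<in>{1/2..<1}. ennreal (ln (2 / (1 - r)) powr lam * chord_energy r) \<partial>lborel) < \<infinity>"
   (is "?L < \<infinity> \<longleftrightarrow> ?R < \<infinity>")
proof -
  obtain C where C: "C \<ge> 0" "\<And>r. 0 < r \<Longrightarrow> r < 1 \<Longrightarrow> twisted_chord_energy r \<le> chord_energy r"
    "\<And>r. 0 < r \<Longrightarrow> r < 1 \<Longrightarrow> chord_energy r \<le> 2 * twisted_chord_energy r + C"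
    using twisted_chord_energy_comparison by blast
  let ?w = "\<lambda>r. ln (2 / (1 - r)) powr lam"
  have tw: "2 * pi * twisted_chord_energy r = r\<^sup>2 * circle_energy r" if "0 < r" "r < 1" for r
    using energy_circle[OF that] by (simp add: circle_energy_def)
  have w0: "?w r \<ge> 0" for r by simp
  have R_if: "?R < \<infinity>" if L: "?L < \<infinity>"
  proof -
    have L': "(\<integral>\<^sup>+r\<in>{1/2..<1}. ennreal (r * (?w r * circle_energy r)) \<partial>lborel) < \<infinity>"
      by (rule le_less_trans[OF _ L], intro nn_integral_mono) (auto simp: indicator_def)
    have W': "(\<integral>\<^sup>+r\<in>{1/2..<1}. ennreal (?w r) \<partial>lborel) < \<infinity>"
      by (rule le_less_trans[OF _ radial_log_weight_finite[of lam]], intro nn_integral_mono) (auto simp: indicator_def)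
    show ?thesis
    proof (rule nn_integral_finite_comparison[OF _ _ _ _ _ _ _ L' W', where C="1 + C"])
      fix r :: real assume r: "r \<in> {1/2..<1}"
      then have r': "0 < r" "r < 1" by auto
      have "r\<^sup>2 * circle_energy r \<le> r * circle_energy r"
        using r' circle_energy_nonneg by (intro mult_right_mono) (auto simp: power2_eq_square)
      \<comment> \<open>Discarding the factor \<open>pi\<close> needs a nonnegative twisted energy.
        Its integrand changes sign, but \<open>tw\<close> identifies it with a multiple of the
        circle energy.\<close>
      moreover have "1 * (2 * twisted_chord_energy r) \<le> pi * (2 * twisted_chord_energy r)"
      proof (rule mult_right_mono)
        have "0 \<le> 2 * pi * twisted_chord_energy r"
          unfolding tw[OF r'] by (simp add: circle_energy_nonneg)
        then show "0 \<le> 2 * twisted_chord_energy r" using pi_gt_zero by (auto simp: zero_le_mult_iff)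
      qed (use pi_gt3 in simp)
      ultimately have "chord_energy r \<le> r * circle_energy r + C"
        using C(3)[OF r'] tw[OF r'] by simp
      also have "\<dots> \<le> (1 + C) * (r * circle_energy r + 1)"
        using C(1) r' circle_energy_nonneg[of r] by (simp add: algebra_simps)
      finally have "?w r * chord_energy r \<le> ?w r * ((1 + C) * (r * circle_energy r + 1))"
        by (intro mult_left_mono) auto
      then show "?w r * chord_energy r \<le> (1 + C) * (r * (?w r * circle_energy r) + ?w r)"
        by (simp add: algebra_simps)
    qed (use C(1) circle_energy_nonneg in auto)
  qed
  have L_if: "?L < \<infinity>" if R: "?R < \<infinity>"
  proof -
    \<comment> \<open>Cutting \<open>?g\<close> off below \<open>1/2\<close> lets one comparison run
      over all of \<open>(0, 1)\<close>; there \<open>?K\<close>, the bound of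
      \<open>circle_energy_bound\<close> at radius \<open>1/2\<close>, takes over.\<close>
    let ?g = "\<lambda>r. ?w r * chord_energy r * indicator {1/2..<1} r"
    let ?K = "2 * pi * (2 * (2 * pi / (1 - 1/2))\<^sup>2)"
    have R': "(\<integral>\<^sup>+r\<in>{0<..<1}. ennreal (?g r) \<partial>lborel) < \<infinity>"
      by (rule le_less_trans[OF _ R], intro nn_integral_mono) (auto simp: indicator_def)
    show ?thesis
    proof (rule nn_integral_finite_comparison[OF _ _ _ _ _ _ _ R' radial_log_weight_finite[of lam], where C="4 * pi + ?K"])
      fix r :: real assume r: "r \<in> {0<..<1}"
      then have r': "0 < r" "r < 1" by auto
      have g0: "0 \<le> ?g r" using r chord_energy_nonneg by (auto simp: indicator_def)
      show "r * (?w r * circle_energy r) \<le> (4 * pi + ?K) * (?g r + ?w r)"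
      proof (cases "1/2 \<le> r")
        case True
        have "1/2 * circle_energy r \<le> r * circle_energy r"
          using True circle_energy_nonneg by (intro mult_right_mono) auto
        then have "r * (1/2 * circle_energy r) \<le> r * (r * circle_energy r)"
          using r' by (intro mult_left_mono) auto
        also have "\<dots> = 2 * pi * twisted_chord_energy r" using tw[OF r'] by (simp add: power2_eq_square)
        also have "\<dots> \<le> 2 * pi * chord_energy r" using C(2)[OF r'] by (intro mult_left_mono) auto
        finally have "r * circle_energy r \<le> 4 * pi * chord_energy r" by simp
        then have "?w r * (r * circle_energy r) \<le> ?w r * (4 * pi * chord_energy r)"
          by (intro mult_left_mono) auto
        also have "\<dots> = 4 * pi * ?g r" using True r' by simp
        also have "\<dots> \<le> (4 * pi + ?K) * (?g r + ?w r)"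
          using g0 by (intro mult_mono) auto
        finally show ?thesis by (simp add: mult_ac)
      next
        case False
        have "circle_energy r \<le> 2 * pi * (2 * (2 * pi / (1 - r))\<^sup>2)"
          using r' by (intro circle_energy_bound) auto
        also have "\<dots> \<le> ?K"
          using False by (intro mult_left_mono power_mono divide_left_mono) auto
        finally have "circle_energy r \<le> ?K" .
        then have "r * circle_energy r \<le> 1 * ?K"
          using r' circle_energy_nonneg by (intro mult_mono) auto
        then have "?w r * (r * circle_energy r) \<le> ?w r * ?K" by (intro mult_left_mono) auto
        also have "\<dots> \<le> (?g r + ?w r) * (4 * pi + ?K)"
          using g0 by (intro mult_mono) auto
        finally show ?thesis by (simp add: mult_ac)
      qed
    qed (use chord_energy_nonneg in \<open>auto simp: indicator_def\<close>)
  qed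
  show ?thesis using L_if R_if by blast
qed

lemma measurable_radial_kernel [measurable]: "radial_kernel lam \<in> borel_measurable borel"
  unfolding radial_kernel_def chord_kernel_def by measurable

lemma chord_energy_eq_nn_integral:
  assumes r: "0 < r" "r < 1"
  shows "ennreal (chord_energy r) = double_integral (\<lambda>d. ennreal (chord_kernel r d))"
proof -
  let ?P = "arc_length \<Otimes>\<^sub>M arc_length"
  let ?Q = "\<lambda>\<eta> \<xi>. chord_kernel r (norm (\<psi> \<eta> - \<psi> \<xi>))"
  have i1: "integrable (arc_length \<Otimes>\<^sub>M arc_length) (\<lambda>(\<eta>, \<xi>). ?Q \<eta> \<xi>)"
    using integrable_chord_kernel[OF r, of "\<lambda>_ _. 1"] by simp
  have Q0: "?Q \<eta> \<xi> \<ge> 0" for \<eta> \<xi> using r by (intro chord_kernel_nonneg) auto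
  have "chord_energy r = (LINT p|?P. (\<lambda>(\<eta>, \<xi>). ?Q \<eta> \<xi>) p)"
    unfolding chord_energy_def by (rule arc_pair.integral_fst[OF i1])
  also have "ennreal \<dots> = (\<integral>\<^sup>+p. ennreal ((\<lambda>(\<eta>, \<xi>). ?Q \<eta> \<xi>) p) \<partial>(arc_length \<Otimes>\<^sub>M arc_length))"
    by (rule nn_integral_eq_integral[symmetric, OF i1]) (auto simp: Q0)
  also have "\<dots> = (\<integral>\<^sup>+\<eta>. \<integral>\<^sup>+\<xi>. ennreal (?Q \<eta> \<xi>) \<partial>arc_length \<partial>arc_length)"
    using i1 by (subst arc_length.nn_integral_fst[symmetric]) auto
  finally show ?thesis by (simp add: double_integral_def norm_minus_commute)
qed

lemma chord_energy_tonelli: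
  "(\<integral>\<^sup>+r\<in>{1/2..<1}. ennreal (ln (2 / (1 - r)) powr lam * chord_energy r) \<partial>lborel)
   = double_integral (radial_kernel lam)"
proof -
  interpret L: pair_sigma_finite lborel arc_length ..
  let ?f = "\<lambda>r d. ennreal (ln (2 / (1 - r)) powr lam * chord_kernel r d) * indicator {1/2..<1} r"
  have [measurable]: "(\<lambda>(r, d). chord_kernel r d) \<in> borel_measurable (borel \<Otimes>\<^sub>M borel)"
    unfolding chord_kernel_def by measurable
  have "(\<integral>\<^sup>+r\<in>{1/2..<1}. ennreal (ln (2 / (1 - r)) powr lam * chord_energy r) \<partial>lborel)
      = (\<integral>\<^sup>+r. \<integral>\<^sup>+\<xi>. \<integral>\<^sup>+\<eta>. ?f r (norm (\<psi> \<eta> - \<psi> \<xi>)) \<partial>arc_length \<partial>arc_length \<partial>lborel)"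
  proof (rule nn_integral_cong)
    fix r :: real
    show "ennreal (ln (2 / (1 - r)) powr lam * chord_energy r) * indicator {1/2..<1} r
      = (\<integral>\<^sup>+\<xi>. \<integral>\<^sup>+\<eta>. ?f r (norm (\<psi> \<eta> - \<psi> \<xi>)) \<partial>arc_length \<partial>arc_length)"
    proof (cases "r \<in> {1/2..<1}")
      case True
      then have r: "0 < r" "r < 1" by auto
      have "ennreal (ln (2 / (1 - r)) powr lam * chord_energy r)
          = ennreal (ln (2 / (1 - r)) powr lam) * double_integral (\<lambda>d. ennreal (chord_kernel r d))"
        using r chord_energy_nonneg by (simp add: ennreal_mult chord_energy_eq_nn_integral)
      also have "\<dots> = (\<integral>\<^sup>+\<xi>. \<integral>\<^sup>+\<eta>. ennreal (ln (2 / (1 - r)) powr lam) * ennreal (chord_kernel r (norm (\<psi> \<eta> - \<psi> \<xi>))) \<partial>arc_length \<partial>arc_length)"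
        unfolding double_integral_def by (simp add: nn_integral_cmult)
      finally show ?thesis
        using True r by (simp add: ennreal_mult chord_kernel_nonneg)
    qed simp
  qed
  also have "\<dots> = (\<integral>\<^sup>+\<xi>. \<integral>\<^sup>+r. \<integral>\<^sup>+\<eta>. ?f r (norm (\<psi> \<eta> - \<psi> \<xi>)) \<partial>arc_length \<partial>lborel \<partial>arc_length)"
    by (rule L.Fubini'[symmetric]) measurable
  also have "\<dots> = (\<integral>\<^sup>+\<xi>. \<integral>\<^sup>+\<eta>. \<integral>\<^sup>+r. ?f r (norm (\<psi> \<eta> - \<psi> \<xi>)) \<partial>lborel \<partial>arc_length \<partial>arc_length)"
    by (intro nn_integral_cong L.Fubini'[symmetric]) measurable
  finally show ?thesis by (simp add: double_integral_def radial_kernel_def)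
qed

lemma radial_kernel_iff_log:
  assumes lam: "lam > -1"
  shows "double_integral (radial_kernel lam) < \<infinity>
     \<longleftrightarrow> double_integral (\<lambda>d. ennreal (\<bar>ln d\<bar> powr (lam + 1))) < \<infinity>"
proof
  assume "double_integral (radial_kernel lam) < \<infinity>"
  then show "double_integral (\<lambda>d. ennreal (\<bar>ln d\<bar> powr (lam + 1))) < \<infinity>"
    by (rule double_integral_finite_comparison[rotated 2]) (auto intro: radial_kernel_lower lam)
next
  assume fin: "double_integral (\<lambda>d. ennreal (\<bar>ln d\<bar> powr (lam + 1))) < \<infinity>"
  obtain C where C: "C \<ge> 0" "\<And>d. 0 < d \<Longrightarrow> d \<le> 2 \<Longrightarrow> radial_kernel lam d \<le> ennreal (C * (\<bar>ln d\<bar> powr (lam + 1) + 1))"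
    using radial_kernel_upper[OF lam] by blast
  show "double_integral (radial_kernel lam) < \<infinity>"
  proof (rule double_integral_finite_comparison[OF _ _ fin])
    fix d :: real assume "0 < d" "d \<le> 2"
    from C(2)[OF this] show "radial_kernel lam d \<le> ennreal C * (ennreal (\<bar>ln d\<bar> powr (lam + 1)) + 1)"
      using C(1) by (simp add: ennreal_mult ennreal_plus)
  qed measurable
qed

lemma weighted_energy_iff_log_distance:
  assumes "lam > -1"
  shows "(\<integral>\<^sup>+z\<in>ball 0 1. ennreal ((norm_D (poisson_extension \<phi>) z)\<^sup>2 * ln (2 / (1 - norm z)) powr lam) \<partial>lborel) < \<infinity>
   \<longleftrightarrow> double_integral (\<lambda>d. ennreal (\<bar>ln d\<bar> powr (lam + 1))) < \<infinity>"
  unfolding weighted_energy_iff weighted_energy_polar weighted_energy_iff_chord_energy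
    chord_energy_tonelli radial_kernel_iff_log[OF assms] ..

end

section \<open>Dyadic sums\<close>

text \<open>By the mean value theorem the increments of \<open>x powr (lam + 1)\<close> over unit
  steps are comparable to \<open>lam\<close>-th powers: the intermediate point is within a factor 2
  of the left endpoint. Telescoping does the rest.\<close>

lemma power_sum_comparison:
  fixes lam :: real
  assumes lam: "lam > -1"
  obtains c C where "c > 0" "C > 0"
    "\<And>J. real (Suc J) powr (lam + 1) - 1 \<le> c * (\<Sum>j<J. real (Suc j) powr lam)"
    "\<And>J. (\<Sum>j<J. real (Suc j) powr lam) \<le> C * real (Suc J) powr (lam + 1)"
proof -
  define p where "p = lam + 1"
  have p: "p > 0" using lam by (simp add: p_def)
  define K where "K = 1 powr lam + 2 powr lam"
  define K' where "K' = (1/2) powr lam + 1 powr lam"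
  have KK: "K > 0" "K' > 0" by (auto simp: K_def K'_def add_pos_pos)
  have step: "real (Suc (Suc j)) powr p - real (Suc j) powr p \<le> p * K * real (Suc j) powr lam
     \<and> p * real (Suc j) powr lam \<le> K' * (real (Suc (Suc j)) powr p - real (Suc j) powr p)" for j
  proof -
    have "\<exists>z>real (Suc j). z < real (Suc (Suc j)) \<and>
      real (Suc (Suc j)) powr p - real (Suc j) powr p = (real (Suc (Suc j)) - real (Suc j)) * (p * z powr (p - 1))"
      by (rule MVT2) (auto intro!: has_real_derivative_powr)
    then obtain z where z: "real (Suc j) < z" "z < real (Suc (Suc j))"
      "real (Suc (Suc j)) powr p - real (Suc j) powr p = p * z powr lam"
      by (auto simp: p_def)
    have "z powr lam \<le> K * real (Suc j) powr lam"
      unfolding K_def using z by (intro powr_comparable) auto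
    moreover have "real (Suc j) powr lam \<le> K' * z powr lam"
      unfolding K'_def using z by (intro powr_comparable) auto
    ultimately show ?thesis
      unfolding z(3) using p by (simp add: mult.assoc mult.left_commute[of K'])
  qed
  have tele: "(\<Sum>j<J. real (Suc (Suc j)) powr p - real (Suc j) powr p) = real (Suc J) powr p - 1" for J
    by (subst sum_lessThan_telescope) simp
  have "real (Suc J) powr p - 1 \<le> (p * K) * (\<Sum>j<J. real (Suc j) powr lam)" for J
    unfolding tele[symmetric] sum_distrib_left using step by (intro sum_mono) auto
  moreover have "(\<Sum>j<J. real (Suc j) powr lam) \<le> (K' / p) * real (Suc J) powr p" for J
  proof -
    have "p * (\<Sum>j<J. real (Suc j) powr lam) \<le> K' * (real (Suc J) powr p - 1)"
      unfolding tele[symmetric] sum_distrib_left using step by (intro sum_mono) auto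
    also have "\<dots> \<le> K' * real (Suc J) powr p" using KK by (intro mult_left_mono) auto
    finally show ?thesis using p by (simp add: field_simps)
  qed
  ultimately show thesis
    using that[of "p * K" "K' / p"] p KK unfolding p_def[symmetric] by simp
qed

text \<open>The scales start at 1, hence \<open>Suc j\<close>. The parameter \<open>c\<close> is 1
  or 8, according to whether closeness is to imply adjacent arcs or to follow from a common
  arc.\<close>

definition scale_sum :: "real \<Rightarrow> real \<Rightarrow> real \<Rightarrow> ennreal" where
  "scale_sum lam c d = (\<Sum>j. ennreal (real (Suc j) powr lam) * indicator {..c / 2 ^ Suc j} d)"

lemma measurable_scale_sum [measurable]: "scale_sum lam c \<in> borel_measurable borel"
  unfolding scale_sum_def by measurable

lemma log_le_scale_sum:
  fixes lam :: real
  assumes lam: "lam > -1"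
  obtains C where "\<And>d. 0 < d \<Longrightarrow> d \<le> 2 \<Longrightarrow> ennreal (\<bar>ln d\<bar> powr (lam + 1)) \<le> ennreal C * (scale_sum lam 1 d + 1)"
proof -
  let ?w = "\<lambda>j. ennreal (real (Suc j) powr lam)"
  define p where "p = lam + 1"
  have p: "p > 0" using lam by (simp add: p_def)
  obtain c where c: "c > 0" "\<And>J. real (Suc J) powr p - 1 \<le> c * (\<Sum>j<J. real (Suc j) powr lam)"
    using power_sum_comparison[OF lam] unfolding p_def by metis
  have l2: "ln 2 \<le> (1::real)" using ln_le_minus_one[of 2] by simp
  have "ennreal (\<bar>ln d\<bar> powr p) \<le> ennreal (c + 1) * (scale_sum lam 1 d + 1)" if d: "0 < d" "d \<le> 2" for d
  proof (cases "d \<le> 1/2")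
    case False
    have "ln d \<le> ln 2" "ln (1/2) \<le> ln d" using d False by (subst ln_le_cancel_iff; simp)+
    then have "\<bar>ln d\<bar> \<le> 1" using l2 by (auto simp: ln_div)
    then have "\<bar>ln d\<bar> powr p \<le> 1 powr p" using p by (intro powr_mono2) auto
    then have "ennreal (\<bar>ln d\<bar> powr p) \<le> ennreal ((c + 1) * 1)" using c(1) by (intro ennreal_leI) auto
    also have "\<dots> \<le> ennreal (c + 1) * (scale_sum lam 1 d + 1)"
      by (simp add: distrib_left)
    finally show ?thesis .
  next
    case True
    define x where "x = log 2 (1 / d)"
    have x: "2 powr x = 1 / d" using d by (simp add: x_def)
    have "log 2 2 \<le> x" unfolding x_def using d True by (subst log_le_cancel_iff) (auto simp: field_simps)
    then have x1: "1 \<le> x" by simp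
    \<comment> \<open>\<open>J\<close> counts the dyadic scales that are at least \<open>d\<close>;
      every index below \<open>J\<close> contributes its full weight.\<close>
    define J where "J = nat \<lfloor>x\<rfloor>"
    have J: "real J \<le> x" "x \<le> real (Suc J)" using x1 unfolding J_def by linarith+
    have "(\<Sum>j<J. ?w j) = (\<Sum>j<J. ?w j * indicator {..1 / 2 ^ Suc j} d)"
    proof (rule sum.cong[OF refl])
      fix j assume "j \<in> {..<J}"
      then have "real (Suc j) \<le> x" using J(1) by auto
      then have "2 powr real (Suc j) \<le> 2 powr x" by simp
      then have "2 ^ Suc j \<le> 1 / d" unfolding x by (simp only: powr_realpow zero_less_numeral)
      then have "d \<le> 1 / 2 ^ Suc j" using d by (simp add: field_simps)
      then show "?w j = ?w j * indicator {..1 / 2 ^ Suc j} d"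
        by simp
    qed
    also have "\<dots> \<le> scale_sum lam 1 d"
      unfolding scale_sum_def by (intro sum_le_suminf) auto
    finally have S: "ennreal (\<Sum>j<J. real (Suc j) powr lam) \<le> scale_sum lam 1 d"
      by (simp add: sum_ennreal)
    have "\<bar>ln d\<bar> = x * ln 2" using d True by (simp add: x_def log_def ln_div)
    also have "\<dots> \<le> x" using x1 l2 by (simp add: mult_left_le)
    finally have "\<bar>ln d\<bar> powr p \<le> real (Suc J) powr p" using J p by (intro powr_mono2) auto
    also have "\<dots> \<le> c * (\<Sum>j<J. real (Suc j) powr lam) + 1" using c(2)[of J] by simp
    also have "\<dots> \<le> (c + 1) * ((\<Sum>j<J. real (Suc j) powr lam) + 1)"
      using c(1) by (simp add: algebra_simps sum_nonneg)
    finally have "ennreal (\<bar>ln d\<bar> powr p) \<le> ennreal ((c + 1) * ((\<Sum>j<J. real (Suc j) powr lam) + 1))"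
      by (rule ennreal_leI)
    also have "\<dots> = ennreal (c + 1) * (ennreal (\<Sum>j<J. real (Suc j) powr lam) + 1)"
      using c(1) by (subst ennreal_mult) (auto simp: sum_nonneg ennreal_plus simp del: sum_ennreal)
    also have "\<dots> \<le> ennreal (c + 1) * (scale_sum lam 1 d + 1)"
      using S by (intro mult_left_mono add_right_mono) auto
    finally show ?thesis .
  qed
  then show thesis using that unfolding p_def by blast
qed

lemma scale_sum_le_log:
  fixes lam :: real
  assumes lam: "lam > -1"
  obtains C where "\<And>d. 0 < d \<Longrightarrow> d \<le> 2 \<Longrightarrow> scale_sum lam 8 d \<le> ennreal C * (ennreal (\<bar>ln d\<bar> powr (lam + 1)) + 1)"
proof -
  let ?w = "\<lambda>j. ennreal (real (Suc j) powr lam)"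
  define p where "p = lam + 1"
  have p: "p > 0" using lam by (simp add: p_def)
  obtain C where C: "C > 0" "\<And>J. (\<Sum>j<J. real (Suc j) powr lam) \<le> C * real (Suc J) powr p"
    using power_sum_comparison[OF lam] unfolding p_def by metis
  have "scale_sum lam 8 d \<le> ennreal (C * (4 powr p + 8 powr p)) * (ennreal (\<bar>ln d\<bar> powr p) + 1)"
    if d: "0 < d" "d \<le> 2" for d
  proof -
    define y where "y = log 2 (8 / d)"
    have y: "2 powr y = 8 / d" using d by (simp add: y_def)
    have "log 2 2 \<le> y" unfolding y_def using d by (subst log_le_cancel_iff) (auto simp: field_simps)
    then have y1: "1 \<le> y" by simp
    define J where "J = nat \<lfloor>y\<rfloor>"
    have J: "real J \<le> y" "y < real (Suc J)" using y1 unfolding J_def by linarith+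
    have "scale_sum lam 8 d = (\<Sum>j<J. ?w j * indicator {..8 / 2 ^ Suc j} d)"
      unfolding scale_sum_def
    proof (rule suminf_finite)
      fix j assume "j \<notin> {..<J}"
      then have "y < real (Suc j)" using J(2) by auto
      then have "2 powr y < 2 powr real (Suc j)" by simp
      then have "8 / d < 2 ^ Suc j" unfolding y by (simp only: powr_realpow zero_less_numeral)
      then have "8 / 2 ^ Suc j < d" using d by (simp add: field_simps)
      then show "?w j * indicator {..8 / 2 ^ Suc j} d = 0"
        by simp
    qed simp
    also have "\<dots> \<le> (\<Sum>j<J. ?w j)"
      by (intro sum_mono) (auto simp: indicator_def)
    also have "\<dots> = ennreal (\<Sum>j<J. real (Suc j) powr lam)" by (simp add: sum_ennreal)
    also have "\<dots> \<le> ennreal (C * ((4 powr p + 8 powr p) * (\<bar>ln d\<bar> powr p + 1)))"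
    proof (rule ennreal_leI, rule order_trans[OF C(2)], rule mult_left_mono)
      have "exp 1 \<le> (2::real) ^ 2" using exp_le by simp
      then have "1 \<le> ln ((2::real) ^ 2)" by (subst ln_ge_iff) auto
      then have l2: "1 / 2 \<le> ln (2::real)" by (subst (asm) ln_realpow) auto
      have "y = 3 - ln d / ln 2"
      proof -
        have "y = log 2 8 - log 2 d" unfolding y_def using d by (subst log_divide) auto
        moreover have "log 2 (8::real) = 3" using log_pow_cancel[of 2 3] by simp
        ultimately show ?thesis by (simp add: log_def)
      qed
      also have "\<dots> \<le> 3 + \<bar>ln d\<bar> / ln 2"
        using l2 divide_right_mono[of "- ln d" "\<bar>ln d\<bar>" "ln 2"] by simp
      also have "\<dots> \<le> 3 + \<bar>ln d\<bar> / (1 / 2)"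
        using l2 by (intro add_left_mono divide_left_mono) auto
      finally have "y \<le> 3 + 2 * \<bar>ln d\<bar>" by simp
      \<comment> \<open>\<open>Suc J\<close> is at most \<open>y + 1\<close>, hence at most
        \<open>4 + 2 * \<bar>ln d\<bar>\<close>; the maximum absorbs the 4.\<close>
      then have "real (Suc J) \<le> 4 * max \<bar>ln d\<bar> 2" using J(1) by (simp add: max_def)
      then have "real (Suc J) powr p \<le> (4 * max \<bar>ln d\<bar> 2) powr p"
        using p by (intro powr_mono2) auto
      also have "\<dots> \<le> 4 powr p * \<bar>ln d\<bar> powr p + 8 powr p"
        by (cases "\<bar>ln d\<bar> \<le> 2") (auto simp: max_def powr_mult)
      also have "\<dots> \<le> (4 powr p + 8 powr p) * (\<bar>ln d\<bar> powr p + 1)"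
        by (simp add: algebra_simps)
      finally show "real (Suc J) powr p \<le> (4 powr p + 8 powr p) * (\<bar>ln d\<bar> powr p + 1)" .
    qed (use C in auto)
    also have "\<dots> = ennreal (C * (4 powr p + 8 powr p)) * (ennreal (\<bar>ln d\<bar> powr p) + 1)"
      using C(1) by (simp add: mult.assoc[symmetric] ennreal_mult ennreal_plus)
    finally show ?thesis .
  qed
  then show thesis using that unfolding p_def by blast
qed

section \<open>Dyadic arcs and chordal distance\<close>

definition arc_index :: "nat \<Rightarrow> complex \<Rightarrow> nat" where
  "arc_index j \<zeta> = nat \<lfloor>Arg2pi \<zeta> * 2 ^ j / (2 * pi)\<rfloor> + 1"

text \<open>Without the right endpoint the arcs of one generation partition the circle, and a point
  lies in exactly the arc numbered by \<open>arc_index\<close>.\<close>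

definition half_arc :: "nat \<Rightarrow> nat \<Rightarrow> complex set" where
  "half_arc j k = cis ` {2 * pi * (real k - 1) / 2 ^ j..<2 * pi * real k / 2 ^ j}"

lemma cis_Arg2pi: "norm \<zeta> = 1 \<Longrightarrow> cis (Arg2pi \<zeta>) = \<zeta>"
  using Arg2pi_eq[of \<zeta>] by (simp add: cis_conv_exp)

lemma Arg2pi_cis: "0 \<le> t \<Longrightarrow> t < 2 * pi \<Longrightarrow> Arg2pi (cis t) = t"
  by (rule Arg2pi_unique[of 1]) (auto simp: cis_conv_exp)

lemma arc_index_range:
  "arc_index j \<zeta> \<in> {1..2 ^ j}"
proof -
  define u where "u = Arg2pi \<zeta> * 2 ^ j / (2 * pi)"
  have "0 \<le> Arg2pi \<zeta>" "Arg2pi \<zeta> < 2 * pi" using Arg2pi[of \<zeta>] by auto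
  then have u: "0 \<le> u" "u < 2 ^ j" by (auto simp: u_def field_simps)
  then have "\<lfloor>u\<rfloor> < 2 ^ j" by (simp add: floor_less_iff)
  then have "nat \<lfloor>u\<rfloor> < 2 ^ j" by (simp add: nat_less_iff u)
  then have "nat \<lfloor>u\<rfloor> + 1 \<le> 2 ^ j" by (simp only: Suc_eq_plus1[symmetric] Suc_le_eq)
  then show ?thesis unfolding arc_index_def u_def[symmetric] atLeastAtMost_iff using le_add2 by blast
qed

lemma half_arc_iff:
  assumes \<zeta>: "norm \<zeta> = 1" and k: "k \<in> {1..2 ^ j}"
  shows "\<zeta> \<in> half_arc j k \<longleftrightarrow> arc_index j \<zeta> = k"
proof
  assume "\<zeta> \<in> half_arc j k"
  then obtain t where t: "\<zeta> = cis t" "2 * pi * (real k - 1) / 2 ^ j \<le> t" "t < 2 * pi * real k / 2 ^ j"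
    by (auto simp: half_arc_def)
  have "real k \<le> 2 ^ j" using k by (metis atLeastAtMost_iff of_nat_le_iff of_nat_numeral of_nat_power)
  then have "2 * pi * real k / 2 ^ j \<le> 2 * pi" by (simp add: field_simps)
  moreover have "0 \<le> 2 * pi * (real k - 1) / 2 ^ j" using k by simp
  ultimately have "Arg2pi \<zeta> = t" unfolding t(1) using t by (intro Arg2pi_cis) auto
  moreover have "\<lfloor>t * 2 ^ j / (2 * pi)\<rfloor> = int k - 1"
    using t(2,3) by (intro floor_unique) (auto simp: field_simps)
  moreover have "nat (int k - 1) = k - 1" by (simp add: nat_diff_distrib)
  ultimately show "arc_index j \<zeta> = k" using k by (simp add: arc_index_def)
next
  assume "arc_index j \<zeta> = k"
  define u where "u = Arg2pi \<zeta> * 2 ^ j / (2 * pi)"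
  have "0 \<le> u" using Arg2pi[of \<zeta>] by (simp add: u_def)
  then have "real k - 1 \<le> u" "u < real k"
    using \<open>arc_index j \<zeta> = k\<close> unfolding arc_index_def u_def[symmetric] by linarith+
  then have "2 * pi * (real k - 1) / 2 ^ j \<le> Arg2pi \<zeta>" "Arg2pi \<zeta> < 2 * pi * real k / 2 ^ j"
    by (auto simp: u_def field_simps)
  then show "\<zeta> \<in> half_arc j k"
    unfolding half_arc_def using cis_Arg2pi[OF \<zeta>] by (intro image_eqI[of _ _ "Arg2pi \<zeta>"]) auto
qed

lemma norm_cis_diff: "norm (cis a - cis b) = 2 * \<bar>sin ((a - b) / 2)\<bar>"
proof -
  have "(norm (cis a - cis b))\<^sup>2 = (cos a - cos b)\<^sup>2 + (sin a - sin b)\<^sup>2"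
    by (simp add: cmod_power2)
  also have "\<dots> = 2 - 2 * cos (a - b)"
    unfolding cos_diff using sin_cos_squared_add3[of a] sin_cos_squared_add3[of b]
    by (simp add: power2_eq_square algebra_simps)
  also have "cos (a - b) = 1 - 2 * (sin ((a - b) / 2))\<^sup>2"
    by (metis cos_double_sin field_sum_of_halves mult_2)
  also have "2 - 2 * (1 - 2 * (sin ((a - b) / 2))\<^sup>2) = (2 * \<bar>sin ((a - b) / 2)\<bar>)\<^sup>2"
    by (simp add: power_mult_distrib)
  finally show ?thesis by (rule power2_eq_imp_eq) auto
qed

lemma sin_ge_half:
  assumes "0 \<le> x" "x \<le> pi / 2"
  shows "x / 2 \<le> sin x"
proof -
  have "\<bar>sin x - (\<Sum>m<3. sin_coeff m * x ^ m)\<bar> \<le> inverse (fact 3) * \<bar>x\<bar> ^ 3"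
    by (rule Maclaurin_sin_bound)
  moreover have "(\<Sum>m<3. sin_coeff m * x ^ m) = x"
    by (simp add: sin_coeff_def numeral_3_eq_3)
  ultimately have "\<bar>sin x - x\<bar> \<le> x ^ 3 / 6" using assms by (simp add: fact_numeral)
  then have "x - x ^ 3 / 6 \<le> sin x" by linarith
  moreover have "x ^ 3 / 6 \<le> x / 2"
  proof -
    have "x \<le> 1.6" using assms pi_less_4 pi_approx by simp
    then have "x * x \<le> 1.6 * 1.6" using assms by (intro mult_mono) auto
    then have "x * x * x \<le> 3 * x" using assms by (intro mult_right_mono) auto
    then show ?thesis by (simp add: power3_eq_cube)
  qed
  ultimately show ?thesis by linarith
qed

text \<open>A chord is at most the angle it spans, here at most \<open>2 * pi / 2 ^ j\<close>.
  Rounding \<open>2 * pi\<close> up to 8 gives the constant.\<close>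

lemma same_arc_close:
  assumes "norm x = 1" "norm y = 1" "arc_index j x = arc_index j y"
  shows "norm (x - y) \<le> 8 / 2 ^ j"
proof -
  let ?u = "Arg2pi x * 2 ^ j / (2 * pi)" and ?v = "Arg2pi y * 2 ^ j / (2 * pi)"
  have "0 \<le> ?u" "0 \<le> ?v" using Arg2pi by auto
  then have "\<bar>?u - ?v\<bar> \<le> 1" using assms(3) unfolding arc_index_def by linarith
  moreover have "\<bar>?u - ?v\<bar> = \<bar>Arg2pi x - Arg2pi y\<bar> * 2 ^ j / (2 * pi)"
    by (simp add: abs_mult flip: diff_divide_distrib left_diff_distrib)
  ultimately have "\<bar>Arg2pi x - Arg2pi y\<bar> * 2 ^ j \<le> 2 * pi" by simp
  also have "2 * pi \<le> 8" using pi_less_4 by simp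
  finally have D: "\<bar>Arg2pi x - Arg2pi y\<bar> \<le> 8 / 2 ^ j" by (simp add: field_simps)
  have "norm (x - y) = norm (cis (Arg2pi x) - cis (Arg2pi y))" using assms by (simp add: cis_Arg2pi)
  also have "\<dots> \<le> \<bar>Arg2pi x - Arg2pi y\<bar>"
    unfolding norm_cis_diff using abs_sin_x_le_abs_x[of "(Arg2pi x - Arg2pi y) / 2"] by simp
  finally show ?thesis using D by linarith
qed

text \<open>A chord of at most \<open>1 / 2 ^ j\<close> spans an angle of at most
  \<open>2 / 2 ^ j\<close>, less than one arc, so the indices agree or are cyclic neighbours. The
  last two candidates are the wrap-around between the first and the last arc.\<close>

lemma close_arcs_adjacent:
  assumes n: "norm x = 1" "norm y = 1" and d: "norm (x - y) \<le> 1 / 2 ^ j"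
  shows "arc_index j y \<in> {arc_index j x - 1, arc_index j x, arc_index j x + 1, arc_index j x + (2 ^ j - 1), arc_index j x - (2 ^ j - 1)}"
proof -
  define N :: nat where "N = 2 ^ j"
  have N: "real N = 2 ^ j" "N \<ge> 1" by (auto simp: N_def)
  define u where "u = Arg2pi x * 2 ^ j / (2 * pi)"
  define v where "v = Arg2pi y * 2 ^ j / (2 * pi)"
  have Arg: "0 \<le> Arg2pi x" "Arg2pi x < 2 * pi" "0 \<le> Arg2pi y" "Arg2pi y < 2 * pi"
    using Arg2pi by auto
  then have u: "0 \<le> u" "u < real N" and v: "0 \<le> v" "v < real N"
    by (auto simp: u_def v_def N field_simps)
  have ix: "arc_index j x = nat \<lfloor>u\<rfloor> + 1" and iy: "arc_index j y = nat \<lfloor>v\<rfloor> + 1"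
    by (auto simp: arc_index_def u_def v_def)
  define D where "D = \<bar>Arg2pi x - Arg2pi y\<bar>"
  have D: "0 \<le> D" "D < 2 * pi" using Arg by (auto simp: D_def)
  have uv: "\<bar>u - v\<bar> = D * 2 ^ j / (2 * pi)"
    by (simp add: u_def v_def D_def abs_mult flip: diff_divide_distrib left_diff_distrib)
  have "norm (x - y) = norm (cis (Arg2pi x) - cis (Arg2pi y))" using n by (simp add: cis_Arg2pi)
  also have "\<dots> = 2 * \<bar>sin (D / 2)\<bar>"
    unfolding norm_cis_diff D_def using sin_minus[of "(Arg2pi x - Arg2pi y) / 2"]
    by (cases "Arg2pi x \<ge> Arg2pi y") (simp_all add: minus_divide_left del: sin_minus)
  also have "\<bar>sin (D / 2)\<bar> = sin (D / 2)" using D by (simp add: sin_ge_zero)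
  finally have s: "sin (D / 2) \<le> 1 / (2 * 2 ^ j)" using d by simp
  show ?thesis
  proof (cases "D \<le> pi")
    case True
    then have "D / 2 / 2 \<le> sin (D / 2)" using D by (intro sin_ge_half) auto
    then have "D \<le> 4 * (1 / (2 * 2 ^ j))" using s by linarith
    then have "D * 2 ^ j \<le> 2" by (simp add: field_simps)
    also have "\<dots> < 2 * pi" using pi_gt3 by simp
    finally have "\<bar>u - v\<bar> < 1" unfolding uv by simp
    then have "\<lfloor>v\<rfloor> = \<lfloor>u\<rfloor> - 1 \<or> \<lfloor>v\<rfloor> = \<lfloor>u\<rfloor> \<or> \<lfloor>v\<rfloor> = \<lfloor>u\<rfloor> + 1" by linarith
    moreover have "0 \<le> \<lfloor>u\<rfloor>" "0 \<le> \<lfloor>v\<rfloor>" using u v by auto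
    ultimately have "nat \<lfloor>v\<rfloor> + 1 = nat \<lfloor>u\<rfloor> + 1 - 1 \<or> nat \<lfloor>v\<rfloor> + 1 = nat \<lfloor>u\<rfloor> + 1 \<or> nat \<lfloor>v\<rfloor> + 1 = nat \<lfloor>u\<rfloor> + 1 + 1"
      by arith
    then show ?thesis unfolding ix iy by blast
  next
    case False
    \<comment> \<open>The short way round passes through angle 0: \<open>2 * pi - D\<close> is less
      than one arc, which forces one of the points into the first arc and the other into the
      last.\<close>
    have "(pi - D / 2) / 2 \<le> sin (pi - D / 2)" using False D by (intro sin_ge_half) auto
    also have "\<dots> = sin (D / 2)" by simp
    finally have "4 * ((pi - D / 2) / 2) \<le> 4 * (1 / (2 * 2 ^ j))" using s by linarith
    also have "4 * ((pi - D / 2) / 2) = 2 * pi - D" by (simp add: field_simps)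
    finally have "2 * pi - D \<le> 4 * (1 / (2 * 2 ^ j))" .
    then have "(2 * pi - D) * 2 ^ j \<le> 2" by (simp add: field_simps)
    also have "\<dots> < 2 * pi" using pi_gt3 by simp
    finally have "2 * pi * (real N - 1) < D * 2 ^ j" by (simp add: N algebra_simps)
    then have far: "real N - 1 < \<bar>u - v\<bar>" unfolding uv by (simp add: field_simps)
    show ?thesis
    proof (cases "u \<ge> v")
      case True
      then have "\<lfloor>u\<rfloor> = int N - 1" "\<lfloor>v\<rfloor> = 0" using far u v N(2) by (auto intro!: floor_unique)
      then show ?thesis unfolding ix iy N_def[symmetric] using N(2) by auto
    next
      case False
      then have "\<lfloor>v\<rfloor> = int N - 1" "\<lfloor>u\<rfloor> = 0" using far u v N(2) by (auto intro!: floor_unique)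
      then show ?thesis unfolding ix iy N_def[symmetric] using N(2) by auto
    qed
  qed
qed

text \<open>For \<open>j \<ge> 1\<close> the arc is shorter than a full turn, so its right endpoint
  is not covered a second time and the set is a compact arc minus one point.\<close>

lemma half_arc_sets [measurable]:
  assumes j: "j \<ge> 1"
  shows "half_arc j k \<in> sets borel"
proof -
  let ?a = "2 * pi * (real k - 1) / 2 ^ j" and ?b = "2 * pi * real k / 2 ^ j"
  have "(2::real) ^ 1 \<le> 2 ^ j" using j by (intro power_increasing) auto
  then have "2 * pi / 2 ^ j \<le> 2 * pi / 2" by (intro divide_left_mono) auto
  then have ba: "?a < ?b" "?b - ?a < 2 * pi"
    using pi_gt_zero by (auto simp: field_simps)
  have "cis ?b \<notin> cis ` {?a..<?b}"
  proof
    assume "cis ?b \<in> cis ` {?a..<?b}"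
    then obtain t where t: "?a \<le> t" "t < ?b" "cis ?b = cis t" by auto
    then obtain n :: int where n: "?b = t + 2 * pi * n" unfolding cis_eq_iff by blast
    then have "0 < 2 * pi * real_of_int n" "2 * pi * real_of_int n < 2 * pi * 1"
      using t(1,2) ba(2) by linarith+
    then have "0 < real_of_int n" "real_of_int n < 1"
      using mult_less_cancel_left_pos[of "2 * pi" "real_of_int n" 1] by (auto simp: zero_less_mult_iff)
    then show False by simp
  qed
  moreover have "{?a..?b} = insert ?b {?a..<?b}" using ba by auto
  ultimately have "half_arc j k = cis ` {?a..?b} - {cis ?b}" unfolding half_arc_def by auto
  moreover have "closed (cis ` {?a..?b})"
    by (intro compact_imp_closed compact_continuous_image continuous_intros) auto
  ultimately show ?thesis by simp
qed

context circle_homeomorphism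
begin

text \<open>This is the image of \<open>half_arc j k\<close> under \<open>\<phi>\<close>, written as
  a preimage under \<open>\<psi>\<close> so that measurability follows from that of
  \<open>\<psi>\<close>.\<close>

definition arc_preimage :: "nat \<Rightarrow> nat \<Rightarrow> complex set" where
  "arc_preimage j k = {\<eta> \<in> sphere 0 1. \<psi> \<eta> \<in> half_arc j k}"

definition image_arc_length :: "nat \<Rightarrow> nat \<Rightarrow> real" where
  "image_arc_length j k = measure arc_length (\<phi> ` dyadic_arc j k)"

lemma arc_preimage_sets [measurable]: "j \<ge> 1 \<Longrightarrow> arc_preimage j k \<in> sets arc_length"
  using measurable_sets[OF measurable_psi half_arc_sets[of j k]]
  by (simp add: arc_preimage_def vimage_def Int_def conj_commute)

lemma measure_arc_preimage:
  assumes j: "j \<ge> 1"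
  shows "emeasure arc_length (arc_preimage j k) = ennreal (image_arc_length j k)"
proof -
  let ?a = "2 * pi * (real k - 1) / 2 ^ j" and ?b = "2 * pi * real k / 2 ^ j"
  have hom: "\<phi> ` sphere 0 1 = sphere 0 1" "\<And>x. norm x = 1 \<Longrightarrow> \<psi> (\<phi> x) = x" "\<And>x. norm x = 1 \<Longrightarrow> \<phi> (\<psi> x) = x"
    using homeo by (auto simp: homeomorphism_def)
  have "\<phi> ` half_arc j k = arc_preimage j k"
  proof (intro equalityI subsetI)
    fix \<eta> assume "\<eta> \<in> \<phi> ` half_arc j k"
    then obtain x where x: "x \<in> half_arc j k" "\<eta> = \<phi> x" by auto
    then have "norm x = 1" by (auto simp: half_arc_def)
    then show "\<eta> \<in> arc_preimage j k" using x hom by (auto simp: arc_preimage_def)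
  next
    fix \<eta> assume "\<eta> \<in> arc_preimage j k"
    then show "\<eta> \<in> \<phi> ` half_arc j k"
      using hom(3)[of \<eta>] by (intro image_eqI[of _ _ "\<psi> \<eta>"]) (auto simp: arc_preimage_def)
  qed
  moreover have "{?a..?b} = insert ?b {?a..<?b}"
    using pi_gt_zero by (auto simp: field_simps)
  ultimately have e: "\<phi> ` dyadic_arc j k = insert (\<phi> (cis ?b)) (arc_preimage j k)"
    unfolding dyadic_arc_def half_arc_def by auto
  have "norm (\<phi> (cis ?b)) = 1" using hom(1) by (metis imageI mem_sphere_0 norm_cis)
  then have null: "{\<phi> (cis ?b)} \<in> null_sets arc_length"
    by (auto simp: null_sets_def emeasure_arc_length_singleton sets_arc_length sets_restrict_space)
  have "emeasure arc_length (arc_preimage j k \<union> {\<phi> (cis ?b)}) = emeasure arc_length (arc_preimage j k)"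
    by (rule emeasure_Un_null_set[OF arc_preimage_sets[OF j] null])
  then show ?thesis
    unfolding image_arc_length_def e by (simp add: arc_length.emeasure_eq_measure)
qed

lemma image_arc_length_nonneg: "0 \<le> image_arc_length j k"
  by (simp add: image_arc_length_def)

lemma arc_preimage_iff:
  assumes "norm \<eta> = 1" "k \<in> {1..2 ^ j}"
  shows "\<eta> \<in> arc_preimage j k \<longleftrightarrow> arc_index j (\<psi> \<eta>) = k"
  using assms half_arc_iff[OF norm_psi[OF assms(1)] assms(2)] by (simp add: arc_preimage_def)

lemma double_integral_arc_products:
  assumes j: "j \<ge> 1" and P: "finite P"
  shows "(\<integral>\<^sup>+\<xi>. \<integral>\<^sup>+\<eta>. (\<Sum>(k, l)\<in>P. indicator (arc_preimage j k) \<eta> * indicator (arc_preimage j l) \<xi>) \<partial>arc_length \<partial>arc_length)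
     = ennreal (\<Sum>(k, l)\<in>P. image_arc_length j k * image_arc_length j l)"
proof -
  note [measurable] = arc_preimage_sets[OF j]
  have "(\<integral>\<^sup>+\<xi>. \<integral>\<^sup>+\<eta>. (\<Sum>(k, l)\<in>P. indicator (arc_preimage j k) \<eta> * indicator (arc_preimage j l) \<xi>) \<partial>arc_length \<partial>arc_length)
     = (\<Sum>(k, l)\<in>P. emeasure arc_length (arc_preimage j k) * emeasure arc_length (arc_preimage j l))"
    by (simp add: case_prod_unfold nn_integral_sum nn_integral_multc nn_integral_cmult)
  also have "\<dots> = ennreal (\<Sum>(k, l)\<in>P. image_arc_length j k * image_arc_length j l)"
    by (simp add: case_prod_unfold measure_arc_preimage[OF j] sum_ennreal ennreal_mult image_arc_length_nonneg flip: sum_ennreal)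
  finally show ?thesis .
qed

text \<open>The sum of squares is the measure of the pairs whose \<open>\<psi>\<close>-values share
  an arc, and such values are at distance at most \<open>8 / 2 ^ j\<close>.\<close>

lemma sum_squares_le_double_integral:
  assumes j: "j \<ge> 1"
  shows "ennreal (\<Sum>k=1..2 ^ j. (image_arc_length j k)\<^sup>2) \<le> double_integral (indicator {..8 / 2 ^ j})"
proof -
  let ?J = "arc_preimage j"
  define P where "P = (\<lambda>k. (k, k)) ` {1..2 ^ j :: nat}"
  have sP: "(\<Sum>(k, l)\<in>P. f k l) = (\<Sum>k=1..2 ^ j. f k k)" for f :: "nat \<Rightarrow> nat \<Rightarrow> 'a :: comm_monoid_add"
    unfolding P_def by (subst sum.reindex) (auto simp: inj_on_def)
  have "ennreal (\<Sum>k=1..2 ^ j. (image_arc_length j k)\<^sup>2) = ennreal (\<Sum>(k, l)\<in>P. image_arc_length j k * image_arc_length j l)"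
    by (simp add: sP power2_eq_square)
  also have "\<dots> = (\<integral>\<^sup>+\<xi>. \<integral>\<^sup>+\<eta>. (\<Sum>(k, l)\<in>P. indicator (?J k) \<eta> * indicator (?J l) \<xi>) \<partial>arc_length \<partial>arc_length)"
    by (rule double_integral_arc_products[symmetric, OF j]) (simp add: P_def)
  also have "\<dots> \<le> double_integral (indicator {..8 / 2 ^ j})"
    unfolding double_integral_def
  proof (intro nn_integral_mono)
    fix \<xi> \<eta> assume "\<xi> \<in> space arc_length" "\<eta> \<in> space arc_length"
    then have n: "norm \<xi> = 1" "norm \<eta> = 1" by auto
    have "(\<Sum>(k, l)\<in>P. indicator (?J k) \<eta> * indicator (?J l) \<xi> :: ennreal)
        = (\<Sum>k=1..2 ^ j. if arc_index j (\<psi> \<eta>) = k then (if arc_index j (\<psi> \<eta>) = arc_index j (\<psi> \<xi>) then 1 else 0) else 0)"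
      unfolding sP using n by (intro sum.cong) (auto simp: indicator_def arc_preimage_iff)
    also have "\<dots> = (if arc_index j (\<psi> \<eta>) = arc_index j (\<psi> \<xi>) then 1 else 0)"
      using arc_index_range[of j "\<psi> \<eta>"] by (subst sum.delta') auto
    also have "\<dots> \<le> indicator {..8 / 2 ^ j} (norm (\<psi> \<eta> - \<psi> \<xi>))"
      using same_arc_close[of "\<psi> \<eta>" "\<psi> \<xi>" j] n norm_psi by auto
    finally show "(\<Sum>(k, l)\<in>P. indicator (?J k) \<eta> * indicator (?J l) \<xi> :: ennreal)
        \<le> indicator {..8 / 2 ^ j} (norm (\<psi> \<eta> - \<psi> \<xi>))" .
  qed
  finally show ?thesis .
qed

end

context circle_homeomorphism
begin

text \<open>Close pairs lie in equal or neighbouring arcs. The product of two arc lengths is at most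
  half the sum of their squares, each arc has at most five candidate neighbours, and the relation is
  symmetric, so both halves give the same sum.\<close>

lemma double_integral_le_sum_squares:
  assumes j: "j \<ge> 1"
  shows "double_integral (indicator {..1 / 2 ^ j}) \<le> ennreal (5 * (\<Sum>k=1..2 ^ j. (image_arc_length j k)\<^sup>2))"
proof -
  let ?J = "arc_preimage j"
  define I where "I = {1..2 ^ j :: nat}"
  define N :: nat where "N = 2 ^ j"
  define nb where "nb k = set [k - 1, k, k + 1, k + (N - 1), k - (N - 1)]" for k :: nat
  define P where "P = {(k, l) \<in> I \<times> I. l \<in> nb k}"
  have finI: "finite I" by (simp add: I_def)
  have "P \<subseteq> I \<times> I" unfolding P_def by blast
  then have finP: "finite P" using finI by (meson finite_SigmaI finite_subset)
  note fin = finI finP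
  have card_nb: "card (nb k) \<le> 5" for k
    using card_length[of "[k - 1, k, k + 1, k + (N - 1), k - (N - 1)]"] unfolding nb_def by simp
  \<comment> \<open>Truncated subtraction loses information only when it yields 0, and both indices
    are at least 1.\<close>
  have nb_sym: "k \<in> nb l" if "(k, l) \<in> P" for k l
  proof -
    have kl: "1 \<le> k" "1 \<le> l" "l = k - 1 \<or> l = k \<or> l = k + 1 \<or> l = k + (N - 1) \<or> l = k - (N - 1)"
      using that by (auto simp: P_def I_def nb_def)
    from kl(3) consider "k = l + 1" | "k = l" | "k = l - 1" | "k = l - (N - 1)" | "k = l + (N - 1)"
    proof (elim disjE)
      assume "l = k - 1" then have "k = l + 1" using kl(1) by simp
      then show thesis by (rule that(1))
    next
      assume "l = k - (N - 1)" then have "k = l + (N - 1)" using kl(2) by simp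
      then show thesis by (rule that(5))
    qed (use that in simp_all)
    then show ?thesis unfolding nb_def by cases simp_all
  qed
  define m where "m = image_arc_length j"
  have row: "(\<Sum>(k, l)\<in>P. (m k)\<^sup>2) \<le> 5 * (\<Sum>k\<in>I. (m k)\<^sup>2)"
  proof -
    have P: "P = Sigma I (\<lambda>k. nb k \<inter> I)" by (auto simp: P_def)
    have "(\<Sum>(k, l)\<in>P. (m k)\<^sup>2) = (\<Sum>k\<in>I. \<Sum>l\<in>nb k \<inter> I. (m k)\<^sup>2)"
      unfolding P using finI by (intro sum.Sigma[symmetric]) auto
    also have "\<dots> \<le> (\<Sum>k\<in>I. 5 * (m k)\<^sup>2)"
    proof (rule sum_mono)
      fix k
      have "card (nb k \<inter> I) \<le> card (nb k)" by (intro card_mono) (auto simp: nb_def)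
      then have "real (card (nb k \<inter> I)) \<le> 5" using card_nb[of k] by linarith
      then show "(\<Sum>l\<in>nb k \<inter> I. (m k)\<^sup>2) \<le> 5 * (m k)\<^sup>2" by (simp add: mult_right_mono)
    qed
    finally show ?thesis by (simp add: sum_distrib_left)
  qed
  have swap_P: "(l, k) \<in> P" if "(k, l) \<in> P" for k l
    using that nb_sym[OF that] unfolding P_def by blast
  have swap: "(\<Sum>(k, l)\<in>P. (m l)\<^sup>2) = (\<Sum>(k, l)\<in>P. (m k)\<^sup>2)"
    by (rule sum.reindex_bij_witness[where i=prod.swap and j=prod.swap]) (auto intro: swap_P)
  have "(\<Sum>(k, l)\<in>P. m k * m l) \<le> (\<Sum>(k, l)\<in>P. ((m k)\<^sup>2 + (m l)\<^sup>2) / 2)"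
  proof (intro sum_mono, clarify)
    fix k l
    show "m k * m l \<le> ((m k)\<^sup>2 + (m l)\<^sup>2) / 2"
      using sum_squares_ge_zero[of "m k - m l" 0] by (simp add: power2_eq_square algebra_simps)
  qed
  also have "\<dots> = ((\<Sum>(k, l)\<in>P. (m k)\<^sup>2) + (\<Sum>(k, l)\<in>P. (m l)\<^sup>2)) / 2"
    by (simp add: case_prod_unfold sum.distrib flip: sum_divide_distrib)
  also have "\<dots> \<le> 5 * (\<Sum>k\<in>I. (m k)\<^sup>2)" unfolding swap using row by simp
  finally have le: "(\<Sum>(k, l)\<in>P. m k * m l) \<le> 5 * (\<Sum>k\<in>I. (m k)\<^sup>2)" .
  have "double_integral (indicator {..1 / 2 ^ j})
     \<le> (\<integral>\<^sup>+\<xi>. \<integral>\<^sup>+\<eta>. (\<Sum>(k, l)\<in>P. indicator (?J k) \<eta> * indicator (?J l) \<xi>) \<partial>arc_length \<partial>arc_length)"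
    unfolding double_integral_def
  proof (intro nn_integral_mono)
    fix \<xi> \<eta> assume "\<xi> \<in> space arc_length" "\<eta> \<in> space arc_length"
    then have n: "norm \<xi> = 1" "norm \<eta> = 1" by auto
    show "indicator {..1 / 2 ^ j} (norm (\<psi> \<eta> - \<psi> \<xi>))
       \<le> (\<Sum>(k, l)\<in>P. indicator (?J k) \<eta> * indicator (?J l) \<xi> :: ennreal)"
    proof (cases "norm (\<psi> \<eta> - \<psi> \<xi>) \<le> 1 / 2 ^ j")
      case True
      let ?k = "arc_index j (\<psi> \<eta>)" and ?l = "arc_index j (\<psi> \<xi>)"
      have "(?k, ?l) \<in> P"
        using close_arcs_adjacent[OF norm_psi[OF n(2)] norm_psi[OF n(1)] True] arc_index_range
        by (simp add: P_def nb_def I_def N_def)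
      then have "(\<lambda>(k, l). indicator (?J k) \<eta> * indicator (?J l) \<xi> :: ennreal) (?k, ?l)
          \<le> (\<Sum>(k, l)\<in>P. indicator (?J k) \<eta> * indicator (?J l) \<xi> :: ennreal)"
        using fin by (intro member_le_sum) auto
      moreover have "\<eta> \<in> ?J ?k" "\<xi> \<in> ?J ?l"
        using n arc_preimage_iff[OF _ arc_index_range] by auto
      ultimately show ?thesis using True by simp
    qed simp
  qed
  also have "\<dots> = ennreal (\<Sum>(k, l)\<in>P. m k * m l)"
    unfolding m_def by (rule double_integral_arc_products[OF j fin(2)])
  also have "\<dots> \<le> ennreal (5 * (\<Sum>k\<in>I. (m k)\<^sup>2))" using le by (rule ennreal_leI)
  finally show ?thesis by (simp add: m_def I_def)
qed

end

context circle_homeomorphism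
begin

lemma double_integral_scale_sum:
  "double_integral (scale_sum lam c) = (\<Sum>j. ennreal (real (Suc j) powr lam) * double_integral (indicator {..c / 2 ^ Suc j}))"
  unfolding double_integral_def scale_sum_def
  by (simp add: nn_integral_suminf nn_integral_cmult)

text \<open>Up to constants and bounded terms the chain closes: the logarithm is below
  \<open>scale_sum lam 1\<close>, whose integral is below the dyadic sum; this is below the integral
  of \<open>scale_sum lam 8\<close>, which is again below that of the logarithm.\<close>

lemma dyadic_sum_iff_log_distance:
  assumes lam: "lam > -1"
  shows "(\<lambda>j::nat. real j powr lam * (\<Sum>k=1..2^j. (image_arc_length j k)\<^sup>2)) summable_on {1..}
     \<longleftrightarrow> double_integral (\<lambda>d. ennreal (\<bar>ln d\<bar> powr (lam + 1))) < \<infinity>"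
proof -
  let ?w = "\<lambda>j. ennreal (real (Suc j) powr lam)"
  define S where "S j = (\<Sum>k=1..2^j. (image_arc_length j k)\<^sup>2)" for j
  have S0: "S j \<ge> 0" for j by (simp add: S_def sum_nonneg)
  have "(\<lambda>j::nat. real j powr lam * S j) summable_on {1..} \<longleftrightarrow> (\<lambda>j::nat. real j powr lam * S j) summable_on (Suc ` UNIV)"
  proof -
    have "k \<in> range Suc" if "1 \<le> k" for k
      using that by (cases k) auto
    then have "range Suc = {1..}" by auto
    then show ?thesis by simp
  qed
  also have "\<dots> \<longleftrightarrow> (\<lambda>j. real (Suc j) powr lam * S (Suc j)) summable_on UNIV"
    by (subst summable_on_reindex) (auto simp: o_def)
  also have "\<dots> \<longleftrightarrow> summable (\<lambda>j. real (Suc j) powr lam * S (Suc j))"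
    by (rule summable_on_UNIV_nonneg_real_iff) (simp add: S0)
  also have "\<dots> \<longleftrightarrow> (\<Sum>j. ennreal (real (Suc j) powr lam * S (Suc j))) < \<infinity>"
  proof
    let ?f = "\<lambda>j. real (Suc j) powr lam * S (Suc j)"
    have nn: "0 \<le> ?f j" for j by (intro mult_nonneg_nonneg S0) simp
    show "(\<Sum>j. ennreal (?f j)) < \<infinity>" if "summable ?f"
      using ennreal_suminf_neq_top[OF that nn] by (simp only: infinity_ennreal_def less_top)
    show "summable ?f" if "(\<Sum>j. ennreal (?f j)) < \<infinity>"
      using that by (intro summable_suminf_not_top nn) (simp only: infinity_ennreal_def less_top)
  qed
  also have "\<dots> \<longleftrightarrow> (\<Sum>j. ?w j * ennreal (S (Suc j))) < \<infinity>"
    by (simp add: ennreal_mult S0)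
  also have "\<dots> \<longleftrightarrow> double_integral (\<lambda>d. ennreal (\<bar>ln d\<bar> powr (lam + 1))) < \<infinity>"
  proof
    assume fin: "(\<Sum>j. ?w j * ennreal (S (Suc j))) < \<infinity>"
    have "double_integral (scale_sum lam 1) \<le> (\<Sum>j. ennreal 5 * (?w j * ennreal (S (Suc j))))"
      unfolding double_integral_scale_sum
    proof (rule suminf_le)
      fix j
      have "double_integral (indicator {..1 / 2 ^ Suc j}) \<le> ennreal 5 * ennreal (S (Suc j))"
        using double_integral_le_sum_squares[of "Suc j"] S0 unfolding S_def[symmetric] by (simp add: ennreal_mult)
      then have "?w j * double_integral (indicator {..1 / 2 ^ Suc j})
         \<le> ?w j * (ennreal 5 * ennreal (S (Suc j)))"
        by (intro mult_left_mono) auto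
      then show "?w j * double_integral (indicator {..1 / 2 ^ Suc j})
         \<le> ennreal 5 * (?w j * ennreal (S (Suc j)))"
        by (simp only: mult_ac)
    qed auto
    also have "\<dots> = ennreal 5 * (\<Sum>j. ?w j * ennreal (S (Suc j)))"
      by (rule ennreal_suminf_cmult)
    also have "\<dots> < \<infinity>" using fin by (simp add: ennreal_mult_less_top)
    finally have fin': "double_integral (scale_sum lam 1) < \<infinity>" .
    obtain C where "\<And>d. 0 < d \<Longrightarrow> d \<le> 2 \<Longrightarrow> ennreal (\<bar>ln d\<bar> powr (lam + 1)) \<le> ennreal C * (scale_sum lam 1 d + 1)"
      using log_le_scale_sum[OF lam] by blast
    then show "double_integral (\<lambda>d. ennreal (\<bar>ln d\<bar> powr (lam + 1))) < \<infinity>"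
      by (rule double_integral_finite_comparison) (auto simp: fin'[simplified])
  next
    assume fin: "double_integral (\<lambda>d. ennreal (\<bar>ln d\<bar> powr (lam + 1))) < \<infinity>"
    obtain C where C: "\<And>d. 0 < d \<Longrightarrow> d \<le> 2 \<Longrightarrow> scale_sum lam 8 d \<le> ennreal C * (ennreal (\<bar>ln d\<bar> powr (lam + 1)) + 1)"
      using scale_sum_le_log[OF lam] by blast
    have "double_integral (scale_sum lam 8) < \<infinity>"
      by (rule double_integral_finite_comparison[OF C _ fin]) auto
    moreover have "(\<Sum>j. ?w j * ennreal (S (Suc j))) \<le> double_integral (scale_sum lam 8)"
      unfolding double_integral_scale_sum S_def
      by (intro suminf_le mult_left_mono sum_squares_le_double_integral) auto
    ultimately show "(\<Sum>j. ?w j * ennreal (S (Suc j))) < \<infinity>"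
      by (rule le_less_trans[rotated])
  qed
  finally show ?thesis by (simp add: S_def)
qed

end

section \<open>Exchange of logarithms for relative arc lengths\<close>

lemma summable_on_geometric_tail:
  fixes q :: real
  assumes "0 \<le> q" "q < 1"
  shows "(\<lambda>j::nat. q ^ j) summable_on {1..}"
proof -
  have "(\<lambda>j::nat. q ^ j) summable_on UNIV"
    using assms by (subst summable_on_UNIV_nonneg_real_iff) (auto intro: summable_geometric)
  then show ?thesis by (rule summable_on_subset_banach) auto
qed

context circle_homeomorphism
begin

lemma image_arc_length_le: "image_arc_length j k \<le> 2 * pi"
proof -
  have "measure arc_length (\<phi> ` dyadic_arc j k) \<le> measure arc_length (space arc_length)"
    by (rule arc_length.bounded_measure)
  then show ?thesis
    by (simp add: image_arc_length_def measure_def emeasure_arc_length_space)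
qed

text \<open>The pointwise exchange is applied with \<open>s = 2 powr (- j)\<close> and
  \<open>x\<close> the relative arc length, then multiplied by the square of \<open>s\<close>. The
  bound \<open>2 * pi\<close> on arc lengths provides \<open>K\<close>.\<close>

lemma dyadic_sums_comparable:
  "(\<lambda>j::nat. real j powr lam * (\<Sum>k=1..2^j. (image_arc_length j k)\<^sup>2)) summable_on {1..}
   \<longleftrightarrow> (\<lambda>j::nat. \<Sum>k=1..2^j. (image_arc_length j k)\<^sup>2 * ln (exp 1 + image_arc_length j k / 2 powr (- real j)) powr lam) summable_on {1..}"
   (is "?W summable_on _ \<longleftrightarrow> ?V summable_on _")
proof -
  let ?a = "image_arc_length"
  obtain C where C: "C \<ge> 0"
    "\<And>s x. 0 < s \<Longrightarrow> s \<le> 1 \<Longrightarrow> 0 \<le> x \<Longrightarrow> x \<le> (2 * pi) / s \<Longrightarrow>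
      x\<^sup>2 * ln (exp 1 + x) powr lam \<le> C * (x\<^sup>2 * ln (2 / s) powr lam + s powr (- 3 / 4))"
    "\<And>s x. 0 < s \<Longrightarrow> s \<le> 1 \<Longrightarrow> 0 \<le> x \<Longrightarrow> x \<le> (2 * pi) / s \<Longrightarrow>
      x\<^sup>2 * ln (2 / s) powr lam \<le> C * (x\<^sup>2 * ln (exp 1 + x) powr lam + s powr (- 3 / 4))"
    using log_weights_comparable[of "2 * pi" lam] by auto
  define s where "s j = 2 powr (- real j)" for j :: nat
  define q where "q = 2 powr (- 1 / 4 :: real)"
  define L where "L j = ln (2 / s j)" for j
  define l where "l j k = ln (exp 1 + ?a j k / s j)" for j k
  define D where "D = ln 2 powr lam + (2 * ln 2) powr lam"
  define D' where "D' = (1 / (2 * ln 2)) powr lam + (1 / ln 2) powr lam"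
  have D0: "D \<ge> 0" "D' \<ge> 0" by (auto simp: D_def D'_def)
  have s: "0 < s j" "s j \<le> 1" for j
    using powr_mono[of "- real j" 0 2] by (auto simp: s_def)
  have q: "0 \<le> q" "q < 1" unfolding q_def using powr_less_mono[of "-1/4" 0 2] by auto
  have q_summable: "(\<lambda>j::nat. q ^ j) summable_on {1..}"
    by (rule summable_on_geometric_tail[OF q])
  \<comment> \<open>The error of one generation: \<open>2 ^ j\<close> arcs, each with error of order
    \<open>2 powr (- 5/4 * j)\<close>, leave the ratio \<open>2 powr (- 1/4)\<close> of a convergent
    geometric series.\<close>
  have sq: "2 ^ j * ((s j)\<^sup>2 * s j powr (- 3 / 4)) = q ^ j" for j
  proof -
    have "2 ^ j = (2::real) powr real j" by (simp add: powr_realpow)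
    moreover have "q ^ j = 2 powr (- 1 / 4 * real j)" by (simp add: q_def powr_powr flip: powr_realpow)
    moreover have "(s j)\<^sup>2 = 2 powr (- 2 * real j)"
      by (simp add: s_def power2_eq_square flip: powr_add)
    moreover have "s j powr (- 3 / 4) = 2 powr (3 / 4 * real j)" by (simp add: s_def powr_powr mult.commute)
    ultimately show ?thesis by (simp flip: powr_add)
  qed
  have Lj: "L j = (real j + 1) * ln 2" for j
  proof -
    have "2 / s j = 2 powr (1 + real j)" unfolding s_def by (simp only: powr_minus powr_add) (simp add: field_simps)
    then show ?thesis unfolding L_def by (simp add: ln_powr)
  qed
  \<comment> \<open>\<open>L j\<close> is \<open>(j + 1) * ln 2\<close>, which lies between
    \<open>ln 2 * j\<close> and twice that as soon as \<open>j \<ge> 1\<close>.\<close>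
  have LD: "L j powr lam \<le> D * real j powr lam" "real j powr lam \<le> D' * L j powr lam" if "j \<ge> 1" for j
  proof -
    have j: "1 \<le> real j" using that by simp
    have l2: "ln 2 > (0::real)" by simp
    have "ln 2 * 1 \<le> ln 2 * real j" using j by (intro mult_left_mono) auto
    then have "ln 2 * real j \<le> L j" "L j \<le> (2 * ln 2) * real j" unfolding Lj by (auto simp: algebra_simps)
    moreover from this have "1 / (2 * ln 2) * L j \<le> real j" "real j \<le> 1 / ln 2 * L j"
      using l2 by (auto simp: field_simps)
    moreover have "L j > 0" unfolding Lj using j by simp
    ultimately show "L j powr lam \<le> D * real j powr lam" "real j powr lam \<le> D' * L j powr lam"
      unfolding D_def D'_def using j by (auto intro!: powr_comparable)
  qed
  have pt: "(?a j k)\<^sup>2 * l j k powr lam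
        \<le> C * ((?a j k)\<^sup>2 * L j powr lam + (s j)\<^sup>2 * s j powr (- 3 / 4))
      \<and> (?a j k)\<^sup>2 * L j powr lam
        \<le> C * ((?a j k)\<^sup>2 * l j k powr lam + (s j)\<^sup>2 * s j powr (- 3 / 4))" for j k
  proof -
    define x where "x = ?a j k / s j"
    have x: "0 \<le> x" "x \<le> (2 * pi) / s j"
      using s[of j] image_arc_length_le image_arc_length_nonneg by (auto simp: x_def divide_right_mono)
    have e: "(?a j k)\<^sup>2 = (s j)\<^sup>2 * x\<^sup>2" using s(1)[of j] by (simp add: x_def power_divide)
    have "(s j)\<^sup>2 * (x\<^sup>2 * l j k powr lam) \<le> (s j)\<^sup>2 * (C * (x\<^sup>2 * L j powr lam + s j powr (- 3 / 4)))"
      using C(2)[OF s x] unfolding l_def L_def x_def by (intro mult_left_mono) auto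
    moreover have "(s j)\<^sup>2 * (x\<^sup>2 * L j powr lam) \<le> (s j)\<^sup>2 * (C * (x\<^sup>2 * l j k powr lam + s j powr (- 3 / 4)))"
      using C(3)[OF s x] unfolding l_def L_def x_def by (intro mult_left_mono) auto
    ultimately show ?thesis unfolding e by (simp add: algebra_simps)
  qed
  have V_eq: "?V j = (\<Sum>k=1..2^j. (?a j k)\<^sup>2 * l j k powr lam)" for j
    by (simp add: l_def s_def)
  have V_le: "?V j \<le> (C * D) * ?W j + C * q ^ j" if j: "j \<ge> 1" for j
  proof -
    have "?V j \<le> (\<Sum>k=1..2^j. C * ((?a j k)\<^sup>2 * L j powr lam + (s j)\<^sup>2 * s j powr (- 3 / 4)))"
      unfolding V_eq using pt by (intro sum_mono) auto
    also have "\<dots> = C * (L j powr lam * (\<Sum>k=1..2^j. (?a j k)\<^sup>2)) + C * (2 ^ j * ((s j)\<^sup>2 * s j powr (- 3 / 4)))"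
      by (simp add: sum_distrib_left sum.distrib algebra_simps)
    also have "\<dots> \<le> C * (D * real j powr lam * (\<Sum>k=1..2^j. (?a j k)\<^sup>2)) + C * q ^ j"
      unfolding sq using LD(1)[OF j] C(1) by (intro add_right_mono mult_left_mono mult_right_mono sum_nonneg) auto
    finally show ?thesis by (simp add: mult_ac)
  qed
  have W_le: "?W j \<le> (D' * C) * ?V j + (D' * C) * q ^ j" if j: "j \<ge> 1" for j
  proof -
    have "?W j \<le> (D' * L j powr lam) * (\<Sum>k=1..2^j. (?a j k)\<^sup>2)"
      using LD(2)[OF j] by (intro mult_right_mono sum_nonneg) auto
    also have "\<dots> = D' * (\<Sum>k=1..2^j. (?a j k)\<^sup>2 * L j powr lam)"
      by (simp add: sum_distrib_left sum_distrib_right mult_ac)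
    also have "\<dots> \<le> D' * (\<Sum>k=1..2^j. C * ((?a j k)\<^sup>2 * l j k powr lam + (s j)\<^sup>2 * s j powr (- 3 / 4)))"
      using pt D0 by (intro mult_left_mono sum_mono) auto
    also have "\<dots> = D' * (C * ?V j + C * (2 ^ j * ((s j)\<^sup>2 * s j powr (- 3 / 4))))"
      unfolding V_eq by (simp add: sum_distrib_left sum.distrib algebra_simps)
    finally show ?thesis unfolding sq by (simp add: algebra_simps)
  qed
  show ?thesis
  proof
    assume "?W summable_on {1..}"
    then have "(\<lambda>j. (C * D) * ?W j + C * q ^ j) summable_on {1..}"
      by (intro summable_on_add summable_on_cmult_right q_summable)
    then show "?V summable_on {1..}"
      by (rule summable_on_comparison_test) (use V_le in \<open>auto intro!: sum_nonneg\<close>)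
  next
    assume "?V summable_on {1..}"
    then have "(\<lambda>j. (D' * C) * ?V j + (D' * C) * q ^ j) summable_on {1..}"
      by (intro summable_on_add summable_on_cmult_right q_summable)
    then show "?W summable_on {1..}"
      by (rule summable_on_comparison_test) (use W_le in \<open>auto intro!: sum_nonneg mult_nonneg_nonneg\<close>)
  qed
qed

end

theorem theorem2:
  fixes \<phi> \<psi> :: "complex \<Rightarrow> complex" and lam :: real
  assumes homeo: "homeomorphism (sphere 0 1) (sphere 0 1) \<phi> \<psi>"
    and lam: "lam > -1"
  shows
    "let h = poisson_extension \<phi>;
         len = (\<lambda>j k. measure arc_length (\<phi> ` dyadic_arc j k));
         i = (\<integral>\<^sup>+z\<in>ball 0 1. ennreal ((norm_D h z)\<^sup>2 * ln (exp 1 + norm_D h z) powr lam) \<partial>lborel) < \<infinity>;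
         ii = (\<integral>\<^sup>+z\<in>ball 0 1. ennreal ((norm_D h z)\<^sup>2 * ln (2 / (1 - norm z)) powr lam) \<partial>lborel) < \<infinity>;
         iii = (\<integral>\<^sup>+\<xi>. (\<integral>\<^sup>+\<eta>. ennreal (\<bar>ln (norm (\<psi> \<eta> - \<psi> \<xi>))\<bar> powr (lam + 1)) \<partial>arc_length) \<partial>arc_length) < \<infinity>;
         iv = (\<lambda>j::nat. real j powr lam * (\<Sum>k=1..2^j. (len j k)\<^sup>2)) summable_on {1..};
         v = (\<lambda>j::nat. \<Sum>k=1..2^j. (len j k)\<^sup>2 * ln (exp 1 + len j k / 2 powr (- real j)) powr lam) summable_on {1..}
     in (i \<longleftrightarrow> ii) \<and> (ii \<longleftrightarrow> iii) \<and> (iii \<longleftrightarrow> iv) \<and> (iv \<longleftrightarrow> v)"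
proof -
  interpret circle_homeomorphism \<phi> \<psi>
    by standard (rule homeo)
  show ?thesis
    unfolding Let_def
    using log_energy_iff_weighted_energy[of lam] weighted_energy_iff_log_distance[OF lam]
      dyadic_sum_iff_log_distance[OF lam] dyadic_sums_comparable[of lam]
    unfolding double_integral_def image_arc_length_def by blast
qed

end
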